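(* Let $\iota:\mathcal{G}^*\to\mathbf{G}$ be the map $\iota(F)=[\Pi_mF]$. Then $\iota$ is a linear embedding (an injective linear map). Moreover, for all $\varphi\in\mathcal{G}$, $\iota(\varphi)=[\varphi]$, where $[\varphi]$ is the class of the constant sequence with all terms equal to $\varphi$.
   Context: White noise space: $\mathcal{S}'(\mathbb{R}^d)$ with its Borel $\sigma$-field and the unique probability $\mu$ with $\int e^{i(\omega,\phi)}\,d\mu(\omega)=e^{-\frac12|\phi|^2_{L^2(\mathbb{R}^d)}}$ for $\phi\in\mathcal{S}(\mathbb{R}^d)$; $(L^2)=L^2(\mathcal{S}'(\mathbb{R}^d),\mu)$. $I_n:L^2(\mathbb{R}^d)^{\hat\otimes n}\to(L^2)$ is the multiple Wiener integral of order $n$ ($\hat\otimes$: symmetric tensor product); every $F\in(L^2)$ is uniquely $F=\sum_{n\ge0}I_n(F_n)$, with $\mathbb{E}[F^2]=\sum_n n!|F_n|_0^2$, $|\cdot|_0$ the $L^2$ norm. For $p\in\mathbb{N}_0$, $\|F\|_p^2=\sum_n e^{2pn}n!|F_n|_0^2$, $\mathcal{G}_p=\{F\in(L^2):\|F\|_p<\infty\}$, $\mathcal{G}$ is the projective limit of the $\mathcal{G}_p$, and $\mathcal{G}^*$ its dual, the inductive limit of the duals $\mathcal{G}_{-p}$. Elements of $\mathcal{G}^*$ are formal series $F=\sum_nI_n(F_n)$, $F_n\in L^2(\mathbb{R}^d)^{\hat\otimes n}$, with $\|F\|_{-p}^2=\sum_ne^{-2pn}n!|F_n|_0^2<\infty$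 for some $p\in\mathbb{N}_0$. $\mathcal{G}$ is an algebra under pointwise multiplication. For $F=\sum_nI_n(F_n)\in\mathcal{G}^*$, $\Pi_mF=\sum_{n=0}^mI_n(F_n)\in\mathcal{G}$. $\mathbf{e}=\{(a_n)_{n\in\mathbb{N}_0}\in\ell^2:\lim_n e^{nm}a_n=0\ \forall m\in\mathbb{N}_0\}$; $\mathbf{e}'=\{(b_n)_{n\in\mathbb{N}_0}:\exists\,C\in\mathbb{R},m\in\mathbb{N}_0,\ |b_n|\le Ce^{2nm}\ \forall n\}$. $G_{\mathbf{e}}=\{(\varphi_m)\in\mathcal{G}^{\mathbb{N}_0}:(\|\varphi_m\|_p)_m\in\mathbf{e}\ \forall p\in\mathbb{N}_0\}$, $G_{\mathbf{e}'}=\{(\varphi_m)\in\mathcal{G}^{\mathbb{N}_0}:(\|\varphi_m\|_p)_m\in\mathbf{e}'\ \forall p\in\mathbb{N}_0\}$; $G_{\mathbf{e}'}$ is an algebra with termwise operations, $G_{\mathbf{e}}$ an ideal of it, and $\mathbf{G}=G_{\mathbf{e}'}/G_{\mathbf{e}}$ is the algebra of stochastic generalized functions. $[\varphi_m]$ denotes the class of $(\varphi_m)$. For every $F\in\mathcal{G}^*$ one has $(\Pi_mF)_m\in G_{\mathbf{e}'}$. *)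

theory Defs
  imports "HOL-Probability.Probability" "HOL-Algebra.QuotRing" "HOL-Algebra.Module"
begin

section \<open>Square integrable functions\<close>

text \<open>Elements of an \<open>L\<^sup>2\<close> space are handled through representatives.\<close>

definition L2 :: "'x measure \<Rightarrow> ('x \<Rightarrow> real) set" where
  "L2 M = {f \<in> borel_measurable M. integrable M (\<lambda>x. (f x)\<^sup>2)}"

definition L2_sq :: "'x measure \<Rightarrow> ('x \<Rightarrow> real) \<Rightarrow> real" where
  "L2_sq M f = (LINT x|M. (f x)\<^sup>2)"

lemma L2_add:
  assumes "f \<in> L2 M" "g \<in> L2 M"
  shows "(\<lambda>x. f x + g x) \<in> L2 M"
    and "L2_sq M (\<lambda>x. f x + g x) \<le> 2 * L2_sq M f + 2 * L2_sq M g"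
proof -
  have [measurable]: "f \<in> borel_measurable M" "g \<in> borel_measurable M"
    and i: "integrable M (\<lambda>x. (f x)\<^sup>2)" "integrable M (\<lambda>x. (g x)\<^sup>2)"
    using assms by (auto simp: L2_def)
  have le: "(f x + g x)\<^sup>2 \<le> 2 * (f x)\<^sup>2 + 2 * (g x)\<^sup>2" for x
    using sum_squares_bound[of "f x" "g x"] by (simp add: power2_sum)
  have i2: "integrable M (\<lambda>x. 2 * (f x)\<^sup>2 + 2 * (g x)\<^sup>2)"
    using i by auto
  have i3: "integrable M (\<lambda>x. (f x + g x)\<^sup>2)"
    by (rule Bochner_Integration.integrable_bound[OF i2]) (use le in \<open>auto intro: order_trans\<close>)
  show "(\<lambda>x. f x + g x) \<in> L2 M"
    using i3 by (simp add: L2_def)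
  have "L2_sq M (\<lambda>x. f x + g x) \<le> (LINT x|M. 2 * (f x)\<^sup>2 + 2 * (g x)\<^sup>2)"
    unfolding L2_sq_def by (rule integral_mono[OF i3 i2 le])
  also have "\<dots> = 2 * L2_sq M f + 2 * L2_sq M g"
    using i by (simp add: L2_sq_def)
  finally show "L2_sq M (\<lambda>x. f x + g x) \<le> 2 * L2_sq M f + 2 * L2_sq M g" .
qed

lemma L2_scale:
  assumes "f \<in> L2 M"
  shows "(\<lambda>x. c * f x) \<in> L2 M" and "L2_sq M (\<lambda>x. c * f x) = c\<^sup>2 * L2_sq M f"
  using assms by (auto simp: L2_def L2_sq_def power_mult_distrib)

lemma L2_zero: "(\<lambda>x. 0) \<in> L2 M" "L2_sq M (\<lambda>x. 0) = 0"
  by (auto simp: L2_def L2_sq_def)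

lemma L2_sq_nonneg: "0 \<le> L2_sq M f"
  by (simp add: L2_sq_def)

lemma L2_sq_cong_AE:
  assumes "f \<in> borel_measurable M" "g \<in> borel_measurable M" "AE x in M. f x = g x"
  shows "L2_sq M f = L2_sq M g"
  unfolding L2_sq_def by (rule integral_cong_AE) (use assms in auto)


section \<open>Schwartz functions and tempered distributions\<close>

primrec iter_deriv :: "'a::euclidean_space list \<Rightarrow> ('a \<Rightarrow> real) \<Rightarrow> 'a \<Rightarrow> real" where
  "iter_deriv [] f = f"
| "iter_deriv (b # bs) f = (\<lambda>x. frechet_derivative (iter_deriv bs f) (at x) b)"

text \<open>Iterated partial derivatives are indexed by lists of coordinate directions.  Differentiability
  of all of them amounts to smoothness.\<close>

definition schwartz_fun :: "('a::euclidean_space \<Rightarrow> real) \<Rightarrow> bool" where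
  "schwartz_fun f \<longleftrightarrow> (\<forall>bs \<in> lists Basis. (\<forall>x. iter_deriv bs f differentiable at x) \<and>
      (\<forall>k::nat. \<exists>C. \<forall>x. norm x ^ k * \<bar>iter_deriv bs f x\<bar> \<le> C))"

lemma iter_deriv_zero: "iter_deriv bs (\<lambda>x. 0) = (\<lambda>x. 0)"
  by (induction bs) auto

lemma iter_deriv_linear:
  assumes "schwartz_fun f" "schwartz_fun g" "bs \<in> lists Basis"
  shows "iter_deriv bs (\<lambda>x. a * f x + b * g x) =
    (\<lambda>x. a * iter_deriv bs f x + b * iter_deriv bs g x)"
  using assms(3)
proof (induction bs)
  case (Cons c bs)
  then have bs: "bs \<in> lists Basis" by auto
  have d: "iter_deriv bs f differentiable at x" "iter_deriv bs g differentiable at x" for x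
    using assms(1,2) bs by (auto simp: schwartz_fun_def)
  have "frechet_derivative (\<lambda>x. a * iter_deriv bs f x + b * iter_deriv bs g x) (at x) =
    (\<lambda>h. a * frechet_derivative (iter_deriv bs f) (at x) h
       + b * frechet_derivative (iter_deriv bs g) (at x) h)" for x
    using d[of x]
    by (intro frechet_derivative_at[symmetric]) (auto simp: frechet_derivative_works intro!: derivative_intros)
  then show ?case
    using Cons.IH by simp
qed simp

lemma schwartz_fun_linear:
  assumes f: "schwartz_fun f" and g: "schwartz_fun g"
  shows "schwartz_fun (\<lambda>x. a * f x + b * g x)"
  unfolding schwartz_fun_def
proof (intro ballI conjI allI)
  fix bs :: "'a list" and x assume bs: "bs \<in> lists Basis"
  have "iter_deriv bs f differentiable at x" "iter_deriv bs g differentiable at x"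
    using f g bs by (auto simp: schwartz_fun_def)
  then show "iter_deriv bs (\<lambda>x. a * f x + b * g x) differentiable at x"
    unfolding iter_deriv_linear[OF f g bs] by simp
next
  fix bs :: "'a list" and k :: nat assume bs: "bs \<in> lists Basis"
  obtain C where C: "\<And>x. norm x ^ k * \<bar>iter_deriv bs f x\<bar> \<le> C"
    using f bs unfolding schwartz_fun_def by blast
  obtain D where D: "\<And>x. norm x ^ k * \<bar>iter_deriv bs g x\<bar> \<le> D"
    using g bs unfolding schwartz_fun_def by blast
  have "norm x ^ k * \<bar>a * iter_deriv bs f x + b * iter_deriv bs g x\<bar> \<le> \<bar>a\<bar> * C + \<bar>b\<bar> * D" for x
  proof -
    have "norm x ^ k * \<bar>a * iter_deriv bs f x + b * iter_deriv bs g x\<bar>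
        \<le> norm x ^ k * (\<bar>a\<bar> * \<bar>iter_deriv bs f x\<bar> + \<bar>b\<bar> * \<bar>iter_deriv bs g x\<bar>)"
      by (intro mult_left_mono order_trans[OF abs_triangle_ineq]) (auto simp: abs_mult)
    also have "\<dots> = \<bar>a\<bar> * (norm x ^ k * \<bar>iter_deriv bs f x\<bar>) + \<bar>b\<bar> * (norm x ^ k * \<bar>iter_deriv bs g x\<bar>)"
      by (simp add: algebra_simps)
    also have "\<dots> \<le> \<bar>a\<bar> * C + \<bar>b\<bar> * D"
      by (intro add_mono mult_left_mono C D) auto
    finally show ?thesis .
  qed
  then show "\<exists>C. \<forall>x. norm x ^ k * \<bar>iter_deriv bs (\<lambda>x. a * f x + b * g x) x\<bar> \<le> C"
    unfolding iter_deriv_linear[OF f g bs] by blast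
qed

lemma schwartz_fun_zero: "schwartz_fun (\<lambda>x. 0)"
  by (auto simp: schwartz_fun_def iter_deriv_zero)

typedef (overloaded) 'a schwartz = "{f :: 'a::euclidean_space \<Rightarrow> real. schwartz_fun f}"
  morphisms schwartz_apply Schwartz
  using schwartz_fun_zero by blast

setup_lifting type_definition_schwartz

instantiation schwartz :: (euclidean_space) real_vector
begin

lift_definition zero_schwartz :: "'a schwartz" is "\<lambda>x. 0"
  by (rule schwartz_fun_zero)

lift_definition plus_schwartz :: "'a schwartz \<Rightarrow> 'a schwartz \<Rightarrow> 'a schwartz" is "\<lambda>f g x. f x + g x"
  using schwartz_fun_linear[where a = 1 and b = 1] by simp

lift_definition minus_schwartz :: "'a schwartz \<Rightarrow> 'a schwartz \<Rightarrow> 'a schwartz" is "\<lambda>f g x. f x - g x"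
  using schwartz_fun_linear[where a = 1 and b = "-1"] by simp

lift_definition uminus_schwartz :: "'a schwartz \<Rightarrow> 'a schwartz" is "\<lambda>f x. - f x"
  using schwartz_fun_linear[where a = "-1" and b = 0] by fastforce

lift_definition scaleR_schwartz :: "real \<Rightarrow> 'a schwartz \<Rightarrow> 'a schwartz" is "\<lambda>c f x. c * f x"
  using schwartz_fun_linear[where b = 0] by fastforce

instance
  by standard (transfer; auto simp: algebra_simps)+

end

definition schwartz_seminorm :: "nat \<Rightarrow> 'a::euclidean_space list \<Rightarrow> 'a schwartz \<Rightarrow> real" where
  "schwartz_seminorm k bs \<phi> = (SUP x. norm x ^ k * \<bar>iter_deriv bs (schwartz_apply \<phi>) x\<bar>)"

text \<open>The locally convex topology generated by the seminorms.\<close>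

instantiation schwartz :: (euclidean_space) topological_space
begin

definition open_schwartz :: "'a schwartz set \<Rightarrow> bool" where
  "open_schwartz U \<longleftrightarrow> (\<forall>\<phi>\<in>U. \<exists>N. \<exists>\<epsilon>>0. \<forall>\<psi>.
      (\<forall>k\<le>N. \<forall>bs\<in>lists Basis. length bs \<le> N \<longrightarrow> schwartz_seminorm k bs (\<psi> - \<phi>) < \<epsilon>) \<longrightarrow> \<psi> \<in> U)"

instance
proof
  show "open (UNIV :: 'a schwartz set)"
    by (auto simp: open_schwartz_def intro: exI[of _ 1])
next
  fix S T :: "'a schwartz set" assume S: "open S" and T: "open T"
  show "open (S \<inter> T)"
    unfolding open_schwartz_def
  proof
    fix \<phi> assume "\<phi> \<in> S \<inter> T"
    then obtain N1 e1 N2 e2 where "e1 > 0" "e2 > 0" and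
      1: "\<And>\<psi>. (\<forall>k\<le>N1. \<forall>bs\<in>lists Basis. length bs \<le> N1 \<longrightarrow> schwartz_seminorm k bs (\<psi> - \<phi>) < e1) \<Longrightarrow> \<psi> \<in> S" and
      2: "\<And>\<psi>. (\<forall>k\<le>N2. \<forall>bs\<in>lists Basis. length bs \<le> N2 \<longrightarrow> schwartz_seminorm k bs (\<psi> - \<phi>) < e2) \<Longrightarrow> \<psi> \<in> T"
      using S T unfolding open_schwartz_def by (metis IntE)
    show "\<exists>N. \<exists>\<epsilon>>0. \<forall>\<psi>. (\<forall>k\<le>N. \<forall>bs\<in>lists Basis. length bs \<le> N \<longrightarrow>
        schwartz_seminorm k bs (\<psi> - \<phi>) < \<epsilon>) \<longrightarrow> \<psi> \<in> S \<inter> T"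
      by (rule exI[of _ "max N1 N2"], rule exI[of _ "min e1 e2"])
         (use \<open>e1 > 0\<close> \<open>e2 > 0\<close> in \<open>simp; metis 1 2 le_max_iff_disj\<close>)
  qed
next
  fix K :: "'a schwartz set set" assume K: "\<forall>S\<in>K. open S"
  show "open (\<Union>K)"
    unfolding open_schwartz_def
  proof
    fix \<phi> assume "\<phi> \<in> \<Union>K"
    then obtain S where "S \<in> K" "\<phi> \<in> S" by blast
    then obtain N e where "e > 0" and
      "\<And>\<psi>. (\<forall>k\<le>N. \<forall>bs\<in>lists Basis. length bs \<le> N \<longrightarrow> schwartz_seminorm k bs (\<psi> - \<phi>) < e) \<Longrightarrow> \<psi> \<in> S"
      using K unfolding open_schwartz_def by metis
    then show "\<exists>N. \<exists>\<epsilon>>0. \<forall>\<psi>. (\<forall>k\<le>N. \<forall>bs\<in>lists Basis. length bs \<le> N \<longrightarrow>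
        schwartz_seminorm k bs (\<psi> - \<phi>) < \<epsilon>) \<longrightarrow> \<psi> \<in> \<Union>K"
      using \<open>S \<in> K\<close> by blast
  qed
qed

end

definition tempered_distributions :: "('a::euclidean_space schwartz \<Rightarrow> real) set" where
  "tempered_distributions = {\<omega>. linear \<omega> \<and> continuous_on UNIV \<omega>}"

abbreviation schwartz_sq :: "'a::euclidean_space schwartz \<Rightarrow> real" where
  "schwartz_sq \<phi> \<equiv> L2_sq lborel (schwartz_apply \<phi>)"


section \<open>White noise and multiple Wiener integrals\<close>

text \<open>Functions into \<open>\<real>\<close> carry the product topology, so that the Borel sets of the subspace of tempered
  distributions belong to the weak-* topology (the strong dual topology has the same Borel sets).
  The characteristic functional determines the measure.\<close>

definition white_noise :: "('a::euclidean_space schwartz \<Rightarrow> real) measure \<Rightarrow> bool" where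
  "white_noise \<mu> \<longleftrightarrow> prob_space \<mu> \<and>
     sets \<mu> = sets (restrict_space borel tempered_distributions) \<and>
     (\<forall>\<phi>. (LINT \<omega>|\<mu>. exp (\<i> * complex_of_real (\<omega> \<phi>))) = complex_of_real (exp (- schwartz_sq \<phi> / 2)))"

text \<open>A point of the \<open>n\<close>-fold product is a function on \<open>{..<n}\<close>; for \<open>n = 0\<close> the product measure is a
  point mass, so that kernels of order \<open>0\<close> are constants.\<close>

abbreviation lborel_pow :: "nat \<Rightarrow> (nat \<Rightarrow> 'a::euclidean_space) measure" where
  "lborel_pow n \<equiv> PiM {..<n} (\<lambda>_. lborel)"

definition L2_sym :: "nat \<Rightarrow> ((nat \<Rightarrow> 'a::euclidean_space) \<Rightarrow> real) set" where
  "L2_sym n = {f \<in> L2 (lborel_pow n).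
     \<forall>\<sigma>. \<sigma> permutes {..<n} \<longrightarrow> (AE x in lborel_pow n. f (x \<circ> \<sigma>) = f x)}"

definition tensor_power :: "nat \<Rightarrow> 'a::euclidean_space schwartz \<Rightarrow> (nat \<Rightarrow> 'a) \<Rightarrow> real" where
  "tensor_power n \<phi> x = (\<Prod>i<n. schwartz_apply \<phi> (x i))"

text \<open>Monic Hermite polynomials for the centred Gaussian law of variance \<open>v\<close>.\<close>

fun hermite :: "real \<Rightarrow> nat \<Rightarrow> real \<Rightarrow> real" where
  "hermite v 0 x = 1"
| "hermite v (Suc 0) x = x"
| "hermite v (Suc (Suc n)) x = x * hermite v (Suc n) x - of_nat (Suc n) * v * hermite v n x"

definition wick_power :: "nat \<Rightarrow> 'a::euclidean_space schwartz \<Rightarrow> ('a schwartz \<Rightarrow> real) \<Rightarrow> real" where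
  "wick_power n \<phi> \<omega> = hermite (schwartz_sq \<phi>) n (\<omega> \<phi>)"

text \<open>The multiple Wiener integral of order \<open>n\<close> is the continuous linear extension to all symmetric kernels of
  the map that sends the \<open>n\<close>-th tensor power of \<open>\<phi>\<close> to the \<open>n\<close>-th Wick power of the Gaussian variable
  \<open>\<omega> \<mapsto> \<omega> \<phi>\<close>: its graph is the \<open>L\<^sup>2\<close>-closure of the graph on the span of the tensor powers.\<close>

definition has_wiener_integral ::
  "('a::euclidean_space schwartz \<Rightarrow> real) measure \<Rightarrow> nat \<Rightarrow> ((nat \<Rightarrow> 'a) \<Rightarrow> real) \<Rightarrow>
    (('a schwartz \<Rightarrow> real) \<Rightarrow> real) \<Rightarrow> bool" where
  "has_wiener_integral \<mu> n f J \<longleftrightarrow> J \<in> L2 \<mu> \<and>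
     (\<forall>\<epsilon>>0. \<exists>A c. finite A \<and>
        L2_sq (lborel_pow n) (\<lambda>x. f x - (\<Sum>\<phi>\<in>A. c \<phi> * tensor_power n \<phi> x)) < \<epsilon> \<and>
        L2_sq \<mu> (\<lambda>\<omega>. J \<omega> - (\<Sum>\<phi>\<in>A. c \<phi> * wick_power n \<phi> \<omega>)) < \<epsilon>)"

definition wiener_integral ::
  "('a::euclidean_space schwartz \<Rightarrow> real) measure \<Rightarrow> nat \<Rightarrow> ((nat \<Rightarrow> 'a) \<Rightarrow> real) \<Rightarrow>
    ('a schwartz \<Rightarrow> real) \<Rightarrow> real" where
  "wiener_integral \<mu> n f = (SOME J. has_wiener_integral \<mu> n f J)"


section \<open>Regular generalized functions\<close>

text \<open>The squared norm of index \<open>p\<close> of a chaos series, for positive and negative \<open>p\<close>, is the sum of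
  these terms.\<close>

definition chaos_term :: "int \<Rightarrow> (nat \<Rightarrow> (nat \<Rightarrow> 'a::euclidean_space) \<Rightarrow> real) \<Rightarrow> nat \<Rightarrow> real" where
  "chaos_term p F n = exp (2 * of_int p * of_nat n) * fact n * L2_sq (lborel_pow n) (F n)"

text \<open>Elements of the dual are formal chaos series: two sequences of kernels give the same generalized function iff their
  kernels agree almost everywhere.\<close>

definition regular_kernels :: "(nat \<Rightarrow> (nat \<Rightarrow> 'a::euclidean_space) \<Rightarrow> real) set" where
  "regular_kernels = {F. (\<forall>n. F n \<in> L2_sym n) \<and> (\<exists>p::nat. summable (chaos_term (- int p) F))}"

definition kernels_eq :: "(nat \<Rightarrow> (nat \<Rightarrow> 'a::euclidean_space) \<Rightarrow> real) \<Rightarrow>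
    (nat \<Rightarrow> (nat \<Rightarrow> 'a) \<Rightarrow> real) \<Rightarrow> bool" where
  "kernels_eq F H \<longleftrightarrow> F \<in> regular_kernels \<and> H \<in> regular_kernels \<and>
     (\<forall>n. AE x in lborel_pow n. F n x = H n x)"

lemma L2_sym_linear:
  assumes "f \<in> L2_sym n" "g \<in> L2_sym n"
  shows "(\<lambda>x. a * f x + b * g x) \<in> L2_sym n"
proof -
  have "(\<lambda>x. a * f x + b * g x) \<in> L2 (lborel_pow n)"
    using assms by (intro L2_add L2_scale) (auto simp: L2_sym_def)
  moreover have "AE x in lborel_pow n. a * f (x \<circ> \<sigma>) + b * g (x \<circ> \<sigma>) = a * f x + b * g x"
    if "\<sigma> permutes {..<n}" for \<sigma>
  proof -
    have "AE x in lborel_pow n. f (x \<circ> \<sigma>) = f x" "AE x in lborel_pow n. g (x \<circ> \<sigma>) = g x"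
      using assms that by (auto simp: L2_sym_def)
    then show ?thesis by eventually_elim simp
  qed
  ultimately show ?thesis by (simp add: L2_sym_def)
qed

lemma chaos_term_nonneg: "0 \<le> chaos_term p F n"
  by (simp add: chaos_term_def L2_sq_nonneg)

lemma chaos_term_mono: "p \<le> q \<Longrightarrow> chaos_term p F n \<le> chaos_term q F n"
  unfolding chaos_term_def by (intro mult_right_mono) (auto simp: L2_sq_nonneg mult_right_mono)

lemma regular_kernels_linear:
  assumes "F \<in> regular_kernels" "H \<in> regular_kernels"
  shows "(\<lambda>n x. a * F n x + b * H n x) \<in> regular_kernels"
proof -
  obtain p q :: nat where p: "summable (chaos_term (- int p) F)" and q: "summable (chaos_term (- int q) H)"
    using assms by (auto simp: regular_kernels_def)
  let ?r = "max p q" and ?L = "\<lambda>n x. a * F n x + b * H n x"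
  have p': "summable (chaos_term (- int ?r) F)"
    by (rule summable_comparison_test'[OF p, of 0]) (auto simp: chaos_term_nonneg intro!: chaos_term_mono)
  have q': "summable (chaos_term (- int ?r) H)"
    by (rule summable_comparison_test'[OF q, of 0]) (auto simp: chaos_term_nonneg intro!: chaos_term_mono)
  have in_L2: "F n \<in> L2 (lborel_pow n)" "H n \<in> L2 (lborel_pow n)" for n
    using assms by (auto simp: regular_kernels_def L2_sym_def)
  have le: "chaos_term (- int ?r) ?L n \<le>
      2 * a\<^sup>2 * chaos_term (- int ?r) F n + 2 * b\<^sup>2 * chaos_term (- int ?r) H n" for n
  proof -
    have "L2_sq (lborel_pow n) (?L n) \<le>
        2 * (a\<^sup>2 * L2_sq (lborel_pow n) (F n)) + 2 * (b\<^sup>2 * L2_sq (lborel_pow n) (H n))"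
      using L2_add(2)[OF L2_scale(1)[OF in_L2(1)[of n], of a] L2_scale(1)[OF in_L2(2)[of n], of b]]
      by (simp add: L2_scale(2)[OF in_L2(1)[of n]] L2_scale(2)[OF in_L2(2)[of n]])
    then have "chaos_term (- int ?r) ?L n \<le> exp (2 * of_int (- int ?r) * of_nat n) * fact n *
        (2 * (a\<^sup>2 * L2_sq (lborel_pow n) (F n)) + 2 * (b\<^sup>2 * L2_sq (lborel_pow n) (H n)))"
      unfolding chaos_term_def by (intro mult_left_mono) auto
    then show ?thesis by (simp add: chaos_term_def algebra_simps)
  qed
  have "summable (\<lambda>n. 2 * a\<^sup>2 * chaos_term (- int ?r) F n + 2 * b\<^sup>2 * chaos_term (- int ?r) H n)"
    by (intro summable_add summable_mult p' q')
  then have "summable (chaos_term (- int ?r) ?L)"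
    by (rule summable_comparison_test'[of _ 0]) (use le in \<open>auto simp: chaos_term_nonneg\<close>)
  moreover have "?L n \<in> L2_sym n" for n
    using assms by (intro L2_sym_linear) (auto simp: regular_kernels_def)
  ultimately show ?thesis
    unfolding regular_kernels_def by blast
qed

lemma regular_kernels_zero: "(\<lambda>n (x :: nat \<Rightarrow> 'a::euclidean_space). 0) \<in> regular_kernels"
proof -
  have "chaos_term p (\<lambda>n (x :: nat \<Rightarrow> 'a). 0) = (\<lambda>n. 0)" for p
    by (simp add: fun_eq_iff chaos_term_def L2_zero)
  then show ?thesis
    by (simp add: regular_kernels_def L2_sym_def L2_zero)
qed

lemma kernels_eq_linear:
  assumes "kernels_eq F F'" "kernels_eq H H'"
  shows "kernels_eq (\<lambda>n x. a * F n x + b * H n x) (\<lambda>n x. a * F' n x + b * H' n x)"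
proof -
  have "AE x in lborel_pow n. a * F n x + b * H n x = a * F' n x + b * H' n x" for n
  proof -
    have "AE x in lborel_pow n. F n x = F' n x" "AE x in lborel_pow n. H n x = H' n x"
      using assms by (auto simp: kernels_eq_def)
    then show ?thesis by eventually_elim simp
  qed
  then show ?thesis
    using assms by (auto simp: kernels_eq_def intro!: regular_kernels_linear)
qed

quotient_type (overloaded) 'a Gstar = "nat \<Rightarrow> (nat \<Rightarrow> 'a::euclidean_space) \<Rightarrow> real" / partial: kernels_eq
proof (rule part_equivpI)
  show "\<exists>F :: nat \<Rightarrow> (nat \<Rightarrow> 'a) \<Rightarrow> real. kernels_eq F F"
    using regular_kernels_zero by (auto simp: kernels_eq_def)
  show "symp (kernels_eq :: (nat \<Rightarrow> (nat \<Rightarrow> 'a) \<Rightarrow> real) \<Rightarrow> _)"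
    by (auto simp: symp_def kernels_eq_def eq_commute)
  show "transp (kernels_eq :: (nat \<Rightarrow> (nat \<Rightarrow> 'a) \<Rightarrow> real) \<Rightarrow> _)"
  proof (rule transpI)
    fix F H K :: "nat \<Rightarrow> (nat \<Rightarrow> 'a) \<Rightarrow> real"
    assume *: "kernels_eq F H" "kernels_eq H K"
    have "AE x in lborel_pow n. F n x = K n x" for n
    proof -
      have "AE x in lborel_pow n. F n x = H n x" "AE x in lborel_pow n. H n x = K n x"
        using * by (auto simp: kernels_eq_def)
      then show ?thesis by eventually_elim simp
    qed
    then show "kernels_eq F K" using * by (auto simp: kernels_eq_def)
  qed
qed

instantiation Gstar :: (euclidean_space) real_vector
begin

lift_definition zero_Gstar :: "'a Gstar" is "\<lambda>n x. 0"
  using regular_kernels_zero by (auto simp: kernels_eq_def)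

lift_definition plus_Gstar :: "'a Gstar \<Rightarrow> 'a Gstar \<Rightarrow> 'a Gstar" is "\<lambda>F H n x. F n x + H n x"
  using kernels_eq_linear[where a = 1 and b = 1] by simp

lift_definition minus_Gstar :: "'a Gstar \<Rightarrow> 'a Gstar \<Rightarrow> 'a Gstar" is "\<lambda>F H n x. F n x - H n x"
  using kernels_eq_linear[where a = 1 and b = "-1"] by simp

lift_definition uminus_Gstar :: "'a Gstar \<Rightarrow> 'a Gstar" is "\<lambda>F n x. - F n x"
  using kernels_eq_linear[where a = "-1" and b = 0] by fastforce

lift_definition scaleR_Gstar :: "real \<Rightarrow> 'a Gstar \<Rightarrow> 'a Gstar" is "\<lambda>c F n x. c * F n x"
  using kernels_eq_linear[where b = 0] by fastforce

lemma kernels_eq_reflI: "F \<in> regular_kernels \<Longrightarrow> H = F \<Longrightarrow> kernels_eq H F"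
  by (simp add: kernels_eq_def)

instance
proof
  fix a b c :: "'a Gstar" and r s :: real
  show "a + b + c = a + (b + c)"
    by transfer (rule kernels_eq_reflI;
      simp add: kernels_eq_def regular_kernels_linear[where a=1 and b=1, simplified] add.assoc)
  show "a + b = b + a"
    by transfer (rule kernels_eq_reflI;
      simp add: kernels_eq_def regular_kernels_linear[where a=1 and b=1, simplified] add.commute)
  show "0 + a = a"
    by transfer (simp add: kernels_eq_def)
  show "- a + a = 0"
    by transfer (simp add: kernels_eq_def regular_kernels_zero)
  show "a - b = a + - b"
    by transfer (rule kernels_eq_reflI;
      simp add: kernels_eq_def regular_kernels_linear[where a=1 and b="-1", simplified])
  show "r *\<^sub>R (a + b) = r *\<^sub>R a + r *\<^sub>R b"
    by transfer (rule kernels_eq_reflI;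
      simp add: kernels_eq_def regular_kernels_linear distrib_left)
  show "(r + s) *\<^sub>R a = r *\<^sub>R a + s *\<^sub>R a"
    by transfer (rule kernels_eq_reflI;
      simp add: kernels_eq_def regular_kernels_linear distrib_right)
  show "r *\<^sub>R s *\<^sub>R a = (r * s) *\<^sub>R a"
    by transfer (rule kernels_eq_reflI;
      simp add: kernels_eq_def regular_kernels_linear[where b=0, simplified] mult.assoc)
  show "1 *\<^sub>R a = a"
    by transfer (simp add: kernels_eq_def)
qed

end

lemma has_wiener_integral_cong:
  assumes f: "f \<in> L2 (lborel_pow n)" and g: "g \<in> L2 (lborel_pow n)"
    and "AE x in lborel_pow n. f x = g x"
  shows "has_wiener_integral \<mu> n f = has_wiener_integral \<mu> n g"
proof -
  have [measurable]: "schwartz_apply \<phi> \<in> borel_measurable borel" for \<phi> :: "'a schwartz"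
  proof (rule borel_measurable_continuous_onI)
    have "\<forall>x. iter_deriv [] (schwartz_apply \<phi>) differentiable at x"
      using schwartz_apply[of \<phi>] unfolding schwartz_fun_def by blast
    then show "continuous_on UNIV (schwartz_apply \<phi>)"
      by (auto intro!: differentiable_imp_continuous_on differentiable_at_imp_differentiable_on)
  qed
  have t [measurable]: "tensor_power n \<phi> \<in> borel_measurable (lborel_pow n)" for \<phi> :: "'a schwartz"
    unfolding tensor_power_def by measurable
  have [measurable]: "f \<in> borel_measurable (lborel_pow n)" "g \<in> borel_measurable (lborel_pow n)"
    using f g by (auto simp: L2_def)
  have "L2_sq (lborel_pow n) (\<lambda>x. f x - (\<Sum>\<phi>\<in>A. c \<phi> * tensor_power n \<phi> x)) =
        L2_sq (lborel_pow n) (\<lambda>x. g x - (\<Sum>\<phi>\<in>A. c \<phi> * tensor_power n \<phi> x))" for A c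
    by (rule L2_sq_cong_AE) (use assms(3) in auto)
  then show ?thesis
    by (simp add: has_wiener_integral_def fun_eq_iff)
qed

lift_definition chaos_truncation ::
  "('a::euclidean_space schwartz \<Rightarrow> real) measure \<Rightarrow> nat \<Rightarrow> 'a Gstar \<Rightarrow> ('a schwartz \<Rightarrow> real) \<Rightarrow> real"
  is "\<lambda>\<mu> m F \<omega>. \<Sum>n\<le>m. wiener_integral \<mu> n (F n) \<omega>"
proof -
  fix \<mu> :: "('a schwartz \<Rightarrow> real) measure" and m and F H :: "nat \<Rightarrow> (nat \<Rightarrow> 'a) \<Rightarrow> real"
  assume "kernels_eq F H"
  then have "wiener_integral \<mu> n (F n) = wiener_integral \<mu> n (H n)" for n
    unfolding wiener_integral_def
    by (subst has_wiener_integral_cong[where g = "H n"])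
       (auto simp: kernels_eq_def regular_kernels_def L2_sym_def)
  then show "(\<lambda>\<omega>. \<Sum>n\<le>m. wiener_integral \<mu> n (F n) \<omega>) = (\<lambda>\<omega>. \<Sum>n\<le>m. wiener_integral \<mu> n (H n) \<omega>)"
    by simp
qed


section \<open>Regular test functions\<close>

definition has_chaos_expansion ::
  "('a::euclidean_space schwartz \<Rightarrow> real) measure \<Rightarrow> (('a schwartz \<Rightarrow> real) \<Rightarrow> real) \<Rightarrow>
    (nat \<Rightarrow> (nat \<Rightarrow> 'a) \<Rightarrow> real) \<Rightarrow> bool" where
  "has_chaos_expansion \<mu> \<phi> F \<longleftrightarrow> (\<forall>n. F n \<in> L2_sym n) \<and>
     (\<lambda>m. L2_sq \<mu> (\<lambda>\<omega>. \<phi> \<omega> - (\<Sum>n\<le>m. wiener_integral \<mu> n (F n) \<omega>))) \<longlonglongrightarrow> 0"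

text \<open>By the chaos decomposition, kernels exist for every element of \<open>L\<^sup>2(\<mu>)\<close> and are unique up to null
  sets; so the existence clause in \<open>Gp\<close> below does not restrict that space.\<close>

definition chaos_kernels ::
  "('a::euclidean_space schwartz \<Rightarrow> real) measure \<Rightarrow> (('a schwartz \<Rightarrow> real) \<Rightarrow> real) \<Rightarrow>
    (nat \<Rightarrow> (nat \<Rightarrow> 'a) \<Rightarrow> real)" where
  "chaos_kernels \<mu> \<phi> = (SOME F. has_chaos_expansion \<mu> \<phi> F)"

definition Gp :: "nat \<Rightarrow> ('a::euclidean_space schwartz \<Rightarrow> real) measure \<Rightarrow> (('a schwartz \<Rightarrow> real) \<Rightarrow> real) set" where
  "Gp p \<mu> = {\<phi> \<in> L2 \<mu>. has_chaos_expansion \<mu> \<phi> (chaos_kernels \<mu> \<phi>) \<and>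
     summable (chaos_term (int p) (chaos_kernels \<mu> \<phi>))}"

definition G_norm :: "nat \<Rightarrow> ('a::euclidean_space schwartz \<Rightarrow> real) measure \<Rightarrow> (('a schwartz \<Rightarrow> real) \<Rightarrow> real) \<Rightarrow> real" where
  "G_norm p \<mu> \<phi> = sqrt (\<Sum>n. chaos_term (int p) (chaos_kernels \<mu> \<phi>) n)"

definition G_test :: "('a::euclidean_space schwartz \<Rightarrow> real) measure \<Rightarrow> (('a schwartz \<Rightarrow> real) \<Rightarrow> real) set" where
  "G_test \<mu> = (\<Inter>p. Gp p \<mu>)"

definition Gstar_of :: "('a::euclidean_space schwartz \<Rightarrow> real) measure \<Rightarrow> (('a schwartz \<Rightarrow> real) \<Rightarrow> real) \<Rightarrow> 'a Gstar" where
  "Gstar_of \<mu> \<phi> = abs_Gstar (chaos_kernels \<mu> \<phi>)"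


section \<open>Stochastic generalized functions\<close>

definition seq_e :: "(nat \<Rightarrow> real) set" where
  "seq_e = {a. summable (\<lambda>n. (a n)\<^sup>2) \<and> (\<forall>m::nat. (\<lambda>n. exp (real n * real m) * a n) \<longlonglongrightarrow> 0)}"

definition seq_e' :: "(nat \<Rightarrow> real) set" where
  "seq_e' = {b. \<exists>C. \<exists>m::nat. \<forall>n. \<bar>b n\<bar> \<le> C * exp (2 * real n * real m)}"

type_synonym 'a random_seq = "nat \<Rightarrow> ('a schwartz \<Rightarrow> real) \<Rightarrow> real"

definition G_e :: "('a::euclidean_space schwartz \<Rightarrow> real) measure \<Rightarrow> 'a random_seq set" where
  "G_e \<mu> = {\<phi>. (\<forall>m. \<phi> m \<in> G_test \<mu>) \<and> (\<forall>p. (\<lambda>m. G_norm p \<mu> (\<phi> m)) \<in> seq_e)}"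

definition G_e' :: "('a::euclidean_space schwartz \<Rightarrow> real) measure \<Rightarrow> 'a random_seq set" where
  "G_e' \<mu> = {\<phi>. (\<forall>m. \<phi> m \<in> G_test \<mu>) \<and> (\<forall>p. (\<lambda>m. G_norm p \<mu> (\<phi> m)) \<in> seq_e')}"

definition G_e'_algebra :: "('a::euclidean_space schwartz \<Rightarrow> real) measure \<Rightarrow> (real, 'a random_seq) module" where
  "G_e'_algebra \<mu> = \<lparr>carrier = G_e' \<mu>,
     mult = (\<lambda>\<phi> \<psi> m \<omega>. \<phi> m \<omega> * \<psi> m \<omega>), one = (\<lambda>m \<omega>. 1),
     zero = (\<lambda>m \<omega>. 0), add = (\<lambda>\<phi> \<psi> m \<omega>. \<phi> m \<omega> + \<psi> m \<omega>),
     smult = (\<lambda>c \<phi> m \<omega>. c * \<phi> m \<omega>)\<rparr>"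

definition gen_class :: "('a::euclidean_space schwartz \<Rightarrow> real) measure \<Rightarrow> 'a random_seq \<Rightarrow> 'a random_seq set" where
  "gen_class \<mu> \<phi> = G_e \<mu> +>\<^bsub>G_e'_algebra \<mu>\<^esub> \<phi>"

text \<open>The quotient by the ideal \<^term>\<open>G_e \<mu>\<close>, which contains all sequences of null functions; hence
  working with representatives in \<^term>\<open>G_test \<mu>\<close> does not change it.  The scalar multiplication
  follows the pattern of \<^const>\<open>rcoset_mult\<close>.\<close>

definition gen_algebra :: "('a::euclidean_space schwartz \<Rightarrow> real) measure \<Rightarrow> (real, 'a random_seq set) module" where
  "gen_algebra \<mu> = ring.extend (G_e'_algebra \<mu> Quot G_e \<mu>)
     (module.fields (\<lambda>c X. \<Union>\<phi>\<in>X. gen_class \<mu> (c \<odot>\<^bsub>G_e'_algebra \<mu>\<^esub> \<phi>)))"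

definition gen_embedding :: "('a::euclidean_space schwartz \<Rightarrow> real) measure \<Rightarrow> 'a Gstar \<Rightarrow> 'a random_seq set" where
  "gen_embedding \<mu> F = gen_class \<mu> (\<lambda>m. chaos_truncation \<mu> m F)"

end

theory Submission
  imports Defs
begin

text \<open>
  Everything rests on two facts about the multiple Wiener integrals \<open>I\<^sub>n\<close>.  They exist for all
  symmetric square integrable kernels, and they satisfy \<open>E[I\<^sub>n(f) I\<^sub>m(g)] = n! (f, g)\<close> if \<open>n = m\<close> and
  \<open>0\<close> otherwise.  Granted these, \<open>\<parallel>\<Pi>\<^sub>m F\<parallel>\<^sub>p\<^sup>2\<close> is the sum of \<open>exp (2 p n) n! |F\<^sub>n|\<^sup>2\<close> over \<open>n \<le> m\<close>, and
  each assertion becomes an estimate for nonnegative series.  If \<open>\<parallel>F\<parallel>\<^sub>-\<^sub>q\<close> is finite, then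
  \<open>\<parallel>\<Pi>\<^sub>m F\<parallel>\<^sub>p \<le> exp ((p + q) m) \<parallel>F\<parallel>\<^sub>-\<^sub>q\<close>, so that the truncations form a moderate sequence
  (\<open>chaos_sum_moderate\<close>).  The numbers \<open>\<parallel>\<Pi>\<^sub>m F\<parallel>\<^sub>0\<close> increase with \<open>m\<close> and therefore tend to \<open>0\<close> only if
  \<open>F = 0\<close>, which gives injectivity (\<open>chaos_sum_negligible_imp_zero\<close>).  For a test function \<open>\<phi>\<close> the
  remainders satisfy \<open>\<parallel>\<phi> - \<Pi>\<^sub>m \<phi>\<parallel>\<^sub>p \<le> exp (- k m) \<parallel>\<phi>\<parallel>\<^sub>p\<^sub>+\<^sub>k\<close> for every \<open>k\<close>, hence they are negligible
  (\<open>chaos_sum_converges\<close>).  The class map is linear because the negligible sequences are a subspace;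
  integrals are representatives and linear only almost surely, which the negligible sequences of null
  functions absorb (\<open>G_e_null\<close>).

  Orthogonality (\<open>L2_inner_wick_power\<close>) is a computation with Hermite polynomials of jointly Gaussian
  variables.  The characteristic functional gives the law of \<open>\<omega> \<mapsto> \<omega> (s \<phi> + \<psi>)\<close> for each real \<open>s\<close>; its
  moments are polynomials in \<open>s\<close> with the mixed moments of \<open>\<omega> \<phi>\<close> and \<open>\<omega> \<psi>\<close> as coefficients up to
  binomial factors, and differentiation in \<open>s\<close> yields Gaussian integration by parts for polynomials.

  Existence (\<open>has_wiener_integral_exists\<close>) follows from the isometry and completeness of \<open>L\<^sup>2\<close> once the
  tensor powers of Schwartz functions span a dense subspace of the symmetric kernels
  (\<open>tensor_powers_dense\<close>).  By orthogonal projection it is enough that a symmetric kernel orthogonal to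
  all tensor powers vanishes.  Polarization makes it orthogonal to all products
  \<open>\<phi>\<^sub>1(x\<^sub>1) \<cdots> \<phi>\<^sub>n(x\<^sub>n)\<close>, approximation of indicator functions by Schwartz functions makes its integral
  over every product of boxes zero, and such products determine a measure.
\<close>

section \<open>Square integrable functions as a Hilbert space\<close>

definition L2_inner :: "'x measure \<Rightarrow> ('x \<Rightarrow> real) \<Rightarrow> ('x \<Rightarrow> real) \<Rightarrow> real" where
  "L2_inner M f g = (LINT x|M. f x * g x)"

lemma L2_measurable: "f \<in> L2 M \<Longrightarrow> f \<in> borel_measurable M"
  by (simp add: L2_def)

lemma L2_lincomb:
  assumes "f \<in> L2 M" "g \<in> L2 M"
  shows "(\<lambda>x. a * f x + b * g x) \<in> L2 M"
  using assms by (intro L2_add L2_scale)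

lemma L2_diff:
  assumes "f \<in> L2 M" "g \<in> L2 M"
  shows "(\<lambda>x. f x - g x) \<in> L2 M"
  using L2_lincomb[OF assms, of 1 "-1"] by simp

lemma L2_sum:
  assumes "\<And>i. i \<in> A \<Longrightarrow> f i \<in> L2 M"
  shows "(\<lambda>x. \<Sum>i\<in>A. f i x) \<in> L2 M"
  using assms by (induction A rule: infinite_finite_induct) (auto simp: L2_zero intro!: L2_add(1))

lemma L2_mult_integrable:
  assumes "f \<in> L2 M" "g \<in> L2 M"
  shows "integrable M (\<lambda>x. f x * g x)"
proof -
  have [measurable]: "f \<in> borel_measurable M" "g \<in> borel_measurable M"
    and i: "integrable M (\<lambda>x. (f x)\<^sup>2)" "integrable M (\<lambda>x. (g x)\<^sup>2)"
    using assms by (auto simp: L2_def)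
  have le: "\<bar>f x * g x\<bar> \<le> (f x)\<^sup>2 + (g x)\<^sup>2" for x
  proof -
    have "2 * (\<bar>f x\<bar> * \<bar>g x\<bar>) \<le> (f x)\<^sup>2 + (g x)\<^sup>2"
      using sum_squares_bound[of "\<bar>f x\<bar>" "\<bar>g x\<bar>"] by simp
    moreover have "0 \<le> \<bar>f x\<bar> * \<bar>g x\<bar>" by simp
    ultimately show ?thesis unfolding abs_mult by linarith
  qed
  show ?thesis
    by (rule Bochner_Integration.integrable_bound[where f = "\<lambda>x. (f x)\<^sup>2 + (g x)\<^sup>2"])
       (use i le in auto)
qed

lemma L2_sq_eq_inner: "L2_sq M f = L2_inner M f f"
  by (simp add: L2_sq_def L2_inner_def power2_eq_square)

lemma L2_inner_commute: "L2_inner M f g = L2_inner M g f"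
  by (simp add: L2_inner_def mult.commute)

lemma L2_inner_lincomb_left:
  assumes "f \<in> L2 M" "g \<in> L2 M" "h \<in> L2 M"
  shows "L2_inner M (\<lambda>x. a * f x + b * g x) h = a * L2_inner M f h + b * L2_inner M g h"
proof -
  have "(\<lambda>x. (a * f x + b * g x) * h x) = (\<lambda>x. a * (f x * h x) + b * (g x * h x))"
    by (auto simp: algebra_simps)
  then show ?thesis
    using L2_mult_integrable[OF assms(1,3)] L2_mult_integrable[OF assms(2,3)]
    by (simp add: L2_inner_def)
qed

lemma L2_inner_diff_left:
  assumes "f \<in> L2 M" "g \<in> L2 M" "h \<in> L2 M"
  shows "L2_inner M (\<lambda>x. f x - g x) h = L2_inner M f h - L2_inner M g h"
  using L2_inner_lincomb_left[OF assms, of 1 "-1"] by simp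

lemma L2_inner_sum_left:
  assumes "\<And>i. i \<in> A \<Longrightarrow> f i \<in> L2 M" "h \<in> L2 M"
  shows "L2_inner M (\<lambda>x. \<Sum>i\<in>A. c i * f i x) h = (\<Sum>i\<in>A. c i * L2_inner M (f i) h)"
  using assms(1)
proof (induction A rule: infinite_finite_induct)
  case (insert i A)
  have "L2_inner M (\<lambda>x. c i * f i x + 1 * (\<Sum>i\<in>A. c i * f i x)) h =
      c i * L2_inner M (f i) h + 1 * L2_inner M (\<lambda>x. \<Sum>i\<in>A. c i * f i x) h"
    using insert.prems assms(2) by (intro L2_inner_lincomb_left L2_sum L2_scale) auto
  then show ?case using insert by simp
qed (auto simp: L2_inner_def)

lemma L2_sq_lincomb:
  assumes "f \<in> L2 M" "g \<in> L2 M"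
  shows "L2_sq M (\<lambda>x. a * f x + b * g x) = a\<^sup>2 * L2_sq M f + 2 * a * b * L2_inner M f g + b\<^sup>2 * L2_sq M g"
proof -
  let ?h = "\<lambda>x. a * f x + b * g x"
  have h: "?h \<in> L2 M" by (rule L2_lincomb[OF assms])
  have "L2_inner M f ?h = a * L2_inner M f f + b * L2_inner M f g"
    using L2_inner_lincomb_left[OF assms assms(1), of a b]
    by (simp only: L2_inner_commute[of M f ?h] L2_inner_commute[of M g f])
  moreover have "L2_inner M g ?h = a * L2_inner M f g + b * L2_inner M g g"
    using L2_inner_lincomb_left[OF assms assms(2), of a b]
    by (simp only: L2_inner_commute[of M g ?h])
  ultimately show ?thesis
    unfolding L2_sq_eq_inner L2_inner_lincomb_left[OF assms h]
    by (simp add: algebra_simps power2_eq_square)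
qed

lemma L2_sq_diff:
  assumes "f \<in> L2 M" "g \<in> L2 M"
  shows "L2_sq M (\<lambda>x. f x - g x) = L2_sq M f - 2 * L2_inner M f g + L2_sq M g"
  using L2_sq_lincomb[OF assms, of 1 "-1"] by simp

lemma L2_sq_minus_commute: "L2_sq M (\<lambda>x. f x - g x) = L2_sq M (\<lambda>x. g x - f x)"
  by (simp add: L2_sq_def power2_commute)

lemma L2_sq_diff_le:
  assumes "f \<in> L2 M" "g \<in> L2 M"
  shows "L2_sq M (\<lambda>x. f x - g x) \<le> 2 * L2_sq M f + 2 * L2_sq M g"
  using L2_add(2)[OF assms(1) L2_scale(1)[OF assms(2), of "-1"]] L2_scale(2)[OF assms(2), of "-1"]
  by simp

lemma L2_sq_triangle:
  assumes "f \<in> L2 M" "g \<in> L2 M" "h \<in> L2 M"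
  shows "L2_sq M (\<lambda>x. f x - h x) \<le> 2 * L2_sq M (\<lambda>x. f x - g x) + 2 * L2_sq M (\<lambda>x. g x - h x)"
  using L2_add(2)[OF L2_diff[OF assms(1,2)] L2_diff[OF assms(2,3)]] by simp

text \<open>The quadratic form \<open>|a f + b g|\<^sup>2\<close> in \<open>a, b\<close> is nonnegative; evaluate it at \<open>a = |g|\<^sup>2\<close> and
  \<open>b = - (f, g)\<close>.\<close>

lemma L2_Cauchy_Schwarz:
  assumes "f \<in> L2 M" "g \<in> L2 M"
  shows "(L2_inner M f g)\<^sup>2 \<le> L2_sq M f * L2_sq M g"
proof -
  let ?F = "L2_sq M f" and ?G = "L2_sq M g" and ?I = "L2_inner M f g"
  have q: "0 \<le> a\<^sup>2 * ?F + 2 * a * b * ?I + b\<^sup>2 * ?G" for a b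
    using L2_sq_nonneg[of M "\<lambda>x. a * f x + b * g x"] L2_sq_lincomb[OF assms, of a b] by simp
  show ?thesis
  proof (cases "?G = 0")
    case True
    have "?I = 0"
    proof (rule ccontr)
      assume "?I \<noteq> 0"
      then show False
        using q[of 1 "- (?F + 1) / (2 * ?I)"] True by (simp add: field_simps)
    qed
    then show ?thesis by (simp add: L2_sq_nonneg)
  next
    case False
    then have G: "?G > 0" using L2_sq_nonneg[of M g] by simp
    have "0 \<le> ?G * (?F * ?G - ?I\<^sup>2)"
      using q[of ?G "- ?I"] by (simp add: algebra_simps power2_eq_square)
    then show ?thesis using G by (simp add: zero_le_mult_iff)
  qed
qed

lemma L2_sq_zero_AE:
  assumes "f \<in> L2 M" "L2_sq M f = 0"
  shows "AE x in M. f x = 0"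
proof -
  have "AE x in M. (f x)\<^sup>2 = 0"
    using assms by (subst integral_nonneg_eq_0_iff_AE[symmetric]) (auto simp: L2_def L2_sq_def)
  then show ?thesis by simp
qed

lemma L2_sq_diff_zero_AE:
  assumes "f \<in> L2 M" "g \<in> L2 M" "L2_sq M (\<lambda>x. f x - g x) = 0"
  shows "AE x in M. f x = g x"
  using L2_sq_zero_AE[OF L2_diff[OF assms(1,2)] assms(3)] by simp

lemma L2_inner_zero_tendsto:
  assumes f: "\<And>k. f k \<in> L2 M" and g: "\<And>k. g k \<in> L2 M"
    and "(\<lambda>k. L2_sq M (f k)) \<longlonglongrightarrow> 0" "(\<lambda>k. L2_sq M (g k)) \<longlonglongrightarrow> c"
  shows "(\<lambda>k. L2_inner M (f k) (g k)) \<longlonglongrightarrow> 0"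
proof -
  have "(\<lambda>k. L2_sq M (f k) * L2_sq M (g k)) \<longlonglongrightarrow> 0 * c"
    by (intro tendsto_mult assms)
  then have 0: "(\<lambda>k. L2_sq M (f k) * L2_sq M (g k)) \<longlonglongrightarrow> 0" by simp
  have "(\<lambda>k. (L2_inner M (f k) (g k))\<^sup>2) \<longlonglongrightarrow> 0"
    by (rule tendsto_sandwich[OF _ _ tendsto_const 0]) (use L2_Cauchy_Schwarz[OF f g] in auto)
  then have "(\<lambda>k. sqrt ((L2_inner M (f k) (g k))\<^sup>2)) \<longlonglongrightarrow> sqrt 0" by (intro tendsto_intros)
  then show ?thesis by (simp add: tendsto_rabs_zero_iff)
qed

text \<open>Both differences tend to \<open>0\<close>, so expand \<open>(f\<^sub>k, g\<^sub>k)\<close> around \<open>(f', g')\<close> and estimate the three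
  other terms by Cauchy-Schwarz.\<close>

lemma L2_inner_tendsto:
  assumes f: "\<And>k. f k \<in> L2 M" "f' \<in> L2 M" and g: "\<And>k. g k \<in> L2 M" "g' \<in> L2 M"
    and lf: "(\<lambda>k. L2_sq M (\<lambda>x. f k x - f' x)) \<longlonglongrightarrow> 0"
    and lg: "(\<lambda>k. L2_sq M (\<lambda>x. g k x - g' x)) \<longlonglongrightarrow> 0"
  shows "(\<lambda>k. L2_inner M (f k) (g k)) \<longlonglongrightarrow> L2_inner M f' g'"
proof -
  let ?df = "\<lambda>k x. f k x - f' x" and ?dg = "\<lambda>k x. g k x - g' x"
  have d: "?df k \<in> L2 M" "?dg k \<in> L2 M" for k using f g by (auto intro: L2_diff)
  have "(\<lambda>k. L2_inner M (?df k) (?dg k) + L2_inner M (?df k) g' + L2_inner M (?dg k) f' + L2_inner M f' g')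
      \<longlonglongrightarrow> 0 + 0 + 0 + L2_inner M f' g'"
    by (intro tendsto_add tendsto_const L2_inner_zero_tendsto[OF d(1) d(2) lf lg]
        L2_inner_zero_tendsto[OF d(1) g(2) lf tendsto_const]
        L2_inner_zero_tendsto[OF d(2) f(2) lg tendsto_const])
  moreover have "L2_inner M (?df k) (?dg k) + L2_inner M (?df k) g' + L2_inner M (?dg k) f' + L2_inner M f' g'
      = L2_inner M (f k) (g k)" for k
  proof -
    have "L2_inner M (?df k) (?dg k) = L2_inner M (f k) (?dg k) - L2_inner M f' (?dg k)"
      by (rule L2_inner_diff_left[OF f(1) f(2) d(2)])
    moreover have "L2_inner M (?df k) g' = L2_inner M (f k) g' - L2_inner M f' g'"
      by (rule L2_inner_diff_left[OF f(1) f(2) g(2)])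
    moreover have "L2_inner M (?dg k) (f k) = L2_inner M (g k) (f k) - L2_inner M g' (f k)"
      by (rule L2_inner_diff_left[OF g(1) g(2) f(1)])
    ultimately show ?thesis
      using L2_inner_commute[of M "?dg k" f'] L2_inner_commute[of M "?dg k" "f k"]
        L2_inner_commute[of M "g k" "f k"] L2_inner_commute[of M g' "f k"] by linarith
  qed
  ultimately show ?thesis by simp
qed

lemma L2_limit_unique:
  assumes f: "\<And>k. f k \<in> L2 M" and g: "g \<in> L2 M" and h: "h \<in> L2 M"
    and fg: "(\<lambda>k. L2_sq M (\<lambda>x. f k x - g x)) \<longlonglongrightarrow> 0"
    and fh: "(\<lambda>k. L2_sq M (\<lambda>x. f k x - h x)) \<longlonglongrightarrow> 0"
  shows "AE x in M. g x = h x"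
proof (rule L2_sq_diff_zero_AE[OF g h])
  have "(\<lambda>k. 2 * L2_sq M (\<lambda>x. f k x - g x) + 2 * L2_sq M (\<lambda>x. f k x - h x)) \<longlonglongrightarrow> 2 * 0 + 2 * 0"
    by (intro tendsto_intros fg fh)
  moreover have "L2_sq M (\<lambda>x. g x - h x) \<le> 2 * L2_sq M (\<lambda>x. f k x - g x) + 2 * L2_sq M (\<lambda>x. f k x - h x)" for k
    using L2_sq_triangle[OF g f[of k] h] by (simp add: L2_sq_minus_commute[of M g])
  ultimately have "L2_sq M (\<lambda>x. g x - h x) \<le> 0"
    by (intro LIMSEQ_le_const[where X = "\<lambda>k. 2 * L2_sq M (\<lambda>x. f k x - g x) + 2 * L2_sq M (\<lambda>x. f k x - h x)"]) auto
  then show "L2_sq M (\<lambda>x. g x - h x) = 0" using L2_sq_nonneg by (rule antisym)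
qed

text \<open>The Riesz-Fischer theorem.  Along a subsequence the increments \<open>d\<^sub>k\<close> satisfy
  \<open>|d\<^sub>k|\<^sup>2 \<le> 8\<^sup>-\<^sup>k\<close>, so that \<open>\<Sum> 2\<^sup>k d\<^sub>k\<^sup>2\<close> is integrable and hence almost everywhere finite; this
  forces \<open>\<Sum> |d\<^sub>k| < \<infinity>\<close> almost everywhere.  Fatou's lemma identifies the pointwise limit as the
  limit in \<open>L\<^sup>2\<close> of the whole sequence.\<close>

lemma L2_complete:
  fixes f :: "nat \<Rightarrow> 'x \<Rightarrow> real"
  assumes f: "\<And>k. f k \<in> L2 M"
    and cauchy: "\<And>e. e > 0 \<Longrightarrow> \<exists>N. \<forall>m\<ge>N. \<forall>n\<ge>N. L2_sq M (\<lambda>x. f m x - f n x) < e"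
  shows "\<exists>h\<in>L2 M. (\<lambda>k. L2_sq M (\<lambda>x. f k x - h x)) \<longlonglongrightarrow> 0"
proof -
  have [measurable]: "f k \<in> borel_measurable M" for k using f by (auto simp: L2_def)
  have "\<forall>k. \<exists>N. \<forall>m\<ge>N. \<forall>n\<ge>N. L2_sq M (\<lambda>x. f m x - f n x) < (1/8)^k"
    using cauchy by simp
  then obtain N where N: "\<And>k m n. m \<ge> N k \<Longrightarrow> n \<ge> N k \<Longrightarrow> L2_sq M (\<lambda>x. f m x - f n x) < (1/8)^k"
    by metis
  (* r k is at least N k, and r is monotone and tends to infinity *)
  define r where "r k = k + (\<Sum>j\<le>k. N j)" for k
  have r1: "N k \<le> r k" for k
    unfolding r_def by (intro trans_le_add2 member_le_sum) auto
  have r2: "r k \<le> r (Suc k)" for k unfolding r_def by simp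
  have r3: "k \<le> r k" for k by (simp add: r_def)
  define d where "d k x = f (r (Suc k)) x - f (r k) x" for k x
  have [measurable]: "d k \<in> borel_measurable M" for k unfolding d_def by measurable
  have dL2: "d k \<in> L2 M" for k unfolding d_def by (intro L2_diff f)
  have dsq: "L2_sq M (d k) \<le> (1/8)^k" for k
    using N[of k "r (Suc k)" "r k"] r1[of k] r2[of k] unfolding d_def by simp
  have "(\<integral>\<^sup>+x. (\<Sum>k. ennreal (2^k * (d k x)\<^sup>2)) \<partial>M) = (\<Sum>k. \<integral>\<^sup>+x. ennreal (2^k * (d k x)\<^sup>2) \<partial>M)"
    by (rule nn_integral_suminf) measurable
  also have "\<dots> \<le> (\<Sum>k. ennreal ((1/4)^k))"
  proof (rule suminf_le)
    fix k
    have "(\<integral>\<^sup>+x. ennreal (2^k * (d k x)\<^sup>2) \<partial>M) = ennreal (2^k * L2_sq M (d k))"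
      using dL2[of k] by (subst nn_integral_eq_integral) (auto simp: L2_def L2_sq_def)
    also have "\<dots> \<le> ennreal (2^k * (1/8)^k)"
      using dsq by (intro ennreal_leI mult_left_mono) auto
    also have "2^k * (1/8)^k = (1/4::real)^k"
      by (simp flip: power_mult_distrib)
    finally show "(\<integral>\<^sup>+x. ennreal (2^k * (d k x)\<^sup>2) \<partial>M) \<le> ennreal ((1/4)^k)" .
  qed auto
  also have "\<dots> < \<infinity>"
    by (subst suminf_ennreal2) (auto intro!: summable_geometric)
  finally have "(\<integral>\<^sup>+x. (\<Sum>k. ennreal (2^k * (d k x)\<^sup>2)) \<partial>M) \<noteq> \<infinity>" by simp
  then have "AE x in M. (\<Sum>k. ennreal (2^k * (d k x)\<^sup>2)) \<noteq> \<infinity>"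
    by (intro nn_integral_PInf_AE) auto
  then have conv: "AE x in M. convergent (\<lambda>k. f (r k) x)"
  proof eventually_elim
    case (elim x)
    then have "summable (\<lambda>k. 2^k * (d k x)\<^sup>2)"
      by (intro summable_suminf_not_top) auto
    then have s: "summable (\<lambda>k. (1/2)^k + 2^k * (d k x)\<^sup>2)"
      by (intro summable_add summable_geometric) auto
    (* either |d| is at most 2^-k, or 1 <= 2^k |d| and hence |d| <= 2^k d^2 *)
    have "\<bar>d k x\<bar> \<le> (1/2)^k + 2^k * (d k x)\<^sup>2" for k
    proof (cases "\<bar>d k x\<bar> \<le> (1/2)^k")
      case False
      then have "1 \<le> 2^k * \<bar>d k x\<bar>" by (simp add: field_simps power_one_over)
      then have "1 * \<bar>d k x\<bar> \<le> 2^k * \<bar>d k x\<bar> * \<bar>d k x\<bar>"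
        by (intro mult_right_mono) auto
      also have "\<dots> = 2^k * (d k x)\<^sup>2" by (simp add: power2_eq_square mult.assoc)
      finally show ?thesis by (simp add: add_increasing)
    qed (simp add: add_increasing2)
    then have "summable (\<lambda>k. d k x)"
      by (intro summable_comparison_test[OF _ s]) auto
    then have "convergent (\<lambda>k. \<Sum>j<k. d j x)" by (simp add: summable_iff_convergent)
    moreover have "(\<Sum>j<k. d j x) = f (r k) x - f (r 0) x" for k
      unfolding d_def by (rule sum_lessThan_telescope)
    ultimately have "convergent (\<lambda>k. f (r k) x + - f (r 0) x)" by simp
    then show ?case by (subst (asm) convergent_add_const_right_iff)
  qed
  define h where "h x = lim (\<lambda>k. f (r k) x)" for x
  have [measurable]: "h \<in> borel_measurable M"
    unfolding h_def by measurable
  have lim: "AE x in M. (\<lambda>k. f (r k) x) \<longlonglongrightarrow> h x"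
    using conv by eventually_elim (simp add: h_def convergent_LIMSEQ_iff)
  have fatou: "(\<integral>\<^sup>+x. ennreal ((f n x - h x)\<^sup>2) \<partial>M) \<le> ennreal e"
    if "\<And>m. m \<ge> K \<Longrightarrow> L2_sq M (\<lambda>x. f n x - f m x) < e" for e n K
  proof -
    have "(\<integral>\<^sup>+x. ennreal ((f n x - h x)\<^sup>2) \<partial>M) =
        (\<integral>\<^sup>+x. liminf (\<lambda>k. ennreal ((f n x - f (r k) x)\<^sup>2)) \<partial>M)"
    proof (rule nn_integral_cong_AE, use lim in eventually_elim)
      case (elim x)
      have "(\<lambda>k. ennreal ((f n x - f (r k) x)\<^sup>2)) \<longlonglongrightarrow> ennreal ((f n x - h x)\<^sup>2)"
        by (intro tendsto_intros elim)
      then show ?case by (metis lim_imp_Liminf trivial_limit_sequentially)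
    qed
    also have "\<dots> \<le> liminf (\<lambda>k. \<integral>\<^sup>+x. ennreal ((f n x - f (r k) x)\<^sup>2) \<partial>M)"
      by (rule nn_integral_liminf) measurable
    also have "\<dots> = liminf (\<lambda>k. ennreal (L2_sq M (\<lambda>x. f n x - f (r k) x)))"
      using L2_diff[OF f f] by (subst nn_integral_eq_integral) (auto simp: L2_def L2_sq_def)
    also have "\<dots> \<le> ennreal e"
    proof (rule Liminf_le)
      show "\<forall>\<^sub>F k in sequentially. ennreal (L2_sq M (\<lambda>x. f n x - f (r k) x)) \<le> ennreal e"
        using eventually_ge_at_top[of K]
      proof eventually_elim
        case (elim k)
        then have "K \<le> r k" using r3[of k] by simp
        then show ?case using that[of "r k"] by (intro ennreal_leI) simp
      qed
    qed simp
    finally show ?thesis .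
  qed
  have mem: "(\<lambda>x. f n x - h x) \<in> L2 M \<and> L2_sq M (\<lambda>x. f n x - h x) \<le> e"
    if "\<And>m. m \<ge> K \<Longrightarrow> L2_sq M (\<lambda>x. f n x - f m x) < e" for e n K
  proof -
    have e: "0 \<le> e" using that[of K] L2_sq_nonneg[of M "\<lambda>x. f n x - f K x"] by simp
    have fin: "(\<integral>\<^sup>+x. ennreal ((f n x - h x)\<^sup>2) \<partial>M) \<le> ennreal e" by (rule fatou[OF that])
    have i: "integrable M (\<lambda>x. (f n x - h x)\<^sup>2)"
      by (rule integrableI_bounded) (use fin in \<open>auto intro: le_less_trans\<close>)
    then have "ennreal (L2_sq M (\<lambda>x. f n x - h x)) \<le> ennreal e"
      using fin by (subst (asm) nn_integral_eq_integral) (auto simp: L2_sq_def)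
    then show ?thesis using i e by (simp add: L2_def)
  qed
  obtain K where "\<And>m n. m \<ge> K \<Longrightarrow> n \<ge> K \<Longrightarrow> L2_sq M (\<lambda>x. f m x - f n x) < 1"
    using cauchy[of 1] by auto
  then have "(\<lambda>x. f K x - h x) \<in> L2 M"
    using mem[of K K 1] by auto
  then have h: "h \<in> L2 M" using L2_diff[OF f[of K]] by fastforce
  have "(\<lambda>k. L2_sq M (\<lambda>x. f k x - h x)) \<longlonglongrightarrow> 0"
  proof (rule LIMSEQ_I)
    fix e :: real assume "e > 0"
    then obtain K where K: "\<And>m n. m \<ge> K \<Longrightarrow> n \<ge> K \<Longrightarrow> L2_sq M (\<lambda>x. f m x - f n x) < e / 2"
      using cauchy[of "e / 2"] by auto
    have "L2_sq M (\<lambda>x. f n x - h x) < e" if "n \<ge> K" for n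
    proof -
      have "L2_sq M (\<lambda>x. f n x - h x) \<le> e / 2"
        using mem[of K n "e / 2"] K that by blast
      then show ?thesis using \<open>e > 0\<close> by linarith
    qed
    then show "\<exists>K. \<forall>n\<ge>K. norm (L2_sq M (\<lambda>x. f n x - h x) - 0) < e"
      using \<open>e > 0\<close> by (intro exI[of _ K]) (simp add: L2_sq_nonneg)
  qed
  with h show ?thesis by blast
qed

text \<open>The orthogonal projection onto the closure of a subspace, as the limit of a sequence in the
  subspace.  A minimising sequence is Cauchy by the parallelogram law, and comparing its limit with
  small perturbations in the direction of \<open>w\<close> gives orthogonality to \<open>w\<close>.\<close>

lemma L2_projection:
  assumes V: "V \<subseteq> L2 M" "(\<lambda>x. 0) \<in> V"
    and lin: "\<And>u v a b. u \<in> V \<Longrightarrow> v \<in> V \<Longrightarrow> (\<lambda>x. a * u x + b * v x) \<in> V"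
    and f: "f \<in> L2 M"
  shows "\<exists>v h. (\<forall>k. v k \<in> V) \<and> h \<in> L2 M \<and> (\<lambda>k. L2_sq M (\<lambda>x. v k x - h x)) \<longlonglongrightarrow> 0 \<and>
    (\<forall>w\<in>V. L2_inner M (\<lambda>x. f x - h x) w = 0)"
proof -
  let ?D = "\<lambda>v. L2_sq M (\<lambda>x. f x - v x)"
  define d where "d = (INF v\<in>V. ?D v)"
  have bdd: "bdd_below (?D ` V)" by (rule bdd_belowI2[of _ 0]) (simp add: L2_sq_nonneg)
  have d_le: "d \<le> ?D v" if "v \<in> V" for v
    unfolding d_def using that bdd by (rule cINF_lower[rotated])
  have "\<forall>k. \<exists>v\<in>V. ?D v < d + 1 / Suc k"
  proof
    fix k
    have "d < d + 1 / Suc k" by simp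
    then show "\<exists>v\<in>V. ?D v < d + 1 / Suc k"
      unfolding d_def using cINF_less_iff[OF _ bdd] V(2) by blast
  qed
  then obtain v where v: "\<And>k. v k \<in> V" and vd: "\<And>k. ?D (v k) < d + 1 / Suc k" by metis
  have vL2: "v k \<in> L2 M" for k using v V by auto
  have par: "L2_sq M (\<lambda>x. v m x - v n x) \<le> 2 / Suc m + 2 / Suc n" for m n
  proof -
    have in_L2: "(\<lambda>x. f x - v k x) \<in> L2 M" for k by (intro L2_diff f vL2)
    let ?mid = "\<lambda>x. 1/2 * v m x + 1/2 * v n x"
    have "L2_sq M (\<lambda>x. v m x - v n x) = L2_sq M (\<lambda>x. 1 * (f x - v n x) + (-1) * (f x - v m x))"
      by simp
    moreover have "4 * ?D ?mid = L2_sq M (\<lambda>x. 1 * (f x - v n x) + 1 * (f x - v m x))"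
    proof -
      have "(\<lambda>x. 1 * (f x - v n x) + 1 * (f x - v m x)) = (\<lambda>x. 2 * (f x - ?mid x))"
        by (auto simp: algebra_simps)
      then show ?thesis
        using L2_scale(2)[OF L2_diff[OF f L2_lincomb[OF vL2[of m] vL2[of n], of "1/2" "1/2"]], of 2]
        by simp
    qed
    ultimately have "L2_sq M (\<lambda>x. v m x - v n x) + 4 * ?D ?mid = 2 * ?D (v n) + 2 * ?D (v m)"
      by (simp only: L2_sq_lincomb[OF in_L2 in_L2]) simp
    moreover have "d \<le> ?D ?mid" by (intro d_le lin v)
    ultimately show ?thesis using vd[of m] vd[of n] by simp
  qed
  have "\<exists>h\<in>L2 M. (\<lambda>k. L2_sq M (\<lambda>x. v k x - h x)) \<longlonglongrightarrow> 0"
  proof (rule L2_complete[OF vL2])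
    fix e :: real assume "e > 0"
    then obtain N where N: "1 / Suc N < e / 4" using nat_approx_posE[of "e / 4"] by auto
    have small: "2 / Suc m < e / 2" if "m \<ge> N" for m
    proof -
      have "1 / Suc m \<le> 1 / Suc N" using that by (intro divide_left_mono) auto
      then show ?thesis using N by simp
    qed
    show "\<exists>N. \<forall>m\<ge>N. \<forall>n\<ge>N. L2_sq M (\<lambda>x. v m x - v n x) < e"
    proof (intro exI[of _ N] allI impI)
      fix m n assume "m \<ge> N" "n \<ge> N"
      then show "L2_sq M (\<lambda>x. v m x - v n x) < e"
        using par[of m n] small[of m] small[of n] by linarith
    qed
  qed
  then obtain h where h: "h \<in> L2 M" and lim: "(\<lambda>k. L2_sq M (\<lambda>x. v k x - h x)) \<longlonglongrightarrow> 0" by blast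
  have "L2_inner M (\<lambda>x. f x - h x) w = 0" if w: "w \<in> V" for w
  proof -
    have wL2: "w \<in> L2 M" using w V by auto
    let ?I = "L2_inner M (\<lambda>x. f x - h x) w"
    have dl: "(\<lambda>x. f x - h x) \<in> L2 M" "(\<lambda>x. f x - v k x) \<in> L2 M" for k
      by (intro L2_diff f h vL2)+
    have flim: "(\<lambda>k. L2_sq M (\<lambda>x. (f x - v k x) - (f x - h x))) \<longlonglongrightarrow> 0"
      using lim by (simp add: L2_sq_minus_commute[of M h])
    have I: "(\<lambda>k. L2_inner M (\<lambda>x. f x - v k x) w) \<longlonglongrightarrow> ?I"
      by (rule L2_inner_tendsto[OF dl(2,1) wL2 wL2 flim]) (simp add: L2_zero)
    (* v k - t w lies in V, so its squared distance to f is at least d; let k tend to infinity *)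
    have ineq: "0 \<le> 2 * t * ?I + t\<^sup>2 * L2_sq M w" for t
    proof (rule LIMSEQ_le)
      have "(\<lambda>k. - (1 / real (Suc k))) \<longlonglongrightarrow> - 0"
        by (rule tendsto_minus[OF LIMSEQ_Suc[OF lim_1_over_n]])
      then show "(\<lambda>k. - (1 / real (Suc k))) \<longlonglongrightarrow> 0" by simp
      show "(\<lambda>k. 2 * t * L2_inner M (\<lambda>x. f x - v k x) w + t\<^sup>2 * L2_sq M w)
          \<longlonglongrightarrow> 2 * t * ?I + t\<^sup>2 * L2_sq M w"
        by (intro tendsto_intros I)
      show "\<exists>N. \<forall>k\<ge>N. - (1 / real (Suc k)) \<le> 2 * t * L2_inner M (\<lambda>x. f x - v k x) w + t\<^sup>2 * L2_sq M w"
      proof (intro exI[of _ 0] allI impI)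
        fix k
        have "(\<lambda>x. 1 * v k x + (-t) * w x) \<in> V" by (intro lin v w)
        from d_le[OF this] have "d \<le> L2_sq M (\<lambda>x. 1 * (f x - v k x) + t * w x)"
          by (simp add: algebra_simps)
        also have "\<dots> = ?D (v k) + 2 * t * L2_inner M (\<lambda>x. f x - v k x) w + t\<^sup>2 * L2_sq M w"
          by (subst L2_sq_lincomb[OF dl(2) wL2]) simp
        finally show "- (1 / real (Suc k)) \<le> 2 * t * L2_inner M (\<lambda>x. f x - v k x) w + t\<^sup>2 * L2_sq M w"
          using vd[of k] by simp
      qed
    qed
    show "?I = 0"
    proof (rule ccontr)
      assume nz: "?I \<noteq> 0"
      let ?W = "L2_sq M w + 1"
      have W: "?W > 0" using L2_sq_nonneg[of M w] by simp
      (* t close to the minimiser of the quadratic; the 1 in W keeps the denominator positive *)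
      have "0 \<le> 2 * (- ?I / ?W) * ?I + (- ?I / ?W)\<^sup>2 * L2_sq M w" by (rule ineq)
      also have "\<dots> \<le> 2 * (- ?I / ?W) * ?I + (- ?I / ?W)\<^sup>2 * ?W"
        by (intro add_left_mono mult_left_mono) auto
      also have "\<dots> = - (?I\<^sup>2 / ?W)"
      proof -
        have "2 * (- i / w) * i + (- i / w)\<^sup>2 * w = - (i\<^sup>2 / w)" if "w > 0" for i w :: real
          using that by (simp add: field_simps power2_eq_square)
        from this[OF W] show ?thesis .
      qed
      also have "\<dots> < 0" using nz W by simp
      finally show False by simp
    qed
  qed
  with v h lim show ?thesis by blast
qed

section \<open>Schwartz functions\<close>

lemma schwartz_apply_differentiable: "schwartz_apply \<phi> differentiable at x"
proof -
  have "\<forall>x. iter_deriv [] (schwartz_apply \<phi>) differentiable at x"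
    using schwartz_apply[of \<phi>] unfolding schwartz_fun_def by blast
  then show ?thesis by simp
qed

lemma schwartz_apply_measurable [measurable]: "schwartz_apply \<phi> \<in> borel_measurable borel"
  by (intro borel_measurable_continuous_onI differentiable_imp_continuous_on
      differentiable_at_imp_differentiable_on schwartz_apply_differentiable)

lemma schwartz_apply_decay: "\<exists>C. \<forall>x. norm x ^ k * \<bar>schwartz_apply \<phi> x\<bar> \<le> C"
proof -
  have "\<forall>k. \<exists>C. \<forall>x. norm x ^ k * \<bar>iter_deriv [] (schwartz_apply \<phi>) x\<bar> \<le> C"
    using schwartz_apply[of \<phi>] unfolding schwartz_fun_def by blast
  then show ?thesis by simp
qed

lemma schwartz_apply_linear:
  "schwartz_apply (a *\<^sub>R \<phi> + b *\<^sub>R \<psi>) x = a * schwartz_apply \<phi> x + b * schwartz_apply \<psi> x"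
  by (simp add: plus_schwartz.rep_eq scaleR_schwartz.rep_eq)

lemma schwartz_apply_sum: "schwartz_apply (\<Sum>i\<in>I. \<phi> i) x = (\<Sum>i\<in>I. schwartz_apply (\<phi> i) x)"
  by (induction I rule: infinite_finite_induct) (auto simp: plus_schwartz.rep_eq zero_schwartz.rep_eq)

lemma integrable_lborel_prod_Basis:
  fixes f :: "real \<Rightarrow> real"
  assumes f: "integrable lborel f" and nn: "\<And>x. 0 \<le> f x"
  shows "integrable lborel (\<lambda>x::'a::euclidean_space. \<Prod>b\<in>Basis. f (x \<bullet> b))"
proof (rule integrableI_bounded)
  have [measurable]: "f \<in> borel_measurable borel" using f by auto
  show "(\<lambda>x::'a. \<Prod>b\<in>Basis. f (x \<bullet> b)) \<in> borel_measurable lborel" by measurable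
  have "(\<integral>\<^sup>+x. ennreal (norm (\<Prod>b\<in>Basis. f ((x::'a) \<bullet> b))) \<partial>lborel) =
      (\<integral>\<^sup>+x. (\<Prod>b\<in>Basis. ennreal (f ((x::'a) \<bullet> b))) \<partial>lborel)"
    using nn by (intro nn_integral_cong) (simp add: prod_nonneg prod_ennreal)
  also have "\<dots> = (\<Prod>b\<in>(Basis::'a set). \<integral>\<^sup>+x. ennreal (f x) \<partial>lborel)"
    by (rule nn_integral_lborel_prod) auto
  also have "\<dots> < \<infinity>"
    using f nn by (subst nn_integral_eq_integral) (auto simp: power_less_top_ennreal)
  finally show "(\<integral>\<^sup>+x. ennreal (norm (\<Prod>b\<in>Basis. f ((x::'a) \<bullet> b))) \<partial>lborel) < \<infinity>" .
qed

lemma integrable_inverse_one_plus_square: "integrable lborel (\<lambda>x::real. inverse (1 + x\<^sup>2))"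
  using integrable_inverse_1_plus_square by (simp add: set_integrable_def einterval_def)

text \<open>Decay of order \<open>DIM('a)\<close> suffices: it bounds \<open>\<phi>\<^sup>2\<close> by a multiple of \<open>\<Prod>\<^sub>b 1 / (1 + x\<^sub>b\<^sup>2)\<close>, whose
  integral is a product of one-dimensional integrals, because \<open>\<Prod>\<^sub>b (1 + x\<^sub>b\<^sup>2) \<le> (1 + |x|\<^sup>2)\<^sup>D\<^sup>I\<^sup>M\<close>.\<close>

lemma schwartz_L2: "schwartz_apply (\<phi> :: 'a::euclidean_space schwartz) \<in> L2 lborel"
proof -
  let ?d = "DIM('a)" and ?f = "schwartz_apply \<phi>"
  obtain C where C: "\<And>x. \<bar>?f x\<bar> \<le> C" using schwartz_apply_decay[of 0 \<phi>] by auto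
  obtain D where D: "\<And>x. norm x ^ ?d * \<bar>?f x\<bar> \<le> D" using schwartz_apply_decay[of ?d \<phi>] by auto
  have bound: "(?f x)\<^sup>2 \<le> 2 ^ ?d * (C\<^sup>2 + D\<^sup>2) * (\<Prod>b\<in>Basis. inverse (1 + (x \<bullet> b)\<^sup>2))" for x
  proof -
    have p: "(1 + (norm x)\<^sup>2) ^ ?d \<le> 2 ^ ?d * (1 + ((norm x)\<^sup>2) ^ ?d)"
    proof -
      have "1 + (norm x)\<^sup>2 \<le> 2 * max 1 ((norm x)\<^sup>2)" by simp
      then have "(1 + (norm x)\<^sup>2) ^ ?d \<le> (2 * max 1 ((norm x)\<^sup>2)) ^ ?d"
        by (intro power_mono) auto
      also have "\<dots> = 2 ^ ?d * (max 1 ((norm x)\<^sup>2)) ^ ?d" by (simp add: power_mult_distrib)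
      also have "(max 1 ((norm x)\<^sup>2)) ^ ?d \<le> 1 + ((norm x)\<^sup>2) ^ ?d"
        by (simp add: max_def)
      finally show ?thesis by simp
    qed
    have q: "(\<Prod>b\<in>Basis. 1 + (x \<bullet> b)\<^sup>2) \<le> (1 + (norm x)\<^sup>2) ^ ?d"
    proof -
      have "(\<Prod>b\<in>(Basis::'a set). 1 + (x \<bullet> b)\<^sup>2) \<le> (\<Prod>b\<in>(Basis::'a set). 1 + (norm x)\<^sup>2)"
      proof (intro prod_mono conjI)
        fix b :: 'a assume "b \<in> Basis"
        then have "\<bar>x \<bullet> b\<bar> \<le> norm x" by (rule Basis_le_norm)
        then have "\<bar>x \<bullet> b\<bar>\<^sup>2 \<le> (norm x)\<^sup>2" by (intro power_mono) auto
        then show "1 + (x \<bullet> b)\<^sup>2 \<le> 1 + (norm x)\<^sup>2" by simp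
      qed simp
      then show ?thesis by simp
    qed
    have "(?f x)\<^sup>2 * (\<Prod>b\<in>Basis. 1 + (x \<bullet> b)\<^sup>2) \<le> (?f x)\<^sup>2 * (2 ^ ?d * (1 + ((norm x)\<^sup>2) ^ ?d))"
      using order_trans[OF q p] by (intro mult_left_mono) auto
    also have "\<dots> = 2 ^ ?d * (\<bar>?f x\<bar>\<^sup>2 + (norm x ^ ?d * \<bar>?f x\<bar>)\<^sup>2)"
      by (simp add: algebra_simps power_mult_distrib flip: power_mult)
    also have "\<dots> \<le> 2 ^ ?d * (C\<^sup>2 + D\<^sup>2)"
      using C[of x] D[of x] by (intro mult_left_mono add_mono power_mono) auto
    finally have le: "(?f x)\<^sup>2 * (\<Prod>b\<in>Basis. 1 + (x \<bullet> b)\<^sup>2) \<le> 2 ^ ?d * (C\<^sup>2 + D\<^sup>2)" .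
    have "(\<Prod>b\<in>Basis. 1 + (x \<bullet> b)\<^sup>2) > 0" by (intro prod_pos) (auto intro: add_pos_nonneg)
    then show ?thesis
      using le by (simp only: prod_inversef[unfolded comp_def] divide_inverse[symmetric] pos_le_divide_eq)
  qed
  have "integrable lborel (\<lambda>x. 2 ^ ?d * (C\<^sup>2 + D\<^sup>2) * (\<Prod>b\<in>(Basis::'a set). inverse (1 + (x \<bullet> b)\<^sup>2)))"
    by (intro integrable_mult_right integrable_lborel_prod_Basis[of "\<lambda>x. inverse (1 + x\<^sup>2)"]
        integrable_inverse_one_plus_square) auto
  then have "integrable lborel (\<lambda>x. (?f x)\<^sup>2)"
    by (rule Bochner_Integration.integrable_bound)
       (use bound in \<open>auto intro!: AE_I2 order_trans[OF bound] abs_ge_self\<close>)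
  then show ?thesis by (simp add: L2_def)
qed

abbreviation schwartz_inner :: "'a::euclidean_space schwartz \<Rightarrow> 'a schwartz \<Rightarrow> real" where
  "schwartz_inner \<phi> \<psi> \<equiv> L2_inner lborel (schwartz_apply \<phi>) (schwartz_apply \<psi>)"

lemma schwartz_sq_lincomb:
  "schwartz_sq (a *\<^sub>R \<phi> + b *\<^sub>R \<psi>) = a\<^sup>2 * schwartz_sq \<phi> + 2 * a * b * schwartz_inner \<phi> \<psi> + b\<^sup>2 * schwartz_sq \<psi>"
proof -
  have "schwartz_apply (a *\<^sub>R \<phi> + b *\<^sub>R \<psi>) = (\<lambda>x. a * schwartz_apply \<phi> x + b * schwartz_apply \<psi> x)"
    by (auto simp: schwartz_apply_linear)
  then show ?thesis by (simp add: L2_sq_lincomb schwartz_L2)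
qed

text \<open>Directional derivatives of polynomials are polynomials; this closure property drives the
  induction over iterated derivatives below.\<close>

lemma real_polynomial_function_derivative:
  assumes "real_polynomial_function Q"
  shows "\<exists>D. (\<forall>x. (Q has_derivative D x) (at x)) \<and> (\<forall>b. real_polynomial_function (\<lambda>x. D x b))"
  using assms
proof (induction rule: real_polynomial_function.induct)
  case (linear f)
  then show ?case
    by (intro exI[of _ "\<lambda>x. f"])
       (auto intro: bounded_linear_imp_has_derivative real_polynomial_function.intros(2))
next
  case (const c)
  show ?case
    by (intro exI[of _ "\<lambda>x b. 0"]) (auto intro: real_polynomial_function.intros(2))
next
  case (add f g)
  then obtain D E where
    "\<And>x. (f has_derivative D x) (at x)" "\<And>b. real_polynomial_function (\<lambda>x. D x b)"
    "\<And>x. (g has_derivative E x) (at x)" "\<And>b. real_polynomial_function (\<lambda>x. E x b)" by blast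
  then show ?case
    by (intro exI[of _ "\<lambda>x b. D x b + E x b"])
       (auto intro: real_polynomial_function.intros(3) has_derivative_add)
next
  case (mult f g)
  then obtain D E where
    "\<And>x. (f has_derivative D x) (at x)" "\<And>b. real_polynomial_function (\<lambda>x. D x b)"
    "\<And>x. (g has_derivative E x) (at x)" "\<And>b. real_polynomial_function (\<lambda>x. E x b)" by blast
  with mult.hyps show ?case
    by (intro exI[of _ "\<lambda>x b. f x * E x b + D x b * g x"])
       (auto intro!: real_polynomial_function.intros(3,4) has_derivative_mult)
qed

lemma real_polynomial_function_growth:
  assumes "real_polynomial_function Q"
  shows "\<exists>C N. \<forall>x. \<bar>Q x\<bar> \<le> C * (1 + norm x) ^ N"
  using assms
proof (induction rule: real_polynomial_function.induct)
  case (linear f)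
  then interpret bounded_linear f .
  obtain K where K: "K > 0" "\<And>x. \<bar>f x\<bar> \<le> norm x * K" using pos_bounded by auto
  have "\<bar>f x\<bar> \<le> K * (1 + norm x) ^ 1" for x using K(1) K(2)[of x] by (simp add: algebra_simps)
  then show ?case by blast
next
  case (const c)
  show ?case by (intro exI[of _ "\<bar>c\<bar>"] exI[of _ 0]) simp
next
  case (add f g)
  then obtain C N D M where *: "\<And>x. \<bar>f x\<bar> \<le> C * (1 + norm x) ^ N"
    "\<And>x. \<bar>g x\<bar> \<le> D * (1 + norm x) ^ M" by blast
  have "0 \<le> C" "0 \<le> D" using *(1)[of 0] *(2)[of 0] by auto
  have "\<bar>f x + g x\<bar> \<le> (C + D) * (1 + norm x) ^ max N M" for x
  proof -
    have "\<bar>f x + g x\<bar> \<le> C * (1 + norm x) ^ N + D * (1 + norm x) ^ M"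
      using *[of x] by linarith
    also have "\<dots> \<le> C * (1 + norm x) ^ max N M + D * (1 + norm x) ^ max N M"
      using \<open>0 \<le> C\<close> \<open>0 \<le> D\<close> by (intro add_mono mult_left_mono power_increasing) auto
    finally show ?thesis by (simp add: algebra_simps)
  qed
  then show ?case by blast
next
  case (mult f g)
  then obtain C N D M where *: "\<And>x. \<bar>f x\<bar> \<le> C * (1 + norm x) ^ N"
    "\<And>x. \<bar>g x\<bar> \<le> D * (1 + norm x) ^ M" by blast
  have "\<bar>f x * g x\<bar> \<le> (C * D) * (1 + norm x) ^ (N + M)" for x
  proof -
    have "\<bar>f x * g x\<bar> \<le> (C * (1 + norm x) ^ N) * (D * (1 + norm x) ^ M)"
      unfolding abs_mult using * order_trans[OF abs_ge_zero *(1)] by (intro mult_mono) auto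
    then show ?thesis by (simp add: power_add mult_ac)
  qed
  then show ?case by blast
qed

text \<open>Differentiating \<open>Q exp (- P)\<close> in the direction \<open>b\<close> replaces \<open>Q\<close> by the polynomial
  \<open>\<partial>\<^sub>b Q - Q \<partial>\<^sub>b P\<close>.\<close>

lemma iter_deriv_poly_exp:
  fixes P :: "'a::euclidean_space \<Rightarrow> real"
  assumes P: "real_polynomial_function P"
  shows "\<exists>Q. real_polynomial_function Q \<and> iter_deriv bs (\<lambda>x. exp (- P x)) = (\<lambda>x. Q x * exp (- P x))"
proof (induction bs)
  case Nil
  show ?case by (intro exI[of _ "\<lambda>x. 1"]) (auto intro: real_polynomial_function.intros(2))
next
  case (Cons b bs)
  then obtain Q where Q: "real_polynomial_function Q"
    and eq: "iter_deriv bs (\<lambda>x. exp (- P x)) = (\<lambda>x. Q x * exp (- P x))" by blast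
  obtain D where D: "\<And>x. (P has_derivative D x) (at x)" "\<And>b. real_polynomial_function (\<lambda>x. D x b)"
    using real_polynomial_function_derivative[OF P] by blast
  obtain E where E: "\<And>x. (Q has_derivative E x) (at x)" "\<And>b. real_polynomial_function (\<lambda>x. E x b)"
    using real_polynomial_function_derivative[OF Q] by blast
  have "((\<lambda>x. Q x * exp (- P x)) has_derivative (\<lambda>h. (E x h - Q x * D x h) * exp (- P x))) (at x)" for x
    by (rule has_derivative_eq_rhs,
        (rule derivative_intros D E)+) (auto simp: algebra_simps)
  then have "frechet_derivative (\<lambda>x. Q x * exp (- P x)) (at x) = (\<lambda>h. (E x h - Q x * D x h) * exp (- P x))" for x
    by (rule frechet_derivative_at[symmetric])
  then show ?case
    using D(2)[of b] E(2)[of b] Q by (intro exI[of _ "\<lambda>x. E x b - Q x * D x b"])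
      (auto simp: eq intro!: real_polynomial_function_diff real_polynomial_function.intros(4))
qed

lemma power_le_fact_exp: "0 \<le> y \<Longrightarrow> y ^ n \<le> fact n * exp (y::real)"
proof -
  assume y: "0 \<le> y"
  have s: "(\<lambda>n. y ^ n /\<^sub>R fact n) sums exp y" by (rule exp_converges)
  have "y ^ n /\<^sub>R fact n = sum (\<lambda>n. y ^ n /\<^sub>R fact n) {n}" by simp
  also have "\<dots> \<le> exp y"
    using s y by (simp only: sums_unique[OF s], intro sum_le_suminf) (auto simp: sums_iff)
  finally show ?thesis by (simp add: field_simps)
qed

text \<open>Every derivative is a polynomial times \<open>exp (- P)\<close>, and the quadratic growth of \<open>P\<close> beats any
  polynomial.\<close>

lemma schwartz_fun_exp_poly:
  fixes P :: "'a::euclidean_space \<Rightarrow> real"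
  assumes P: "real_polynomial_function P" and c: "c > 0" and low: "\<And>x. c * (norm x)\<^sup>2 - K \<le> P x"
  shows "schwartz_fun (\<lambda>x. exp (- P x))"
  unfolding schwartz_fun_def
proof (intro ballI conjI allI)
  fix bs :: "'a list" and x
  obtain Q where Q: "real_polynomial_function Q"
    and eq: "iter_deriv bs (\<lambda>x. exp (- P x)) = (\<lambda>x. Q x * exp (- P x))"
    using iter_deriv_poly_exp[OF P] by blast
  obtain D where D: "(P has_derivative D x) (at x)"
    using real_polynomial_function_derivative[OF P] by blast
  obtain E where E: "(Q has_derivative E x) (at x)"
    using real_polynomial_function_derivative[OF Q] by blast
  show "iter_deriv bs (\<lambda>x. exp (- P x)) differentiable at x"
    unfolding eq by (rule differentiableI, (rule derivative_intros D E)+)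
next
  fix bs :: "'a list" and k :: nat
  obtain Q where Q: "real_polynomial_function Q"
    and eq: "iter_deriv bs (\<lambda>x. exp (- P x)) = (\<lambda>x. Q x * exp (- P x))"
    using iter_deriv_poly_exp[OF P] by blast
  obtain C N where C: "\<And>x. \<bar>Q x\<bar> \<le> C * (1 + norm x) ^ N"
    using real_polynomial_function_growth[OF Q] by blast
  have C0: "0 \<le> C" using C[of 0] by simp
  have "norm x ^ k * \<bar>Q x * exp (- P x)\<bar> \<le> C * fact (k + N) * exp (1 + 1 / c + K)" for x
  proof -
    let ?t = "norm x"
    have "?t ^ k * \<bar>Q x * exp (- P x)\<bar> = ?t ^ k * \<bar>Q x\<bar> * exp (- P x)" by (simp add: abs_mult)
    also have "\<dots> \<le> (1 + ?t) ^ k * (C * (1 + ?t) ^ N) * exp (K - c * ?t\<^sup>2)"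
      using low[of x] C0 by (intro mult_mono C power_mono) auto
    also have "\<dots> = C * (1 + ?t) ^ (k + N) * exp (K - c * ?t\<^sup>2)" by (simp add: power_add)
    also have "\<dots> \<le> C * (fact (k + N) * exp (1 + ?t)) * exp (K - c * ?t\<^sup>2)"
      using C0 by (intro mult_right_mono mult_left_mono power_le_fact_exp) auto
    also have "\<dots> = C * fact (k + N) * exp (1 + ?t + K - c * ?t\<^sup>2)"
      by (simp add: exp_add exp_diff)
    also have "\<dots> \<le> C * fact (k + N) * exp (1 + 1 / c + K)"
    proof -
      (* completing the square *)
      have "0 \<le> c * (?t - 1 / (2 * c))\<^sup>2" using c by simp
      also have "\<dots> = c * ?t\<^sup>2 - ?t + 1 / (4 * c)"
        using c by (simp add: power2_eq_square field_simps)
      finally have "?t - c * ?t\<^sup>2 \<le> 1 / (4 * c)" by simp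
      also have "\<dots> \<le> 1 / c" using c by (simp add: field_simps)
      finally show ?thesis using C0 by (intro mult_left_mono) auto
    qed
    finally show ?thesis .
  qed
  then show "\<exists>C. \<forall>x. norm x ^ k * \<bar>iter_deriv bs (\<lambda>x. exp (- P x)) x\<bar> \<le> C"
    unfolding eq by blast
qed

text \<open>For \<open>s \<ge> 0\<close> the numbers \<open>k s\<^sup>k\<close> tend to \<open>0\<close> if \<open>s < 1\<close> and to infinity otherwise.  Hence
  \<open>exp (- k \<Sum>\<^sub>b t\<^sub>b\<^sup>2\<^sup>k)\<close>, with \<open>t\<close> the affine coordinates that map the box to the cube \<open>(- 1, 1)\<^sup>D\<^sup>I\<^sup>M\<close>,
  tends to the indicator function everywhere, the boundary included.  Since \<open>k s\<^sup>k \<ge> s - 1\<close>, a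
  multiple of the Gaussian with \<open>k = 1\<close> dominates the whole sequence.\<close>

lemma schwartz_approx_box:
  fixes l u :: "'a::euclidean_space"
  assumes ne: "box l u \<noteq> {}"
  shows "\<exists>(\<phi> :: nat \<Rightarrow> 'a schwartz) \<psi>. \<psi> \<in> L2 lborel \<and> (\<forall>k x. \<bar>schwartz_apply (\<phi> k) x\<bar> \<le> \<psi> x) \<and>
    (\<forall>x. (\<lambda>k. schwartz_apply (\<phi> k) x) \<longlonglongrightarrow> indicator (box l u) x)"
proof -
  have lu: "l \<bullet> b < u \<bullet> b" if "b \<in> Basis" for b
    using ne that by (auto simp: box_eq_empty not_le)
  define a where "a = (1/2) *\<^sub>R (l + u)"
  define r where "r b = (u \<bullet> b - l \<bullet> b) / 2" for b
  define t where "t x b = (x \<bullet> b - a \<bullet> b) / r b" for x b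
  have r: "r b > 0" if "b \<in> Basis" for b using lu[OF that] by (simp add: r_def)
  define P where "P k x = (\<Sum>b\<in>Basis. real (Suc k) * ((t x b)\<^sup>2) ^ Suc k)" for k x
  have in_box: "x \<in> box l u \<longleftrightarrow> (\<forall>b\<in>Basis. (t x b)\<^sup>2 < 1)" for x
  proof -
    have "l \<bullet> b < x \<bullet> b \<and> x \<bullet> b < u \<bullet> b \<longleftrightarrow> (t x b)\<^sup>2 < 1" if "b \<in> Basis" for b
    proof -
      have "(t x b)\<^sup>2 < 1 \<longleftrightarrow> \<bar>t x b\<bar> < 1" by (simp add: abs_square_less_1)
      also have "\<dots> \<longleftrightarrow> \<bar>x \<bullet> b - a \<bullet> b\<bar> < r b"
        using r[OF that] by (simp add: t_def abs_divide)
      also have "\<dots> \<longleftrightarrow> l \<bullet> b < x \<bullet> b \<and> x \<bullet> b < u \<bullet> b"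
        by (auto simp: a_def r_def abs_less_iff inner_add_left field_simps)
      finally show ?thesis by blast
    qed
    then show ?thesis by (auto simp: mem_box)
  qed
  have low: "s - 1 \<le> real (Suc k) * s ^ Suc k" if "0 \<le> s" for s :: real and k
  proof (cases "s \<le> 1")
    case False
    then have "1 * s ^ 1 \<le> real (Suc k) * s ^ Suc k"
      by (intro mult_mono power_increasing) auto
    then show ?thesis by simp
  qed (use that in \<open>auto intro: order_trans[of _ 0]\<close>)
  have P0: "P 0 x - DIM('a) \<le> P k x" for k x
  proof -
    have "P 0 x - DIM('a) = (\<Sum>b\<in>(Basis::'a set). (t x b)\<^sup>2 - 1)"
      by (simp add: P_def sum_subtractf)
    also have "\<dots> \<le> P k x" unfolding P_def by (intro sum_mono low) simp
    finally show ?thesis .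
  qed
  have Ppoly: "real_polynomial_function (P k)" for k
  proof -
    have "real_polynomial_function (\<lambda>x. t x b)" for b
    proof -
      have "(\<lambda>x. t x b) = (\<lambda>x. (1 / r b) * (x \<bullet> b) + (- (a \<bullet> b) / r b))"
        by (auto simp: t_def diff_divide_distrib)
      moreover have "real_polynomial_function (\<lambda>x. (1 / r b) * (x \<bullet> b) + (- (a \<bullet> b) / r b))"
        by (intro real_polynomial_function.intros bounded_linear_inner_left)
      ultimately show ?thesis by simp
    qed
    then show ?thesis unfolding P_def
      by (intro real_polynomial_function_sum real_polynomial_function.intros(4)
          real_polynomial_function.intros(2) real_polynomial_function_power) auto
  qed
  (* with r b <= sqrt R for every b, the quadratic growth of P 0 is governed by 1 / R *)
  define R where "R = (\<Sum>b\<in>(Basis::'a set). (r b)\<^sup>2)"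
  have rR: "(r b)\<^sup>2 \<le> R" if "b \<in> Basis" for b
    unfolding R_def using that by (intro member_le_sum) auto
  obtain b0 :: 'a where "b0 \<in> Basis" using nonempty_Basis by blast
  then have R: "R > 0" using rR[of b0] r[of b0] by (smt (verit) zero_less_power)
  have Plow: "1 / (2 * R) * (norm x)\<^sup>2 - ((norm a)\<^sup>2 / R + DIM('a)) \<le> P k x" for k x
  proof -
    have "(norm (x - a))\<^sup>2 / R = (\<Sum>b\<in>Basis. (x \<bullet> b - a \<bullet> b)\<^sup>2 / R)"
      unfolding power2_norm_eq_inner euclidean_inner[of "x - a" "x - a"]
      by (simp add: inner_diff_left power2_eq_square sum_divide_distrib)
    also have "\<dots> \<le> P 0 x"
      unfolding P_def
    proof (rule sum_mono)
      fix b :: 'a assume b: "b \<in> Basis"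
      have "(x \<bullet> b - a \<bullet> b)\<^sup>2 / R \<le> (x \<bullet> b - a \<bullet> b)\<^sup>2 / (r b)\<^sup>2"
        using rR[OF b] r[OF b] R by (intro divide_left_mono) auto
      then show "(x \<bullet> b - a \<bullet> b)\<^sup>2 / R \<le> real (Suc 0) * ((t x b)\<^sup>2) ^ Suc 0"
        by (simp add: t_def power_divide)
    qed
    finally have 1: "(norm (x - a))\<^sup>2 / R \<le> P 0 x" .
    have "norm x \<le> norm (x - a) + norm a" using norm_triangle_ineq[of "x - a" a] by simp
    then have "(norm x)\<^sup>2 \<le> (norm (x - a) + norm a)\<^sup>2" by (intro power_mono) auto
    also have "\<dots> \<le> 2 * (norm (x - a))\<^sup>2 + 2 * (norm a)\<^sup>2"
      using sum_squares_bound[of "norm (x - a)" "norm a"] by (simp add: power2_sum)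
    finally have "(norm x)\<^sup>2 / (2 * R) \<le> (2 * (norm (x - a))\<^sup>2 + 2 * (norm a)\<^sup>2) / (2 * R)"
      using R by (intro divide_right_mono) auto
    also have "\<dots> = (norm (x - a))\<^sup>2 / R + (norm a)\<^sup>2 / R"
      using R by (simp add: field_simps)
    finally show ?thesis using 1 P0[of x k] by simp
  qed
  define \<phi> where "\<phi> k = Schwartz (\<lambda>x. exp (- P k x))" for k
  have app: "schwartz_apply (\<phi> k) = (\<lambda>x. exp (- P k x))" for k
    unfolding \<phi>_def using R
    by (subst Schwartz_inverse) (auto intro!: schwartz_fun_exp_poly[OF Ppoly _ Plow])
  (* P 0 - DIM <= P k turns the member for k = 0 into a dominating function *)
  define \<psi> where "\<psi> x = exp (DIM('a)) * schwartz_apply (\<phi> 0) x" for x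
  have "\<psi> \<in> L2 lborel" unfolding \<psi>_def by (intro L2_scale(1) schwartz_L2)
  moreover have "\<bar>schwartz_apply (\<phi> k) x\<bar> \<le> \<psi> x" for k x
    using P0[of x k] by (simp add: app \<psi>_def flip: exp_add)
  moreover have "(\<lambda>k. schwartz_apply (\<phi> k) x) \<longlonglongrightarrow> indicator (box l u) x" for x
  proof (cases "x \<in> box l u")
    case True
    have "(\<lambda>k. P k x) \<longlonglongrightarrow> (\<Sum>b\<in>(Basis::'a set). 0)"
      unfolding P_def
    proof (rule tendsto_sum)
      fix b :: 'a assume "b \<in> Basis"
      then have "norm ((t x b)\<^sup>2) < 1" using True in_box by simp
      then show "(\<lambda>k. real (Suc k) * ((t x b)\<^sup>2) ^ Suc k) \<longlonglongrightarrow> 0"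
        by (intro LIMSEQ_Suc[OF powser_times_n_limit_0])
    qed
    then have "(\<lambda>k. exp (- P k x)) \<longlonglongrightarrow> exp (- (\<Sum>b\<in>(Basis::'a set). 0))"
      by (intro tendsto_intros)
    then show ?thesis using True by (simp add: app)
  next
    case False
    then obtain b where b: "b \<in> Basis" "1 \<le> (t x b)\<^sup>2" using in_box by (auto simp: not_less)
    have Pk: "real (Suc k) \<le> P k x" for k
    proof -
      have "real (Suc k) * 1 \<le> real (Suc k) * ((t x b)\<^sup>2) ^ Suc k"
        by (intro mult_left_mono one_le_power b(2)) simp
      also have "\<dots> \<le> P k x"
        unfolding P_def using b(1) by (intro member_le_sum) auto
      finally show ?thesis by simp
    qed
    have le: "exp (- P k x) \<le> exp (- real (Suc k))" for k using Pk[of k] by simp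
    have "(\<lambda>k. exp (- real (Suc k))) \<longlonglongrightarrow> 0"
    proof -
      have "(\<lambda>k. exp (- 1 :: real) ^ Suc k) \<longlonglongrightarrow> 0"
        by (intro LIMSEQ_Suc[OF LIMSEQ_power_zero]) simp
      then show ?thesis by (simp only: exp_of_nat_mult[symmetric]) simp
    qed
    then have "(\<lambda>k. exp (- P k x)) \<longlonglongrightarrow> 0"
      by (rule tendsto_sandwich[OF _ _ tendsto_const, rotated 2]) (use le in auto)
    then show ?thesis using False by (simp add: app)
  qed
  ultimately show ?thesis by blast
qed

section \<open>Tensor products of functions\<close>

interpretation lborel_product: product_sigma_finite "\<lambda>_::nat. lborel :: 'a::euclidean_space measure"
  by standard

lemma tensor_measurable [measurable]:
  fixes f :: "nat \<Rightarrow> 'a::euclidean_space \<Rightarrow> real"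
  assumes [measurable]: "\<And>i. i < n \<Longrightarrow> f i \<in> borel_measurable borel"
  shows "(\<lambda>x. \<Prod>i<n. f i (x i)) \<in> borel_measurable (lborel_pow n)"
  by (intro borel_measurable_prod measurable_PiM_component_rev) auto

lemma L2_tensor:
  fixes f :: "nat \<Rightarrow> 'a::euclidean_space \<Rightarrow> real"
  assumes "\<And>i. i < n \<Longrightarrow> f i \<in> L2 lborel"
  shows "(\<lambda>x. \<Prod>i<n. f i (x i)) \<in> L2 (lborel_pow n)"
proof -
  have "integrable (lborel_pow n) (\<lambda>x. \<Prod>i<n. (f i (x i))\<^sup>2)"
    using assms by (intro lborel_product.product_integrable_prod) (auto simp: L2_def)
  moreover have "(\<lambda>x. \<Prod>i<n. f i (x i)) \<in> borel_measurable (lborel_pow n)"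
    using assms by (intro tensor_measurable) (auto simp: L2_def)
  ultimately show ?thesis
    by (simp add: L2_def prod_power_distrib)
qed

lemma L2_inner_tensor:
  fixes f g :: "nat \<Rightarrow> 'a::euclidean_space \<Rightarrow> real"
  assumes "\<And>i. i < n \<Longrightarrow> f i \<in> L2 lborel" "\<And>i. i < n \<Longrightarrow> g i \<in> L2 lborel"
  shows "L2_inner (lborel_pow n) (\<lambda>x. \<Prod>i<n. f i (x i)) (\<lambda>x. \<Prod>i<n. g i (x i)) =
    (\<Prod>i<n. L2_inner lborel (f i) (g i))"
proof -
  have "L2_inner (lborel_pow n) (\<lambda>x. \<Prod>i<n. f i (x i)) (\<lambda>x. \<Prod>i<n. g i (x i)) =
      (LINT x|lborel_pow n. (\<Prod>i<n. f i (x i) * g i (x i)))"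
    by (simp add: L2_inner_def prod.distrib)
  also have "\<dots> = (\<Prod>i<n. (LINT x|lborel. f i x * g i x))"
    using assms by (intro lborel_product.product_integral_prod L2_mult_integrable) auto
  finally show ?thesis by (simp add: L2_inner_def)
qed

lemma tensor_power_L2: "tensor_power n (\<phi> :: 'a::euclidean_space schwartz) \<in> L2 (lborel_pow n)"
  unfolding tensor_power_def by (intro L2_tensor schwartz_L2)

lemma L2_inner_tensor_power:
  "L2_inner (lborel_pow n) (tensor_power n \<phi>) (tensor_power n \<psi>) =
    L2_inner lborel (schwartz_apply \<phi>) (schwartz_apply \<psi>) ^ n"
  using L2_inner_tensor[of n "\<lambda>_. schwartz_apply \<phi>" "\<lambda>_. schwartz_apply \<psi>"]
  by (simp add: tensor_power_def[abs_def] schwartz_L2)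

section \<open>Permutations of coordinates\<close>

lemma permute_coordinates_measurable [measurable]:
  assumes \<sigma>: "\<sigma> permutes {..<n}"
  shows "(\<lambda>x. x \<circ> \<sigma>) \<in> measurable (lborel_pow n) (lborel_pow n :: (nat \<Rightarrow> 'a::euclidean_space) measure)"
proof -
  have "(\<lambda>(x::nat \<Rightarrow> 'a) i. x (\<sigma> i)) \<in> measurable (lborel_pow n) (lborel_pow n)"
  proof (rule measurable_PiM_single')
    fix i assume "i \<in> {..<n}"
    then have "\<sigma> i \<in> {..<n}" using permutes_in_image[OF \<sigma>] by blast
    then show "(\<lambda>x. x (\<sigma> i)) \<in> measurable (lborel_pow n :: (nat \<Rightarrow> 'a) measure) lborel"
      by (rule measurable_component_singleton)
  next
    show "(\<lambda>(x::nat \<Rightarrow> 'a) i. x (\<sigma> i)) \<in> space (lborel_pow n) \<rightarrow> (\<Pi>\<^sub>E i\<in>{..<n}. space lborel)"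
      using permutes_not_in[OF \<sigma>] by (auto simp: space_PiM PiE_iff extensional_def)
  qed
  then show ?thesis by (simp add: comp_def)
qed

text \<open>Permuting the coordinates maps a product set to a product set with the same factors, and
  product sets determine the product measure.\<close>

lemma distr_permute_coordinates:
  assumes \<sigma>: "\<sigma> permutes {..<n}"
  shows "distr (lborel_pow n) (lborel_pow n) (\<lambda>x. x \<circ> \<sigma>) = (lborel_pow n :: (nat \<Rightarrow> 'a::euclidean_space) measure)"
proof (rule lborel_product.PiM_eqI)
  fix A :: "nat \<Rightarrow> 'a set" assume A: "\<And>i. i \<in> {..<n} \<Longrightarrow> A i \<in> sets lborel"
  let ?\<tau> = "inv_into UNIV \<sigma>"
  have \<tau>: "?\<tau> permutes {..<n}" by (rule permutes_inv[OF \<sigma>])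
  have in_image: "?\<tau> i \<in> {..<n} \<longleftrightarrow> i \<in> {..<n}" for i by (rule permutes_in_image[OF \<tau>])
  have "(\<lambda>x. x \<circ> \<sigma>) -` Pi\<^sub>E {..<n} A \<inter> space (lborel_pow n) = Pi\<^sub>E {..<n} (\<lambda>i. A (?\<tau> i))"
  proof (intro subset_antisym subsetI)
    fix x assume x: "x \<in> (\<lambda>x. x \<circ> \<sigma>) -` Pi\<^sub>E {..<n} A \<inter> space (lborel_pow n)"
    have "x i \<in> A (?\<tau> i)" if "i \<in> {..<n}" for i
    proof -
      have "(x \<circ> \<sigma>) (?\<tau> i) \<in> A (?\<tau> i)" using x in_image that by (auto simp: PiE_iff)
      then show ?thesis by (simp add: permutes_inverses(1)[OF \<sigma>])
    qed
    then show "x \<in> Pi\<^sub>E {..<n} (\<lambda>i. A (?\<tau> i))" using x by (auto simp: space_PiM PiE_iff)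
  next
    fix x assume x: "x \<in> Pi\<^sub>E {..<n} (\<lambda>i. A (?\<tau> i))"
    have "x (\<sigma> i) \<in> A i" if "i \<in> {..<n}" for i
    proof -
      have "\<sigma> i \<in> {..<n}" using permutes_in_image[OF \<sigma>] that by blast
      then have "x (\<sigma> i) \<in> A (?\<tau> (\<sigma> i))" using x by (auto simp: PiE_iff)
      then show ?thesis by (simp add: permutes_inverses(2)[OF \<sigma>])
    qed
    then show "x \<in> (\<lambda>x. x \<circ> \<sigma>) -` Pi\<^sub>E {..<n} A \<inter> space (lborel_pow n)"
      using x permutes_not_in[OF \<sigma>] by (auto simp: space_PiM PiE_iff extensional_def)
  qed
  then have "emeasure (distr (lborel_pow n) (lborel_pow n) (\<lambda>x. x \<circ> \<sigma>)) (Pi\<^sub>E {..<n} A) =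
      emeasure (lborel_pow n) (Pi\<^sub>E {..<n} (\<lambda>i. A (?\<tau> i)))"
    using A permute_coordinates_measurable[OF \<sigma>] by (subst emeasure_distr) auto
  also have "\<dots> = (\<Prod>i<n. emeasure lborel (A (?\<tau> i)))"
    using A in_image by (intro lborel_product.emeasure_PiM) auto
  also have "\<dots> = (\<Prod>i<n. emeasure lborel (A i))"
    using prod.permute[OF \<tau>, of "\<lambda>i. emeasure lborel (A i)"] by (simp add: comp_def)
  finally show "emeasure (distr (lborel_pow n) (lborel_pow n) (\<lambda>x. x \<circ> \<sigma>)) (Pi\<^sub>E {..<n} A) =
      (\<Prod>i<n. emeasure lborel (A i))" .
qed auto

lemma integral_permute_coordinates:
  fixes f :: "(nat \<Rightarrow> 'a::euclidean_space) \<Rightarrow> real"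
  assumes \<sigma>: "\<sigma> permutes {..<n}" and f: "f \<in> borel_measurable (lborel_pow n)"
  shows "(LINT x|lborel_pow n. f (x \<circ> \<sigma>)) = (LINT x|lborel_pow n. f x)"
  using integral_distr[OF permute_coordinates_measurable[OF \<sigma>] f]
  by (simp add: distr_permute_coordinates[OF \<sigma>])

lemma L2_permute_coordinates:
  fixes f :: "(nat \<Rightarrow> 'a::euclidean_space) \<Rightarrow> real"
  assumes \<sigma>: "\<sigma> permutes {..<n}" and f: "f \<in> L2 (lborel_pow n)"
  shows "(\<lambda>x. f (x \<circ> \<sigma>)) \<in> L2 (lborel_pow n)"
    and "L2_sq (lborel_pow n) (\<lambda>x. f (x \<circ> \<sigma>)) = L2_sq (lborel_pow n) f"
proof -
  have m: "f \<in> borel_measurable (lborel_pow n)" and i: "integrable (lborel_pow n) (\<lambda>x. (f x)\<^sup>2)"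
    using f by (auto simp: L2_def)
  have "integrable (lborel_pow n) (\<lambda>x. (f (x \<circ> \<sigma>))\<^sup>2)"
    using integrable_distr_eq[OF permute_coordinates_measurable[OF \<sigma>], of "\<lambda>x. (f x)\<^sup>2"] i m
    by (simp add: distr_permute_coordinates[OF \<sigma>])
  then show "(\<lambda>x. f (x \<circ> \<sigma>)) \<in> L2 (lborel_pow n)"
    using measurable_compose[OF permute_coordinates_measurable[OF \<sigma>] m] by (simp add: L2_def)
  show "L2_sq (lborel_pow n) (\<lambda>x. f (x \<circ> \<sigma>)) = L2_sq (lborel_pow n) f"
    unfolding L2_sq_def using m by (intro integral_permute_coordinates[OF \<sigma>, of "\<lambda>x. (f x)\<^sup>2"]) simp
qed

section \<open>Polarization\<close>

text \<open>Adding or removing one fixed element of \<open>U - T\<close> is a sign-reversing involution.\<close>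

lemma sum_alternating_between:
  assumes "finite U" "T \<subseteq> U"
  shows "(\<Sum>S | T \<subseteq> S \<and> S \<subseteq> U. (- 1) ^ card S) = (if T = U then (- 1) ^ card U else (0::real))"
proof (cases "T = U")
  case True
  then have "{S. T \<subseteq> S \<and> S \<subseteq> U} = {U}" by auto
  then show ?thesis using True by simp
next
  case False
  then obtain x where x: "x \<in> U" "x \<notin> T" using assms by blast
  let ?flip = "\<lambda>S. if x \<in> S then S - {x} else insert x S"
  have "(\<Sum>S | T \<subseteq> S \<and> S \<subseteq> U. (- 1) ^ card S) = (\<Sum>S | T \<subseteq> S \<and> S \<subseteq> U. - ((- 1) ^ card S) :: real)"
  proof (rule sum.reindex_bij_witness[of _ ?flip ?flip])
    fix S assume S: "S \<in> {S. T \<subseteq> S \<and> S \<subseteq> U}"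
    then have "finite S" using assms finite_subset by blast
    then show "- ((- 1) ^ card (?flip S)) = ((- 1) ^ card S :: real)"
      using card.remove[of S x] by (cases "x \<in> S"; cases "card S") auto
  qed (use x in auto)
  then show ?thesis using False by (simp add: sum_negf)
qed

text \<open>Ryser's formula for the permanent.  Expand the product over all maps \<open>\<tau>\<close>: the sign of \<open>S\<close>
  is summed over all \<open>S\<close> that contain the range of \<open>\<tau>\<close>, which cancels unless \<open>\<tau>\<close> is onto.\<close>

lemma Ryser_permanent:
  fixes a :: "nat \<Rightarrow> nat \<Rightarrow> real"
  shows "(\<Sum>S\<in>Pow {..<n}. (- 1) ^ card S * (\<Prod>j<n. \<Sum>i\<in>S. a i j)) =
    (- 1) ^ n * (\<Sum>\<sigma> | \<sigma> permutes {..<n}. \<Prod>j<n. a (\<sigma> j) j)"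
proof -
  let ?I = "{..<n}"
  let ?M = "PiE ?I (\<lambda>_. ?I)"
  have finM: "finite ?M" by (intro finite_PiE) auto
  have expand: "(\<Prod>j<n. \<Sum>i\<in>S. a i j) = (\<Sum>\<tau>\<in>?M. if \<tau> ` ?I \<subseteq> S then \<Prod>j<n. a (\<tau> j) j else 0)"
    if "S \<in> Pow ?I" for S
  proof -
    have "finite S" using that finite_subset by blast
    then have "(\<Prod>j<n. \<Sum>i\<in>S. a i j) = (\<Sum>\<tau>\<in>PiE ?I (\<lambda>_. S). \<Prod>j<n. a (\<tau> j) j)"
      by (intro prod_sum_PiE) auto
    also have "PiE ?I (\<lambda>_. S) = {\<tau> \<in> ?M. \<tau> ` ?I \<subseteq> S}" using that by (auto simp: PiE_iff extensional_def)
    finally show ?thesis by (simp only: sum.inter_filter[OF finM])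
  qed
  have "(\<Sum>S\<in>Pow ?I. (- 1) ^ card S * (\<Prod>j<n. \<Sum>i\<in>S. a i j)) =
      (\<Sum>S\<in>Pow ?I. \<Sum>\<tau>\<in>?M. if \<tau> ` ?I \<subseteq> S then (- 1) ^ card S * (\<Prod>j<n. a (\<tau> j) j) else 0)"
    by (intro sum.cong refl) (simp add: expand sum_distrib_left if_distrib cong: if_cong)
  also have "\<dots> = (\<Sum>\<tau>\<in>?M. \<Sum>S\<in>Pow ?I. if \<tau> ` ?I \<subseteq> S then (- 1) ^ card S * (\<Prod>j<n. a (\<tau> j) j) else 0)"
    by (rule sum.swap)
  also have "\<dots> = (\<Sum>\<tau>\<in>?M. if \<tau> ` ?I = ?I then (- 1) ^ n * (\<Prod>j<n. a (\<tau> j) j) else 0)"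
  proof (rule sum.cong[OF refl])
    fix \<tau> assume "\<tau> \<in> ?M"
    then have sub: "\<tau> ` ?I \<subseteq> ?I" by (auto simp: PiE_iff)
    have "(\<Sum>S\<in>Pow ?I. if \<tau> ` ?I \<subseteq> S then (- 1) ^ card S * (\<Prod>j<n. a (\<tau> j) j) else 0) =
        (\<Sum>S\<in>{S \<in> Pow ?I. \<tau> ` ?I \<subseteq> S}. (- 1) ^ card S * (\<Prod>j<n. a (\<tau> j) j))"
      by (rule sum.inter_filter[symmetric]) simp
    also have "\<dots> = (\<Sum>S\<in>{S \<in> Pow ?I. \<tau> ` ?I \<subseteq> S}. (- 1) ^ card S) * (\<Prod>j<n. a (\<tau> j) j)"
      by (simp add: sum_distrib_right)
    also have "{S \<in> Pow ?I. \<tau> ` ?I \<subseteq> S} = {S. \<tau> ` ?I \<subseteq> S \<and> S \<subseteq> ?I}" by auto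
    finally show "(\<Sum>S\<in>Pow ?I. if \<tau> ` ?I \<subseteq> S then (- 1) ^ card S * (\<Prod>j<n. a (\<tau> j) j) else 0) =
        (if \<tau> ` ?I = ?I then (- 1) ^ n * (\<Prod>j<n. a (\<tau> j) j) else 0)"
      by (simp add: sum_alternating_between[OF _ sub])
  qed
  also have "\<dots> = (\<Sum>\<tau>\<in>{\<tau> \<in> ?M. \<tau> ` ?I = ?I}. (- 1) ^ n * (\<Prod>j<n. a (\<tau> j) j))"
    by (rule sum.inter_filter[symmetric, OF finM])
  also have "\<dots> = (\<Sum>\<sigma> | \<sigma> permutes ?I. (- 1) ^ n * (\<Prod>j<n. a (\<sigma> j) j))"
  proof (rule sum.reindex_bij_witness[of _ "\<lambda>\<sigma>. restrict \<sigma> ?I" "\<lambda>\<tau> i. if i \<in> ?I then \<tau> i else i"])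
    fix \<tau> assume \<tau>: "\<tau> \<in> {\<tau> \<in> ?M. \<tau> ` ?I = ?I}"
    then have im: "\<tau> ` ?I = ?I" by blast
    moreover have "inj_on \<tau> ?I" by (rule eq_card_imp_inj_on) (simp_all only: im finite_lessThan)
    ultimately have "bij_betw \<tau> ?I ?I" unfolding bij_betw_def by blast
    then have "bij_betw (\<lambda>i. if i \<in> ?I then \<tau> i else i) ?I ?I"
      by (rule iffD1[OF bij_betw_cong, rotated]) auto
    then have "(\<lambda>i. if i \<in> ?I then \<tau> i else i) permutes ?I"
      by (rule bij_imp_permutes) auto
    then show "(\<lambda>i. if i \<in> ?I then \<tau> i else i) \<in> {\<sigma>. \<sigma> permutes ?I}" by simp
    show "restrict (\<lambda>i. if i \<in> ?I then \<tau> i else i) ?I = \<tau>"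
      using \<tau> by (auto simp: fun_eq_iff restrict_def PiE_iff extensional_def)
    show "(- 1) ^ n * (\<Prod>j<n. a (if j \<in> ?I then \<tau> j else j) j) = (- 1) ^ n * (\<Prod>j<n. a (\<tau> j) j)"
      by simp
  next
    fix \<sigma> assume "\<sigma> \<in> {\<sigma>. \<sigma> permutes ?I}"
    then have \<sigma>: "\<sigma> permutes ?I" by simp
    show "(\<lambda>i. if i \<in> ?I then restrict \<sigma> ?I i else i) = \<sigma>"
      using permutes_not_in[OF \<sigma>] by (auto simp: fun_eq_iff)
    show "restrict \<sigma> ?I \<in> {\<tau> \<in> ?M. \<tau> ` ?I = ?I}"
      using permutes_image[OF \<sigma>] permutes_in_image[OF \<sigma>] by auto
  qed
  finally show ?thesis by (simp add: sum_distrib_left)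
qed

lemma L2_sym_L2: "f \<in> L2_sym n \<Longrightarrow> f \<in> L2 (lborel_pow n)"
  by (simp add: L2_sym_def)

lemma L2_sym_zero: "(\<lambda>x. 0) \<in> L2_sym n"
  by (simp add: L2_sym_def L2_zero)

text \<open>Polarization: by Ryser's formula the sum of the products \<open>\<Prod>\<^sub>j \<phi>\<^bsub>\<sigma> j\<^esub>(x\<^sub>j)\<close> over all permutations
  \<open>\<sigma>\<close> is a linear combination of tensor powers of the partial sums \<open>\<Sum>\<^sub>S \<phi>\<^sub>i\<close>.  For a symmetric \<open>g\<close> all
  these products have the same inner product with \<open>g\<close>.\<close>

lemma L2_sym_orthogonal_tensors:
  fixes g :: "(nat \<Rightarrow> 'a::euclidean_space) \<Rightarrow> real" and \<phi> :: "nat \<Rightarrow> 'a schwartz"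
  assumes g: "g \<in> L2_sym n" and orth: "\<And>\<phi>. L2_inner (lborel_pow n) g (tensor_power n \<phi>) = 0"
  shows "L2_inner (lborel_pow n) g (\<lambda>x. \<Prod>i<n. schwartz_apply (\<phi> i) (x i)) = 0"
proof -
  let ?I = "{..<n}" and ?M = "lborel_pow n :: (nat \<Rightarrow> 'a) measure"
  let ?F = "\<lambda>(\<sigma>::nat \<Rightarrow> nat) x. \<Prod>j<n. schwartz_apply (\<phi> (\<sigma> j)) (x j)"
  have gL2: "g \<in> L2 ?M" using g by (rule L2_sym_L2)
  have FL2: "?F \<sigma> \<in> L2 ?M" for \<sigma> by (intro L2_tensor schwartz_L2)
  have same: "L2_inner ?M (?F \<sigma>) g = L2_inner ?M (?F id) g" if \<sigma>: "\<sigma> permutes ?I" for \<sigma>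
  proof -
    let ?\<tau> = "inv_into UNIV \<sigma>"
    have \<tau>: "?\<tau> permutes ?I" by (rule permutes_inv[OF \<sigma>])
    have F: "?F \<sigma> x = ?F id (x \<circ> ?\<tau>)" for x
    proof -
      have "?F id (x \<circ> ?\<tau>) = (\<Prod>i<n. schwartz_apply (\<phi> (\<sigma> (?\<tau> i))) (x (?\<tau> i)))"
        by (simp add: permutes_inverses(1)[OF \<sigma>])
      also have "\<dots> = ?F \<sigma> x"
        using prod.permute[OF \<tau>, of "\<lambda>j. schwartz_apply (\<phi> (\<sigma> j)) (x j)"] by (simp add: comp_def)
      finally show ?thesis by simp
    qed
    have m [measurable]: "g \<in> borel_measurable ?M" "?F id \<in> borel_measurable ?M" "?F \<sigma> \<in> borel_measurable ?M"
      using gL2 FL2 by (auto intro: L2_measurable)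
    have gm: "(\<lambda>x. g (x \<circ> ?\<tau>)) \<in> borel_measurable ?M"
      by (rule measurable_compose[OF permute_coordinates_measurable[OF \<tau>] m(1)])
    have "L2_inner ?M (?F \<sigma>) g = (LINT x|?M. ?F \<sigma> x * g (x \<circ> ?\<tau>))"
      unfolding L2_inner_def
    proof (rule integral_cong_AE)
      have "AE x in ?M. g (x \<circ> ?\<tau>) = g x" using g \<tau> by (auto simp: L2_sym_def)
      then show "AE x in ?M. ?F \<sigma> x * g x = ?F \<sigma> x * g (x \<circ> ?\<tau>)" by eventually_elim simp
      show "(\<lambda>x. ?F \<sigma> x * g (x \<circ> ?\<tau>)) \<in> borel_measurable ?M"
        by (intro borel_measurable_times gm m)
    qed measurable
    also have "\<dots> = (LINT x|?M. ?F id (x \<circ> ?\<tau>) * g (x \<circ> ?\<tau>))" by (simp add: F del: comp_apply)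
    also have "\<dots> = L2_inner ?M (?F id) g"
      unfolding L2_inner_def
      by (rule integral_permute_coordinates[OF \<tau>, of "\<lambda>x. ?F id x * g x"]) measurable
    finally show ?thesis .
  qed
  have "0 = (\<Sum>S\<in>Pow ?I. (- 1) ^ card S * L2_inner ?M (tensor_power n (\<Sum>i\<in>S. \<phi> i)) g)"
    using orth by (simp add: L2_inner_commute[of _ _ g])
  also have "\<dots> = L2_inner ?M (\<lambda>x. \<Sum>S\<in>Pow ?I. (- 1) ^ card S * tensor_power n (\<Sum>i\<in>S. \<phi> i) x) g"
    by (rule L2_inner_sum_left[symmetric]) (auto intro: tensor_power_L2 gL2)
  also have "(\<lambda>x. \<Sum>S\<in>Pow ?I. (- 1) ^ card S * tensor_power n (\<Sum>i\<in>S. \<phi> i) x) =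
      (\<lambda>x. \<Sum>\<sigma> | \<sigma> permutes ?I. (- 1) ^ n * ?F \<sigma> x)"
  proof
    fix x
    show "(\<Sum>S\<in>Pow ?I. (- 1) ^ card S * tensor_power n (\<Sum>i\<in>S. \<phi> i) x) =
        (\<Sum>\<sigma> | \<sigma> permutes ?I. (- 1) ^ n * ?F \<sigma> x)"
      using Ryser_permanent[of "\<lambda>i j. schwartz_apply (\<phi> i) (x j)" n]
      by (simp add: tensor_power_def schwartz_apply_sum sum_distrib_left)
  qed
  also have "L2_inner ?M \<dots> g = (\<Sum>\<sigma> | \<sigma> permutes ?I. (- 1) ^ n * L2_inner ?M (?F \<sigma>) g)"
    by (rule L2_inner_sum_left) (auto intro: FL2 gL2)
  also have "\<dots> = (\<Sum>\<sigma> | \<sigma> permutes ?I. (- 1) ^ n * L2_inner ?M (?F id) g)"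
    using same by (intro sum.cong) auto
  also have "\<dots> = fact n * ((- 1) ^ n * L2_inner ?M (?F id) g)"
    by (simp add: card_permutations[of ?I n])
  finally show ?thesis by (simp add: L2_inner_commute[of _ g])
qed

section \<open>Density of the tensor powers\<close>

text \<open>The positive and the negative part of \<open>g\<close>, taken as densities, define measures that agree
  on the products of open boxes, an intersection-stable generator on which both are finite;
  hence the densities agree almost everywhere.\<close>

lemma L2_boxes_zero_AE:
  fixes g :: "(nat \<Rightarrow> 'a::euclidean_space) \<Rightarrow> real"
  assumes g: "g \<in> L2 (lborel_pow n)"
    and zero: "\<And>l u. L2_inner (lborel_pow n) g (\<lambda>x. \<Prod>i<n. indicator (box (l i) (u i)) (x i)) = 0"
  shows "AE x in lborel_pow n. g x = 0"
proof -
  let ?I = "{..<n}" and ?M = "lborel_pow n :: (nat \<Rightarrow> 'a) measure"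
  let ?B = "\<lambda>l u. \<Pi>\<^sub>E i\<in>?I. box (l i) (u i) :: 'a set"
  define E where "E = {?B l u | l u. True}"
  have EI: "?B l u \<in> E" for l u unfolding E_def by (rule CollectI, rule exI[of _ l], rule exI[of _ u]) simp
  have [measurable]: "g \<in> borel_measurable ?M" using g by (rule L2_measurable)
  have ind: "(\<Prod>i<n. indicator (box (l i) (u i)) (x i)) = (indicator (?B l u) x :: real)"
    if "x \<in> space ?M" for l u x
    using that by (auto simp: space_PiM PiE_iff indicator_def prod_zero_iff)
  have indL2: "(\<lambda>x. \<Prod>i<n. indicator (box (l i) (u i)) (x i)) \<in> L2 ?M" for l u :: "nat \<Rightarrow> 'a"
  proof (rule L2_tensor)
    fix i
    have "integrable lborel (indicat_real (box (l i) (u i)))"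
      using emeasure_lborel_box_finite[of "l i" "u i"] by (intro integrable_real_indicator) auto
    then show "indicator (box (l i) (u i)) \<in> L2 lborel"
      by (simp add: L2_def power2_eq_square flip: indicator_inter_arith)
  qed
  have Bm: "?B l u \<in> sets ?M" for l u by (rule sets_PiM_I_finite) auto
  have int: "integrable ?M (\<lambda>x. g x * indicator (?B l u) x)" for l u
  proof -
    have "integrable ?M (\<lambda>x. g x * indicator (?B l u) x) =
        integrable ?M (\<lambda>x. g x * (\<Prod>i<n. indicator (box (l i) (u i)) (x i)))"
      by (intro Bochner_Integration.integrable_cong refl) (simp only: ind)
    then show ?thesis using L2_mult_integrable[OF g indL2[of l u]] by blast
  qed
  have int0: "(LINT x|?M. g x * indicator (?B l u) x) = 0" for l u
    using zero[of l u] ind unfolding L2_inner_def by (simp cong: Bochner_Integration.integral_cong)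
  let ?p = "\<lambda>x. max 0 (g x)" and ?q = "\<lambda>x. max 0 (- g x)"
  have ints: "integrable ?M (\<lambda>x. ?p x * indicator (?B l u) x)" "integrable ?M (\<lambda>x. ?q x * indicator (?B l u) x)" for l u
    using Bm by (auto intro!: Bochner_Integration.integrable_bound[OF int[of l u]] simp: indicator_def)
  have em: "emeasure (density ?M (\<lambda>x. ennreal (?p x))) (?B l u) = ennreal (LINT x|?M. ?p x * indicator (?B l u) x)"
      "emeasure (density ?M (\<lambda>x. ennreal (?q x))) (?B l u) = ennreal (LINT x|?M. ?q x * indicator (?B l u) x)" for l u
  proof -
    have nn: "(\<integral>\<^sup>+x. ennreal (h x) * indicator (?B l u) x \<partial>?M) = ennreal (LINT x|?M. h x * indicator (?B l u) x)"
      if "integrable ?M (\<lambda>x. h x * indicator (?B l u) x)" "\<And>x. 0 \<le> h x" for h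
      using that by (subst nn_integral_eq_integral[symmetric])
        (auto intro!: nn_integral_cong simp: indicator_def)
    have pq: "(\<lambda>x. ennreal (?p x)) \<in> borel_measurable ?M" "(\<lambda>x. ennreal (?q x)) \<in> borel_measurable ?M"
      by measurable
    show "emeasure (density ?M (\<lambda>x. ennreal (?p x))) (?B l u) = ennreal (LINT x|?M. ?p x * indicator (?B l u) x)"
      "emeasure (density ?M (\<lambda>x. ennreal (?q x))) (?B l u) = ennreal (LINT x|?M. ?q x * indicator (?B l u) x)"
      unfolding emeasure_density[OF pq(1) Bm] emeasure_density[OF pq(2) Bm]
      by (intro nn ints; simp)+
  qed
  have eq: "emeasure (density ?M (\<lambda>x. ennreal (?p x))) (?B l u) =
      emeasure (density ?M (\<lambda>x. ennreal (?q x))) (?B l u)" for l u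
  proof -
    have "(LINT x|?M. ?p x * indicator (?B l u) x) - (LINT x|?M. ?q x * indicator (?B l u) x) =
        (LINT x|?M. g x * indicator (?B l u) x)"
      unfolding Bochner_Integration.integral_diff[OF ints, symmetric]
      by (rule Bochner_Integration.integral_cong) (auto simp: max_def)
    then have "(LINT x|?M. ?p x * indicator (?B l u) x) = (LINT x|?M. ?q x * indicator (?B l u) x)"
      using int0[of l u] by linarith
    then show ?thesis unfolding em by (rule arg_cong)
  qed
  have sets: "sets ?M = sigma_sets (space ?M) E"
  proof -
    let ?bx = "range (\<lambda>(a, b). box a b :: 'a set)"
    have "sets ?M = sets (\<Pi>\<^sub>M i\<in>?I. sigma UNIV ?bx)"
      by (intro sets_PiM_cong) (auto simp: borel_eq_box)
    also have "\<dots> = sets (sigma (\<Pi>\<^sub>E i\<in>?I. UNIV)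
        {{f\<in>(\<Pi>\<^sub>E i\<in>?I. UNIV). \<forall>i\<in>j. f i \<in> A i} | A j. j \<in> {?I} \<and> A \<in> Pi j (\<lambda>_. ?bx)})"
    proof (rule sets_PiM_sigma)
      fix i assume "i \<in> ?I"
      show "\<exists>S\<subseteq>?bx. countable S \<and> UNIV = \<Union>S"
        by (rule exI[of _ "range (\<lambda>k::nat. box (- (real k *\<^sub>R One)) (real k *\<^sub>R One))"])
           (auto simp: UN_box_eq_UNIV)
    qed auto
    also have "{{f\<in>(\<Pi>\<^sub>E i\<in>?I. UNIV). \<forall>i\<in>j. f i \<in> A i} | A j. j \<in> {?I} \<and> A \<in> Pi j (\<lambda>_. ?bx)} = E"
    proof (intro subset_antisym subsetI)
      fix X assume "X \<in> {{f\<in>(\<Pi>\<^sub>E i\<in>?I. UNIV). \<forall>i\<in>j. f i \<in> A i} | A j. j \<in> {?I} \<and> A \<in> Pi j (\<lambda>_. ?bx)}"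
      then obtain A where X: "X = {f\<in>(\<Pi>\<^sub>E i\<in>?I. UNIV). \<forall>i\<in>?I. f i \<in> A i}" and A: "\<forall>i\<in>?I. A i \<in> ?bx"
        by auto
      have "\<forall>i\<in>?I. \<exists>l u. A i = box l u"
      proof
        fix i assume "i \<in> ?I"
        with A have "A i \<in> ?bx" by (rule bspec)
        then show "\<exists>l u. A i = box l u"
        proof (rule rangeE)
          fix p assume "A i = (\<lambda>(a, b). box a b) p"
          then show ?thesis by (cases p) auto
        qed
      qed
      then obtain l u where "\<forall>i\<in>?I. A i = box (l i) (u i)" by metis
      then have "X = ?B l u" unfolding X by (auto simp: PiE_iff extensional_def)
      then show "X \<in> E" by (simp only: EI)
    next
      fix X assume "X \<in> E"
      then obtain l u where X: "X = ?B l u" by (auto simp: E_def)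
      show "X \<in> {{f\<in>(\<Pi>\<^sub>E i\<in>?I. UNIV). \<forall>i\<in>j. f i \<in> A i} | A j. j \<in> {?I} \<and> A \<in> Pi j (\<lambda>_. ?bx)}"
        unfolding X by (intro CollectI exI[of _ "\<lambda>i. box (l i) (u i)"] exI[of _ ?I]) (auto simp: PiE_iff extensional_def)
    qed
    also have "sets (sigma (\<Pi>\<^sub>E i\<in>?I. UNIV) E) = sigma_sets (\<Pi>\<^sub>E i\<in>?I. UNIV) E"
      by (rule sets_measure_of) (auto simp: E_def PiE_iff)
    finally show ?thesis by (simp add: space_PiM)
  qed
  let ?A = "(\<lambda>k. ?B (\<lambda>i. - (real (k i) *\<^sub>R One)) (\<lambda>i. real (k i) *\<^sub>R One)) ` (PiE ?I (\<lambda>_. UNIV :: nat set))"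
  have "density ?M (\<lambda>x. ennreal (?p x)) = density ?M (\<lambda>x. ennreal (?q x))"
  proof (rule measure_eqI_generator_eq_countable[of E "space ?M" _ _ ?A])
    show "Int_stable E"
    proof (rule Int_stableI)
      fix X Y assume "X \<in> E" "Y \<in> E"
      then obtain l u l' u' where "X = ?B l u" "Y = ?B l' u'" by (auto simp: E_def)
      then have "X \<inter> Y = ?B (\<lambda>i. \<Sum>b\<in>Basis. max (l i \<bullet> b) (l' i \<bullet> b) *\<^sub>R b)
          (\<lambda>i. \<Sum>b\<in>Basis. min (u i \<bullet> b) (u' i \<bullet> b) *\<^sub>R b)"
        by (simp add: PiE_Int box_Int_box)
      then show "X \<inter> Y \<in> E" by (simp only: EI)
    qed
    show "E \<subseteq> Pow (space ?M)" by (auto simp: E_def space_PiM PiE_iff)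
    show "emeasure (density ?M (\<lambda>x. ennreal (?p x))) X = emeasure (density ?M (\<lambda>x. ennreal (?q x))) X"
      if "X \<in> E" for X using that eq by (auto simp: E_def)
    show "?A \<subseteq> E" by (intro image_subsetI EI)
    show "\<Union>?A = space ?M"
    proof (intro subset_antisym subsetI)
      fix x assume x: "x \<in> space ?M"
      have "\<forall>i. \<exists>k::nat. x i \<in> box (- (real k *\<^sub>R One)) (real k *\<^sub>R One)"
        using UN_box_eq_UNIV by blast
      then obtain k :: "nat \<Rightarrow> nat" where "\<And>i. x i \<in> box (- (real (k i) *\<^sub>R One)) (real (k i) *\<^sub>R One)"
        by metis
      then show "x \<in> \<Union>?A"
        using x by (intro UnionI[OF imageI[of "restrict k ?I"]]) (auto simp: space_PiM PiE_iff)
    qed (auto simp: space_PiM PiE_iff)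
    show "countable ?A" by (intro countable_image countable_PiE) auto
    show "emeasure (density ?M (\<lambda>x. ennreal (?p x))) a \<noteq> \<infinity>" if "a \<in> ?A" for a
      using that em by auto
  qed (simp_all add: sets)
  moreover have "sigma_finite_measure ?M" by (rule lborel_product.sigma_finite) simp
  ultimately have "AE x in ?M. ennreal (?p x) = ennreal (?q x)"
    by (intro sigma_finite_measure.density_unique) auto
  then show ?thesis by eventually_elim (auto simp: max_def split: if_splits)
qed

text \<open>By dominated convergence, orthogonality to the products of Schwartz functions passes on to the
  indicator functions of products of boxes.\<close>

lemma L2_sym_orthogonal_zero:
  fixes g :: "(nat \<Rightarrow> 'a::euclidean_space) \<Rightarrow> real"
  assumes g: "g \<in> L2_sym n" and orth: "\<And>\<phi>. L2_inner (lborel_pow n) g (tensor_power n \<phi>) = 0"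
  shows "AE x in lborel_pow n. g x = 0"
proof (rule L2_boxes_zero_AE[OF L2_sym_L2[OF g]])
  fix l u :: "nat \<Rightarrow> 'a"
  let ?M = "lborel_pow n :: (nat \<Rightarrow> 'a) measure"
  have gL2: "g \<in> L2 ?M" using g by (rule L2_sym_L2)
  show "L2_inner ?M g (\<lambda>x. \<Prod>i<n. indicator (box (l i) (u i)) (x i)) = 0"
  proof (cases "\<exists>i<n. box (l i) (u i) = {}")
    case True
    then obtain i where "i < n" "box (l i) (u i) = {}" by blast
    then have eq: "(\<Prod>i<n. indicator (box (l i) (u i)) (x i)) = (0::real)" for x :: "nat \<Rightarrow> 'a"
      by (intro prod_zero bexI[of _ i]) auto
    show ?thesis unfolding L2_inner_def eq by simp
  next
    case False
    have "\<forall>i\<in>{..<n}. \<exists>(\<phi> :: nat \<Rightarrow> 'a schwartz) \<psi>. \<psi> \<in> L2 lborel \<and>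
        (\<forall>k x. \<bar>schwartz_apply (\<phi> k) x\<bar> \<le> \<psi> x) \<and>
        (\<forall>x. (\<lambda>k. schwartz_apply (\<phi> k) x) \<longlonglongrightarrow> indicator (box (l i) (u i)) x)"
    proof
      fix i assume "i \<in> {..<n}"
      then have "box (l i) (u i) \<noteq> {}" using False by blast
      then show "\<exists>(\<phi> :: nat \<Rightarrow> 'a schwartz) \<psi>. \<psi> \<in> L2 lborel \<and>
          (\<forall>k x. \<bar>schwartz_apply (\<phi> k) x\<bar> \<le> \<psi> x) \<and>
          (\<forall>x. (\<lambda>k. schwartz_apply (\<phi> k) x) \<longlonglongrightarrow> indicator (box (l i) (u i)) x)"
        by (rule schwartz_approx_box)
    qed
    then obtain \<phi> \<psi> where "\<forall>i\<in>{..<n}. \<psi> i \<in> L2 lborel \<and> (\<forall>k x. \<bar>schwartz_apply (\<phi> i k) x\<bar> \<le> \<psi> i x) \<and>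
        (\<forall>x. (\<lambda>k::nat. schwartz_apply (\<phi> i k) x) \<longlonglongrightarrow> indicator (box (l i) (u i)) x)"
      unfolding bchoice_iff by blast
    then have *: "\<psi> i \<in> L2 lborel \<and> (\<forall>k x. \<bar>schwartz_apply (\<phi> i k) x\<bar> \<le> \<psi> i x) \<and>
        (\<forall>x. (\<lambda>k::nat. schwartz_apply (\<phi> i k) x) \<longlonglongrightarrow> indicator (box (l i) (u i)) x)" if "i < n" for i
      using that by blast
    have [measurable]: "g \<in> borel_measurable ?M" using gL2 by (rule L2_measurable)
    have "(\<lambda>k. LINT x|?M. g x * (\<Prod>i<n. schwartz_apply (\<phi> i k) (x i))) \<longlonglongrightarrow>
        (LINT x|?M. g x * (\<Prod>i<n. indicator (box (l i) (u i)) (x i)))"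
    proof (rule integral_dominated_convergence[where w = "\<lambda>x. \<bar>g x * (\<Prod>i<n. \<psi> i (x i))\<bar>"])
      show "integrable ?M (\<lambda>x. \<bar>g x * (\<Prod>i<n. \<psi> i (x i))\<bar>)"
        by (intro integrable_abs L2_mult_integrable gL2 L2_tensor) (use * in auto)
      show "AE x in ?M. (\<lambda>k. g x * (\<Prod>i<n. schwartz_apply (\<phi> i k) (x i))) \<longlonglongrightarrow>
          g x * (\<Prod>i<n. indicator (box (l i) (u i)) (x i))"
        using * by (intro AE_I2 tendsto_mult tendsto_const tendsto_prod) auto
      show "AE x in ?M. norm (g x * (\<Prod>i<n. schwartz_apply (\<phi> i k) (x i))) \<le> \<bar>g x * (\<Prod>i<n. \<psi> i (x i))\<bar>" for k
      proof (intro AE_I2)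
        fix x :: "nat \<Rightarrow> 'a"
        have "(\<Prod>i<n. \<bar>schwartz_apply (\<phi> i k) (x i)\<bar>) \<le> (\<Prod>i<n. \<bar>\<psi> i (x i)\<bar>)"
          using * by (intro prod_mono) (auto intro: order_trans[OF _ abs_ge_self])
        then show "norm (g x * (\<Prod>i<n. schwartz_apply (\<phi> i k) (x i))) \<le> \<bar>g x * (\<Prod>i<n. \<psi> i (x i))\<bar>"
          by (simp add: abs_mult abs_prod mult_left_mono)
      qed
      show "(\<lambda>x. g x * (\<Prod>i<n. schwartz_apply (\<phi> i k) (x i))) \<in> borel_measurable ?M" for k
        by (intro borel_measurable_times tensor_measurable) auto
      show "(\<lambda>x. g x * (\<Prod>i<n. indicator (box (l i) (u i)) (x i))) \<in> borel_measurable ?M"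
        by (intro borel_measurable_times tensor_measurable) auto
    qed
    moreover have "(LINT x|?M. g x * (\<Prod>i<n. schwartz_apply (\<phi> i k) (x i))) = 0" for k
      using L2_sym_orthogonal_tensors[OF g orth, of "\<lambda>i. \<phi> i k"] by (simp add: L2_inner_def)
    ultimately show ?thesis by (simp add: L2_inner_def LIMSEQ_const_iff)
  qed
qed

text \<open>The new coefficients do not involve \<open>t\<close>.  So one choice of coefficients serves the tensor
  powers and the Wick powers at the same time.\<close>

lemma lincomb_of_sums:
  fixes t :: "'b \<Rightarrow> real"
  assumes "finite A" "finite B"
  shows "a * (\<Sum>\<phi>\<in>A. c \<phi> * t \<phi>) + b * (\<Sum>\<phi>\<in>B. d \<phi> * t \<phi>) =
    (\<Sum>\<phi>\<in>A \<union> B. (a * (if \<phi> \<in> A then c \<phi> else 0) + b * (if \<phi> \<in> B then d \<phi> else 0)) * t \<phi>)"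
proof -
  have "(\<Sum>\<phi>\<in>A. c \<phi> * t \<phi>) = (\<Sum>\<phi>\<in>A \<union> B. (if \<phi> \<in> A then c \<phi> else 0) * t \<phi>)"
    by (rule sum.mono_neutral_cong_left) (use assms in auto)
  moreover have "(\<Sum>\<phi>\<in>B. d \<phi> * t \<phi>) = (\<Sum>\<phi>\<in>A \<union> B. (if \<phi> \<in> B then d \<phi> else 0) * t \<phi>)"
    by (rule sum.mono_neutral_cong_left) (use assms in auto)
  ultimately show ?thesis
    by (simp only: sum_distrib_left flip: sum.distrib) (intro sum.cong refl, simp add: algebra_simps)
qed

text \<open>Let \<open>h\<close> be the projection of \<open>f\<close> onto the closed span of the tensor powers.  As a limit of
  symmetric functions \<open>h\<close> is symmetric, so \<open>f - h\<close> is a symmetric kernel orthogonal to every tensor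
  power and vanishes.\<close>

lemma tensor_powers_dense:
  fixes f :: "(nat \<Rightarrow> 'a::euclidean_space) \<Rightarrow> real"
  assumes f: "f \<in> L2_sym n"
  shows "\<exists>A c. (\<forall>k. finite (A k)) \<and>
    (\<lambda>k. L2_sq (lborel_pow n) (\<lambda>x. (\<Sum>\<phi>\<in>A k. c k \<phi> * tensor_power n \<phi> x) - f x)) \<longlonglongrightarrow> 0"
proof -
  let ?M = "lborel_pow n :: (nat \<Rightarrow> 'a) measure"
  define V where "V = {\<lambda>x. \<Sum>\<phi>\<in>A. c \<phi> * tensor_power n \<phi> x | A (c :: 'a schwartz \<Rightarrow> real). finite A}"
  have fL2: "f \<in> L2 ?M" using f by (rule L2_sym_L2)
  have VL2: "V \<subseteq> L2 ?M" by (auto simp: V_def intro!: L2_sum L2_scale tensor_power_L2)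
  have V0: "(\<lambda>x. 0) \<in> V"
    unfolding V_def by (intro CollectI exI[of _ "{}"] exI[of _ "\<lambda>_. 0"]) auto
  have Vlin: "(\<lambda>x. a * u x + b * v x) \<in> V" if "u \<in> V" "v \<in> V" for u v a b
  proof -
    from that obtain A c B d where "finite A" "finite B"
      "u = (\<lambda>x. \<Sum>\<phi>\<in>A. c \<phi> * tensor_power n \<phi> x)" "v = (\<lambda>x. \<Sum>\<phi>\<in>B. d \<phi> * tensor_power n \<phi> x)"
      by (auto simp: V_def)
    then show ?thesis
      unfolding V_def by (intro CollectI exI[of _ "A \<union> B"] exI conjI) (auto simp: lincomb_of_sums)
  qed
  obtain v h where v: "\<And>k. v k \<in> V" and h: "h \<in> L2 ?M"
    and lim: "(\<lambda>k. L2_sq ?M (\<lambda>x. v k x - h x)) \<longlonglongrightarrow> 0"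
    and orth: "\<And>w. w \<in> V \<Longrightarrow> L2_inner ?M (\<lambda>x. f x - h x) w = 0"
    using L2_projection[OF VL2 V0 Vlin fL2] by blast
  have vL2: "v k \<in> L2 ?M" for k using v VL2 by auto
  have "AE x in ?M. h (x \<circ> \<sigma>) = h x" if \<sigma>: "\<sigma> permutes {..<n}" for \<sigma>
  proof (rule L2_limit_unique[OF vL2 L2_permute_coordinates(1)[OF \<sigma> h] h _ lim])
    have "v k (x \<circ> \<sigma>) = v k x" for k x
    proof -
      obtain A c where "v k = (\<lambda>x. \<Sum>\<phi>\<in>A. c \<phi> * tensor_power n \<phi> x)" using v[of k] by (auto simp: V_def)
      moreover have "tensor_power n \<phi> (x \<circ> \<sigma>) = tensor_power n \<phi> x" for \<phi> :: "'a schwartz"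
        unfolding tensor_power_def
        using prod.permute[OF \<sigma>, of "\<lambda>i. schwartz_apply \<phi> (x i)"] by (simp add: comp_def)
      ultimately show ?thesis by simp
    qed
    then have "L2_sq ?M (\<lambda>x. v k x - h (x \<circ> \<sigma>)) = L2_sq ?M (\<lambda>x. v k x - h x)" for k
      using L2_permute_coordinates(2)[OF \<sigma> L2_diff[OF vL2[of k] h]] by simp
    then show "(\<lambda>k. L2_sq ?M (\<lambda>x. v k x - h (x \<circ> \<sigma>))) \<longlonglongrightarrow> 0" using lim by simp
  qed
  then have hs: "h \<in> L2_sym n" using h by (simp add: L2_sym_def)
  have "AE x in ?M. f x - h x = 0"
  proof (rule L2_sym_orthogonal_zero)
    show "(\<lambda>x. f x - h x) \<in> L2_sym n" using L2_sym_linear[OF f hs, of 1 "-1"] by simp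
    fix \<phi> :: "'a schwartz"
    have "tensor_power n \<phi> \<in> V"
      unfolding V_def by (intro CollectI exI[of _ "{\<phi>}"] exI[of _ "\<lambda>_. 1"]) auto
    then show "L2_inner ?M (\<lambda>x. f x - h x) (tensor_power n \<phi>) = 0" by (rule orth)
  qed
  then have "L2_sq ?M (\<lambda>x. v k x - f x) = L2_sq ?M (\<lambda>x. v k x - h x)" for k
    using vL2[of k] fL2 h by (intro L2_sq_cong_AE L2_measurable L2_diff) auto
  then have lim': "(\<lambda>k. L2_sq ?M (\<lambda>x. v k x - f x)) \<longlonglongrightarrow> 0" using lim by simp
  have "\<forall>k. \<exists>A c. finite A \<and> v k = (\<lambda>x. \<Sum>\<phi>\<in>A. c \<phi> * tensor_power n \<phi> x)"
  proof
    fix k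
    show "\<exists>A c. finite A \<and> v k = (\<lambda>x. \<Sum>\<phi>\<in>A. c \<phi> * tensor_power n \<phi> x)"
      using v[of k] unfolding V_def by blast
  qed
  from choice[OF this] obtain A where
    "\<forall>k. \<exists>c. finite (A k) \<and> v k = (\<lambda>x. \<Sum>\<phi>\<in>A k. c \<phi> * tensor_power n \<phi> x)" by blast
  from choice[OF this] obtain c where
    "\<And>k. finite (A k) \<and> v k = (\<lambda>x. \<Sum>\<phi>\<in>A k. c k \<phi> * tensor_power n \<phi> x)" by blast
  then show ?thesis using lim' by (intro exI[of _ A] exI[of _ c]) simp
qed

section \<open>Moments of Gaussian variables\<close>

definition normal_moment :: "nat \<Rightarrow> real" where
  "normal_moment k = (LINT x|std_normal_distribution. x ^ k)"

lemma normal_moment_odd: "odd k \<Longrightarrow> normal_moment k = 0"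
  by (simp add: normal_moment_def integral_std_normal_distribution_moment_odd)

lemma normal_moment_Suc_Suc: "normal_moment (Suc (Suc k)) = real (Suc k) * normal_moment k"
proof (cases "even k")
  case True
  then obtain l where k: "k = 2 * l" by blast
  have "normal_moment (2 * Suc l) = fact (2 * Suc l) / (2 ^ Suc l * fact (Suc l))"
    unfolding normal_moment_def by (rule std_normal_distribution_even_moments(1))
  also have "\<dots> = real (2 * l + 1) * (fact (2 * l) / (2 ^ l * fact l))"
    by (simp add: field_simps del: of_nat_Suc) (simp add: algebra_simps)
  also have "\<dots> = real (2 * l + 1) * normal_moment (2 * l)"
    unfolding normal_moment_def by (simp only: std_normal_distribution_even_moments(1))
  finally show ?thesis by (simp add: k)
qed (simp add: normal_moment_odd)

text \<open>Induction for statements that are additive in the polynomial, where the recursion along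
  \<open>pCons\<close> would not fit.\<close>

lemma poly_sum_of_monoms_induct [case_names zero monom add]:
  fixes p :: "'b::comm_semiring_1 poly"
  assumes "Q 0" "\<And>c i. Q (monom c i)" "\<And>p q. Q p \<Longrightarrow> Q q \<Longrightarrow> Q (p + q)"
  shows "Q p"
proof -
  have "Q (\<Sum>i\<in>A. monom (coeff p i) i)" for A
    by (induction A rule: infinite_finite_induct) (auto intro: assms)
  then show ?thesis by (metis poly_as_sum_of_monoms)
qed

locale white_noise_space =
  fixes \<mu> :: "('a::euclidean_space schwartz \<Rightarrow> real) measure"
  assumes white_noise: "white_noise \<mu>"
begin

sublocale prob_space \<mu>
  using white_noise by (simp add: white_noise_def)

lemma space_eq: "space \<mu> = tempered_distributions"
proof -
  have "space \<mu> = space (restrict_space borel tempered_distributions)"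
    using white_noise by (intro sets_eq_imp_space_eq) (simp add: white_noise_def)
  then show ?thesis by (simp add: space_restrict_space)
qed

lemma eval_measurable [simp]: "(\<lambda>\<omega>. \<omega> \<phi>) \<in> borel_measurable \<mu>"
proof -
  have "(\<lambda>\<omega> :: 'a schwartz \<Rightarrow> real. \<omega> \<phi>) \<in> borel_measurable borel"
    by (intro borel_measurable_continuous_onI continuous_on_product_coordinates)
  then have "(\<lambda>\<omega> :: 'a schwartz \<Rightarrow> real. \<omega> \<phi>) \<in> borel_measurable (restrict_space borel tempered_distributions)"
    by (rule measurable_restrict_space1)
  then show ?thesis
    using white_noise measurable_cong_sets[of \<mu> "restrict_space borel tempered_distributions" borel borel]
    by (auto simp: white_noise_def)
qed

lemma eval_linear:
  assumes "\<omega> \<in> space \<mu>"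
  shows "\<omega> (a *\<^sub>R \<phi> + b *\<^sub>R \<psi>) = a * \<omega> \<phi> + b * \<omega> \<psi>"
proof -
  have "linear \<omega>" using assms by (simp add: space_eq tempered_distributions_def)
  then show ?thesis by (simp add: linear_add linear_scale)
qed

text \<open>Both laws have the characteristic function \<open>t \<mapsto> exp (- t\<^sup>2 |\<phi>|\<^sup>2 / 2)\<close>.  Writing the
  Gaussian law as a scaled standard normal law covers \<open>|\<phi>| = 0\<close> as well.\<close>

lemma distr_eval:
  "distr \<mu> borel (\<lambda>\<omega>. \<omega> \<phi>) = distr std_normal_distribution borel (\<lambda>x. sqrt (schwartz_sq \<phi>) * x)"
proof (rule Levy_uniqueness)
  let ?v = "schwartz_sq \<phi>"
  interpret N: real_distribution std_normal_distribution by (rule real_dist_normal_dist)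
  show "real_distribution (distr \<mu> borel (\<lambda>\<omega>. \<omega> \<phi>))"
    by (rule real_distribution_distr, rule eval_measurable)
  show "real_distribution (distr std_normal_distribution borel (\<lambda>x. sqrt ?v * x))"
    by (rule N.real_distribution_distr) measurable
  show "char (distr \<mu> borel (\<lambda>\<omega>. \<omega> \<phi>)) = char (distr std_normal_distribution borel (\<lambda>x. sqrt ?v * x))"
  proof
    fix t :: real
    have scale: "\<omega> (t *\<^sub>R \<phi> + 0 *\<^sub>R 0) = t * \<omega> \<phi>" if "\<omega> \<in> space \<mu>" for \<omega>
      using eval_linear[OF that, of t \<phi> 0 0] by simp
    have "char (distr \<mu> borel (\<lambda>\<omega>. \<omega> \<phi>)) t = (LINT \<omega>|\<mu>. iexp (t * \<omega> \<phi>))"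
      unfolding char_def by (subst integral_distr) auto
    also have "\<dots> = (LINT \<omega>|\<mu>. iexp (\<omega> (t *\<^sub>R \<phi> + 0 *\<^sub>R 0)))"
      by (intro Bochner_Integration.integral_cong refl) (simp only: scale)
    also have "\<dots> = complex_of_real (exp (- schwartz_sq (t *\<^sub>R \<phi> + 0 *\<^sub>R 0) / 2))"
      using white_noise unfolding white_noise_def by blast
    also have "schwartz_sq (t *\<^sub>R \<phi> + 0 *\<^sub>R 0) = t\<^sup>2 * ?v"
      by (subst schwartz_sq_lincomb) simp
    also have "- (t\<^sup>2 * ?v) / 2 = - ((t * sqrt ?v)\<^sup>2) / 2"
      by (simp add: power_mult_distrib L2_sq_nonneg)
    also have "complex_of_real (exp (- ((t * sqrt ?v)\<^sup>2) / 2)) = char std_normal_distribution (t * sqrt ?v)"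
      by (simp add: char_std_normal_distribution)
    also have "\<dots> = char (distr std_normal_distribution borel (\<lambda>x. sqrt ?v * x)) t"
      unfolding char_def by (subst integral_distr) (auto simp: mult.assoc)
    finally show "char (distr \<mu> borel (\<lambda>\<omega>. \<omega> \<phi>)) t = char (distr std_normal_distribution borel (\<lambda>x. sqrt ?v * x)) t" .
  qed
qed

lemma eval_power_integrable: "integrable \<mu> (\<lambda>\<omega>. \<omega> \<phi> ^ k)"
proof -
  have "integrable (distr std_normal_distribution borel (\<lambda>x. sqrt (schwartz_sq \<phi>) * x)) (\<lambda>x. x ^ k)"
    by (subst integrable_distr_eq)
       (auto simp: power_mult_distrib intro!: integrable_mult_right integrable_std_normal_distribution_moment)
  then have "integrable (distr \<mu> borel (\<lambda>\<omega>. \<omega> \<phi>)) (\<lambda>x. x ^ k)" by (simp add: distr_eval)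
  then show ?thesis by (subst (asm) integrable_distr_eq) auto
qed

lemma expectation_eval_power: "(LINT \<omega>|\<mu>. \<omega> \<phi> ^ k) = sqrt (schwartz_sq \<phi>) ^ k * normal_moment k"
proof -
  have "(LINT \<omega>|\<mu>. \<omega> \<phi> ^ k) = (LINT x|distr \<mu> borel (\<lambda>\<omega>. \<omega> \<phi>). x ^ k)"
    by (subst integral_distr) auto
  also have "\<dots> = (LINT x|std_normal_distribution. (sqrt (schwartz_sq \<phi>) * x) ^ k)"
    unfolding distr_eval by (subst integral_distr) auto
  finally show ?thesis by (simp add: power_mult_distrib normal_moment_def)
qed

lemma eval_power_L2: "(\<lambda>\<omega>. \<omega> \<phi> ^ k) \<in> L2 \<mu>"
  using eval_power_integrable[of \<phi> "2 * k"] borel_measurable_power[OF eval_measurable, of \<phi> k] by (simp add: L2_def power_mult[symmetric] mult.commute)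

lemma poly_eval_L2: "(\<lambda>\<omega>. poly p (\<omega> \<phi>)) \<in> L2 \<mu>"
  unfolding poly_altdef by (intro L2_sum L2_scale(1) eval_power_L2)

definition mixed_moment :: "'a schwartz \<Rightarrow> 'a schwartz \<Rightarrow> nat \<Rightarrow> nat \<Rightarrow> real" where
  "mixed_moment \<phi> \<psi> a b = (LINT \<omega>|\<mu>. \<omega> \<phi> ^ a * \<omega> \<psi> ^ b)"

text \<open>The joint moments are obtained from one-dimensional laws: the moment of order \<open>k\<close> of \<open>s X + Y\<close>
  depends only on its variance \<open>|s \<phi> + \<psi>|\<^sup>2\<close>, a quadratic polynomial in \<open>s\<close>, while its binomial expansion has the
  mixed moments, times binomial coefficients, as coefficients.\<close>

lemma mixed_moment_poly:
  "(\<Sum>a\<le>k. monom (real (k choose a) * mixed_moment \<phi> \<psi> a (k - a)) a) =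
    (if even k then Polynomial.smult (normal_moment k)
       ([:schwartz_sq \<psi>, 2 * schwartz_inner \<phi> \<psi>, schwartz_sq \<phi>:] ^ (k div 2)) else 0)"
  (is "?P = ?R")
proof -
  let ?q = "[:schwartz_sq \<psi>, 2 * schwartz_inner \<phi> \<psi>, schwartz_sq \<phi>:]"
  have "poly ?P s = poly ?R s" for s
  proof -
    have "poly ?P s = (\<Sum>a\<le>k. real (k choose a) * mixed_moment \<phi> \<psi> a (k - a) * s ^ a)"
      by (simp add: poly_sum poly_monom)
    also have "\<dots> = (LINT \<omega>|\<mu>. (\<Sum>a\<le>k. real (k choose a) * s ^ a * (\<omega> \<phi> ^ a * \<omega> \<psi> ^ (k - a))))"
      by (subst Bochner_Integration.integral_sum)
         (auto simp: mixed_moment_def mult_ac intro!: sum.cong L2_mult_integrable eval_power_L2)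
    also have "\<dots> = (LINT \<omega>|\<mu>. \<omega> (s *\<^sub>R \<phi> + 1 *\<^sub>R \<psi>) ^ k)"
    proof (intro Bochner_Integration.integral_cong refl)
      fix \<omega> assume "\<omega> \<in> space \<mu>"
      then have "\<omega> (s *\<^sub>R \<phi> + 1 *\<^sub>R \<psi>) ^ k = (s * \<omega> \<phi> + \<omega> \<psi>) ^ k" by (simp only: eval_linear mult_1)
      also have "\<dots> = (\<Sum>a\<le>k. real (k choose a) * s ^ a * (\<omega> \<phi> ^ a * \<omega> \<psi> ^ (k - a)))"
        by (simp add: binomial_ring power_mult_distrib mult_ac)
      finally show "(\<Sum>a\<le>k. real (k choose a) * s ^ a * (\<omega> \<phi> ^ a * \<omega> \<psi> ^ (k - a))) =
          \<omega> (s *\<^sub>R \<phi> + 1 *\<^sub>R \<psi>) ^ k" by simp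
    qed
    also have "\<dots> = sqrt (schwartz_sq (s *\<^sub>R \<phi> + 1 *\<^sub>R \<psi>)) ^ k * normal_moment k"
      by (rule expectation_eval_power)
    also have "schwartz_sq (s *\<^sub>R \<phi> + 1 *\<^sub>R \<psi>) = poly ?q s"
      by (subst schwartz_sq_lincomb) (simp add: power2_eq_square algebra_simps)
    also have "sqrt (poly ?q s) ^ k * normal_moment k = poly ?R s"
    proof (cases "even k")
      case True
      have "0 \<le> poly ?q s"
        using L2_sq_nonneg[of lborel "schwartz_apply (s *\<^sub>R \<phi> + 1 *\<^sub>R \<psi>)"]
        unfolding schwartz_sq_lincomb by (simp add: power2_eq_square algebra_simps)
      then have "sqrt (poly ?q s) ^ (2 * (k div 2)) = poly ?q s ^ (k div 2)"
        unfolding power_mult by (simp only: real_sqrt_pow2)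
      then show ?thesis using True by (simp add: poly_power)
    qed (simp add: normal_moment_odd)
    finally show ?thesis .
  qed
  then show ?thesis by (intro poly_eq_poly_eq_iff[THEN iffD1] ext)
qed

text \<open>Differentiate the polynomial identity for the moments with respect to \<open>s\<close>.  Since the moment of
  order \<open>k + 2\<close> of a standard normal variable is \<open>k + 1\<close> times that of order \<open>k\<close>, the derivative of
  the polynomial of order \<open>k + 2\<close> is the one of order \<open>k\<close> times a linear factor; now compare coefficients.\<close>

lemma mixed_moment_Suc:
  "mixed_moment \<phi> \<psi> (Suc a) b = real a * schwartz_sq \<phi> * mixed_moment \<phi> \<psi> (a - 1) b +
     real b * schwartz_inner \<phi> \<psi> * mixed_moment \<phi> \<psi> a (b - 1)"
proof (cases "a + b = 0")
  case True
  then show ?thesis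
    using expectation_eval_power[of \<phi> 1] by (simp add: mixed_moment_def normal_moment_odd)
next
  case False
  then obtain k where k: "a + b = Suc k" by (cases "a + b") auto
  let ?v = "schwartz_sq \<phi>" and ?c = "schwartz_inner \<phi> \<psi>"
  let ?q = "[:schwartz_sq \<psi>, 2 * ?c, ?v:]"
  let ?M = "mixed_moment \<phi> \<psi>"
  define P where "P k = (\<Sum>a\<le>k. monom (real (k choose a) * ?M a (k - a)) a)" for k
  have P: "P k = (if even k then Polynomial.smult (normal_moment k) (?q ^ (k div 2)) else 0)" for k
    unfolding P_def by (rule mixed_moment_poly)
  have cP: "coeff (P k) i = (if i \<le> k then real (k choose i) * ?M i (k - i) else 0)" for k i
  proof -
    have "coeff (P k) i = (\<Sum>j\<le>k. if j = i then real (k choose j) * ?M j (k - j) else 0)"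
      unfolding P_def by (simp only: coeff_sum coeff_monom)
    then show ?thesis by simp
  qed
  (* with q the variance polynomial and k even, P (k+2) = m_(k+2) q^(k/2+1), whose derivative has the factor q' = 2 (c + v s) *)
  have dP: "pderiv (P (Suc (Suc k))) = Polynomial.smult (real (Suc (Suc k)) * real (Suc k)) (P k * [:?c, ?v:])"
  proof (cases "even k")
    case True
    have "pderiv (?q ^ Suc (k div 2)) = Polynomial.smult (real (Suc (k div 2))) (?q ^ (k div 2)) * pderiv ?q"
      by (rule pderiv_power_Suc)
    moreover have "pderiv ?q = Polynomial.smult 2 [:?c, ?v:]" by (simp add: pderiv_pCons)
    ultimately have "pderiv (?q ^ Suc (k div 2)) = Polynomial.smult (real (Suc (k div 2)) * 2) (?q ^ (k div 2) * [:?c, ?v:])"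
      by (simp only: mult_smult_left mult_smult_right smult_smult mult.commute)
    moreover have "real (Suc (k div 2)) * 2 = real (Suc (Suc k))" using True by auto
    ultimately have "pderiv (?q ^ Suc (k div 2)) = Polynomial.smult (real (Suc (Suc k))) (?q ^ (k div 2) * [:?c, ?v:])"
      by simp
    then show ?thesis
      using True unfolding P
      by (simp only: even_Suc if_True pderiv_smult normal_moment_Suc_Suc div2_Suc_Suc simp_thms
          mult_smult_left smult_smult) (simp only: mult_ac)
  next
    case False
    then show ?thesis unfolding P by simp
  qed
  have a: "a \<le> Suc k" and b: "b = Suc k - a" using k by auto
  have "coeff (pderiv (P (Suc (Suc k)))) a = real (Suc a) * (real (Suc (Suc k) choose Suc a) * ?M (Suc a) b)"
    using a b by (simp add: coeff_pderiv cP)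
  also have "\<dots> = real (Suc a * (Suc (Suc k) choose Suc a)) * ?M (Suc a) b"
    by (simp only: of_nat_mult mult.assoc)
  also have "Suc a * (Suc (Suc k) choose Suc a) = Suc (Suc k) * (Suc k choose a)"
    by (rule Suc_times_binomial)
  finally have lhs: "coeff (pderiv (P (Suc (Suc k)))) a =
      real (Suc (Suc k)) * (real (Suc k choose a) * ?M (Suc a) b)" by (simp only: of_nat_mult mult.assoc)
  have regroup: "x * (y * m) = c * (z * m)" if "z * c = x * y" for x y z c m :: real
  proof -
    have "(z * c) * m = (x * y) * m" using that by simp
    then show ?thesis by (simp only: mult_ac)
  qed
  have "coeff (P k * [:?c, ?v:]) a = ?c * coeff (P k) a + ?v * (if a = 0 then 0 else coeff (P k) (a - 1))"
    by (cases a) (simp_all add: mult.commute[of "P k"])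
  then have "real (Suc k) * coeff (P k * [:?c, ?v:]) a =
      ?c * (real (Suc k) * coeff (P k) a) + ?v * (real (Suc k) * (if a = 0 then 0 else coeff (P k) (a - 1)))"
    by (simp add: algebra_simps)
  also have "real (Suc k) * coeff (P k) a = real (Suc k choose a) * (real b * ?M a (b - 1))"
  proof (cases "a \<le> k")
    case True
    have "(Suc k - a) * (Suc k choose a) = Suc k * (k choose a)"
      using binomial_absorb_comp[of "Suc k" a] by simp
    from arg_cong[OF this, of real] have e: "real b * real (Suc k choose a) = real (Suc k) * real (k choose a)"
      unfolding b by (simp only: of_nat_mult)
    have "b - 1 = k - a" using b by simp
    then show ?thesis by (simp only: cP True if_True) (rule regroup[OF e])
  next
    case False
    then have "b = 0" using a b by simp
    then show ?thesis using False by (simp add: cP)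
  qed
  also have "real (Suc k) * (if a = 0 then 0 else coeff (P k) (a - 1)) =
      real (Suc k choose a) * (real a * ?M (a - 1) b)"
  proof (cases a)
    case (Suc a')
    have "Suc a' * (Suc k choose Suc a') = Suc k * (k choose a')" by (rule Suc_times_binomial)
    from arg_cong[OF this, of real] have e: "real a * real (Suc k choose a) = real (Suc k) * real (k choose a')"
      unfolding Suc by (simp only: of_nat_mult)
    have "b = k - a'" "a' \<le> k" "a \<noteq> 0" "a - 1 = a'" using a b Suc by auto
    then show ?thesis by (simp only: cP if_True if_False) (rule regroup[OF e])
  qed simp
  finally have rhs: "real (Suc k) * coeff (P k * [:?c, ?v:]) a =
      real (Suc k choose a) * (real a * ?v * ?M (a - 1) b + real b * ?c * ?M a (b - 1))"
    by (simp add: algebra_simps)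
  have "real (Suc (Suc k)) * (real (Suc k choose a) * ?M (Suc a) b) =
      real (Suc (Suc k)) * (real (Suc k choose a) * (real a * ?v * ?M (a - 1) b + real b * ?c * ?M a (b - 1)))"
    using lhs rhs unfolding dP coeff_smult by (simp only: mult.assoc)
  moreover have "real (Suc k choose a) \<noteq> 0" using a by (simp add: binomial_eq_0_iff)
  ultimately show ?thesis by (simp only: mult_cancel_left) simp
qed

text \<open>Both sides are bilinear in \<open>p\<close> and \<open>r\<close>, so the recursion for the mixed moments, which is the
  case of monomials, suffices.\<close>

lemma Gaussian_integration_by_parts:
  "(LINT \<omega>|\<mu>. \<omega> \<phi> * poly p (\<omega> \<phi>) * poly r (\<omega> \<psi>)) =
    schwartz_sq \<phi> * (LINT \<omega>|\<mu>. poly (pderiv p) (\<omega> \<phi>) * poly r (\<omega> \<psi>)) +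
    schwartz_inner \<phi> \<psi> * (LINT \<omega>|\<mu>. poly p (\<omega> \<phi>) * poly (pderiv r) (\<omega> \<psi>))"
proof -
  have i: "integrable \<mu> (\<lambda>\<omega>. poly p (\<omega> \<phi>) * poly r (\<omega> \<psi>))" for p r
    by (intro L2_mult_integrable poly_eval_L2)
  have i': "integrable \<mu> (\<lambda>\<omega>. \<omega> \<phi> * poly p (\<omega> \<phi>) * poly r (\<omega> \<psi>))" for p r
    using i[of "pCons 0 p" r] by simp
  show ?thesis
  proof (induction p rule: poly_sum_of_monoms_induct)
    case zero
    show ?case by simp
  next
    case (add p q)
    then show ?case
      using i i' by (simp add: pderiv_add distrib_left distrib_right)
  next
    case (monom c a)
    show ?case
    proof (induction r rule: poly_sum_of_monoms_induct)
      case zero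
      show ?case by simp
    next
      case (add p q)
      then show ?case
        using i i' by (simp add: pderiv_add distrib_left distrib_right)
    next
      case (monom d b)
      have "(LINT \<omega>|\<mu>. \<omega> \<phi> * poly (monom c a) (\<omega> \<phi>) * poly (monom d b) (\<omega> \<psi>)) =
          c * d * mixed_moment \<phi> \<psi> (Suc a) b"
        by (simp add: poly_monom mixed_moment_def mult_ac flip: integral_mult_right_zero)
      also have "\<dots> = schwartz_sq \<phi> * (real a * c * d * mixed_moment \<phi> \<psi> (a - 1) b) +
          schwartz_inner \<phi> \<psi> * (c * (real b * d) * mixed_moment \<phi> \<psi> a (b - 1))"
        by (simp add: mixed_moment_Suc algebra_simps)
      also have "real a * c * d * mixed_moment \<phi> \<psi> (a - 1) b =
          (LINT \<omega>|\<mu>. poly (pderiv (monom c a)) (\<omega> \<phi>) * poly (monom d b) (\<omega> \<psi>))"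
        by (simp add: pderiv_monom poly_monom mixed_moment_def mult_ac flip: integral_mult_right_zero)
      also have "c * (real b * d) * mixed_moment \<phi> \<psi> a (b - 1) =
          (LINT \<omega>|\<mu>. poly (monom c a) (\<omega> \<phi>) * poly (pderiv (monom d b)) (\<omega> \<psi>))"
        by (simp add: pderiv_monom poly_monom mixed_moment_def mult_ac flip: integral_mult_right_zero)
      finally show ?case .
    qed
  qed
qed

end

section \<open>Hermite polynomials and Wick powers\<close>

fun hermite_poly :: "real \<Rightarrow> nat \<Rightarrow> real poly" where
  "hermite_poly v 0 = 1"
| "hermite_poly v (Suc 0) = [:0, 1:]"
| "hermite_poly v (Suc (Suc n)) = pCons 0 (hermite_poly v (Suc n)) - Polynomial.smult (real (Suc n) * v) (hermite_poly v n)"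

lemma poly_hermite_poly: "poly (hermite_poly v n) x = hermite v n x"
  by (induction v n rule: hermite_poly.induct) auto

lemma pderiv_hermite_poly: "pderiv (hermite_poly v (Suc n)) = Polynomial.smult (real (Suc n)) (hermite_poly v n)"
proof (induction n rule: less_induct)
  case (less n)
  show ?case
  proof (cases n)
    case 0
    then show ?thesis by (simp add: pderiv_pCons)
  next
    case (Suc m)
    have IH: "pderiv (hermite_poly v n) = Polynomial.smult (real n) (hermite_poly v m)"
      using less.IH[of m] Suc by simp
    have "pderiv (hermite_poly v (Suc n)) = hermite_poly v n + (pCons 0 (pderiv (hermite_poly v n))
        - Polynomial.smult (real n * v) (pderiv (hermite_poly v m)))"
      by (simp add: Suc pderiv_diff pderiv_smult pderiv_pCons)
    also have "pCons 0 (pderiv (hermite_poly v n)) - Polynomial.smult (real n * v) (pderiv (hermite_poly v m))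
        = Polynomial.smult (real n) (hermite_poly v n)"
    proof (cases m)
      case 0
      then show ?thesis by (simp add: IH Suc pderiv_pCons)
    next
      case (Suc l)
      have "pderiv (hermite_poly v m) = Polynomial.smult (real m) (hermite_poly v l)"
        using less.IH[of l] Suc \<open>n = Suc m\<close> by simp
      then show ?thesis
        by (simp only: IH) (simp add: \<open>n = Suc m\<close> Suc smult_diff_right mult_ac)
    qed
    finally show ?thesis by (simp add: smult_add_left del: hermite_poly.simps)
  qed
qed

context white_noise_space
begin

lemma wick_power_eq_poly: "wick_power n \<phi> \<omega> = poly (hermite_poly (schwartz_sq \<phi>) n) (\<omega> \<phi>)"
  by (simp add: wick_power_def poly_hermite_poly)

lemma wick_power_L2: "wick_power n \<phi> \<in> L2 \<mu>"
  using poly_eval_L2[of "hermite_poly (schwartz_sq \<phi>) n" \<phi>] by (simp add: wick_power_eq_poly[abs_def])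

text \<open>Integrate \<open>X H\<^sub>n(X) G\<^sub>m(Y)\<close> by parts.  The derivative \<open>H\<^sub>n' = n H\<^sub>n\<^sub>-\<^sub>1\<close> contributes exactly the term
  that the Hermite recursion subtracts, and only \<open>G\<^sub>m' = m G\<^sub>m\<^sub>-\<^sub>1\<close> is left.\<close>

lemma L2_inner_wick_power_Suc:
  "L2_inner \<mu> (wick_power (Suc n) \<phi>) (wick_power m \<psi>) =
    real m * schwartz_inner \<phi> \<psi> * L2_inner \<mu> (wick_power n \<phi>) (wick_power (m - 1) \<psi>)"
proof -
  let ?H = "hermite_poly (schwartz_sq \<phi>)" and ?G = "hermite_poly (schwartz_sq \<psi>)"
  let ?E = "\<lambda>p r. LINT \<omega>|\<mu>. poly p (\<omega> \<phi>) * poly r (\<omega> \<psi>)"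
  have i: "integrable \<mu> (\<lambda>\<omega>. poly p (\<omega> \<phi>) * poly r (\<omega> \<psi>))" for p r
    by (intro L2_mult_integrable poly_eval_L2)
  have E: "L2_inner \<mu> (wick_power k \<phi>) (wick_power l \<psi>) = ?E (?H k) (?G l)" for k l
    by (simp add: L2_inner_def wick_power_eq_poly)
  have G: "?E p (pderiv (?G m)) = real m * ?E p (?G (m - 1))" for p
    by (cases m) (simp_all add: pderiv_hermite_poly mult.left_commute del: hermite_poly.simps(3) of_nat_Suc)
  have X: "?E (pCons 0 p) r = schwartz_sq \<phi> * ?E (pderiv p) r + schwartz_inner \<phi> \<psi> * ?E p (pderiv r)" for p r
    using Gaussian_integration_by_parts[of \<phi> p r \<psi>] by simp
  have "?E (?H (Suc n)) (?G m) = schwartz_inner \<phi> \<psi> * ?E (?H n) (pderiv (?G m))"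
  proof (cases n)
    case 0
    have "?H (Suc 0) = pCons 0 1" by (simp add: one_pCons)
    then show ?thesis using X[of 1 "?G m"] 0 by (simp only: hermite_poly.simps(1)) simp
  next
    case (Suc k)
    have "?E (?H (Suc n)) (?G m) = ?E (pCons 0 (?H n)) (?G m) - real n * schwartz_sq \<phi> * ?E (?H k) (?G m)"
      using i[of "pCons 0 (?H n)" "?G m"] i[of "?H k" "?G m"]
      by (simp add: Suc left_diff_distrib mult.assoc del: poly_pCons of_nat_Suc)
    also have "?E (pCons 0 (?H n)) (?G m) =
        schwartz_sq \<phi> * ?E (pderiv (?H n)) (?G m) + schwartz_inner \<phi> \<psi> * ?E (?H n) (pderiv (?G m))"
      by (rule X)
    also have "?E (pderiv (?H n)) (?G m) = real n * ?E (?H k) (?G m)"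
      by (simp only: Suc pderiv_hermite_poly poly_smult mult.assoc integral_mult_right_zero)
    finally show ?thesis by simp
  qed
  then show ?thesis unfolding E G by (simp only: mult_ac)
qed

text \<open>Each step lowers both degrees by one and yields a factor \<open>m (\<phi>, \<psi>)\<close>; when one degree reaches
  \<open>0\<close> before the other, the inner product is \<open>0\<close>.\<close>

lemma L2_inner_wick_power:
  "L2_inner \<mu> (wick_power n \<phi>) (wick_power m \<psi>) = (if n = m then fact n * schwartz_inner \<phi> \<psi> ^ n else 0)"
proof (induction n arbitrary: m)
  case 0
  show ?case
  proof (cases m)
    case 0
    then show ?thesis by (simp add: L2_inner_def wick_power_def prob_space)
  next
    case (Suc k)
    have "L2_inner \<mu> (wick_power 0 \<phi>) (wick_power m \<psi>) = L2_inner \<mu> (wick_power (Suc k) \<psi>) (wick_power 0 \<phi>)"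
      unfolding Suc by (rule L2_inner_commute)
    also have "\<dots> = 0" unfolding L2_inner_wick_power_Suc by simp
    finally show ?thesis using Suc by simp
  qed
next
  case (Suc n)
  show ?case unfolding L2_inner_wick_power_Suc Suc.IH by (cases m) auto
qed

end

section \<open>Multiple Wiener integrals\<close>

definition tensor_sum :: "nat \<Rightarrow> 'a::euclidean_space schwartz set \<Rightarrow> ('a schwartz \<Rightarrow> real) \<Rightarrow> (nat \<Rightarrow> 'a) \<Rightarrow> real" where
  "tensor_sum n A c x = (\<Sum>\<phi>\<in>A. c \<phi> * tensor_power n \<phi> x)"

definition wick_sum :: "nat \<Rightarrow> 'a::euclidean_space schwartz set \<Rightarrow> ('a schwartz \<Rightarrow> real) \<Rightarrow> ('a schwartz \<Rightarrow> real) \<Rightarrow> real" where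
  "wick_sum n A c \<omega> = (\<Sum>\<phi>\<in>A. c \<phi> * wick_power n \<phi> \<omega>)"

lemma tensor_sum_L2: "tensor_sum n A c \<in> L2 (lborel_pow n)"
  unfolding tensor_sum_def[abs_def] by (intro L2_sum L2_scale tensor_power_L2)

lemma nonneg_squeeze_zero:
  fixes u v :: "nat \<Rightarrow> real"
  assumes "v \<longlonglongrightarrow> c" "c = 0" "\<And>k. 0 \<le> u k" "\<And>k. u k \<le> v k"
  shows "u \<longlonglongrightarrow> 0"
  by (rule tendsto_sandwich[of "\<lambda>_. 0" u sequentially v]) (use assms in auto)

lemma sum_wick_tensor_lincomb:
  assumes "finite A" "finite B"
  shows "\<exists>e. (\<forall>x. tensor_sum n (A \<union> B) e x = a * tensor_sum n A c x + b * tensor_sum n B d x) \<and>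
    (\<forall>\<omega>. wick_sum n (A \<union> B) e \<omega> = a * wick_sum n A c \<omega> + b * wick_sum n B d \<omega>)"
  unfolding tensor_sum_def wick_sum_def lincomb_of_sums[OF assms]
  by (rule exI[of _ "\<lambda>\<phi>. a * (if \<phi> \<in> A then c \<phi> else 0) + b * (if \<phi> \<in> B then d \<phi> else 0)"]) blast

context white_noise_space
begin

lemma wick_sum_L2: "wick_sum n A c \<in> L2 \<mu>"
  unfolding wick_sum_def[abs_def] by (intro L2_sum L2_scale wick_power_L2)

text \<open>The isometry between tensor sums and Wick sums, up to the factor \<open>n!\<close>, together with the
  orthogonality of Wick sums of different orders.  In particular a Wick sum depends, almost surely,
  only on the corresponding tensor sum.\<close>

lemma L2_inner_wick_sum:
  "L2_inner \<mu> (wick_sum n A c) (wick_sum m B d) =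
    (if n = m then fact n * L2_inner (lborel_pow n) (tensor_sum n A c) (tensor_sum n B d) else 0)"
proof -
  have w: "L2_inner \<mu> (wick_power k \<phi>) (wick_sum m B d) = (\<Sum>\<psi>\<in>B. d \<psi> * L2_inner \<mu> (wick_power m \<psi>) (wick_power k \<phi>))"
    for k \<phi>
    unfolding wick_sum_def[abs_def]
    by (subst L2_inner_commute, rule L2_inner_sum_left) (auto intro: wick_power_L2)
  have t: "L2_inner (lborel_pow n) (tensor_power n \<phi>) (tensor_sum n B d) =
      (\<Sum>\<psi>\<in>B. d \<psi> * L2_inner (lborel_pow n) (tensor_power n \<psi>) (tensor_power n \<phi>))" for \<phi>
    unfolding tensor_sum_def[abs_def]
    by (subst L2_inner_commute, rule L2_inner_sum_left) (auto intro: tensor_power_L2)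
  have W: "L2_inner \<mu> (wick_sum n A c) (wick_sum m B d) =
      (\<Sum>\<phi>\<in>A. c \<phi> * L2_inner \<mu> (wick_power n \<phi>) (wick_sum m B d))"
    unfolding wick_sum_def[of n, abs_def]
    by (rule L2_inner_sum_left) (auto intro: wick_power_L2 wick_sum_L2)
  have T: "L2_inner (lborel_pow n) (tensor_sum n A c) (tensor_sum n B d) =
      (\<Sum>\<phi>\<in>A. c \<phi> * L2_inner (lborel_pow n) (tensor_power n \<phi>) (tensor_sum n B d))"
    unfolding tensor_sum_def[of n A, abs_def]
    by (rule L2_inner_sum_left) (auto intro: tensor_power_L2 tensor_sum_L2)
  show ?thesis
    unfolding W T w t by (simp add: L2_inner_wick_power L2_inner_tensor_power sum_distrib_left mult_ac)
qed

lemma L2_sq_wick_sum_diff: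
  assumes "finite A" "finite B"
  shows "L2_sq \<mu> (\<lambda>\<omega>. wick_sum n A c \<omega> - wick_sum n B d \<omega>) =
    fact n * L2_sq (lborel_pow n) (\<lambda>x. tensor_sum n A c x - tensor_sum n B d x)"
  unfolding L2_sq_diff[OF wick_sum_L2 wick_sum_L2] L2_sq_diff[OF tensor_sum_L2 tensor_sum_L2]
  unfolding L2_sq_eq_inner L2_inner_wick_sum by (simp add: algebra_simps)

text \<open>The closure of the graph in terms of sequences, so that identities for Wick sums pass to the
  limit by continuity of the inner product.\<close>

lemma has_wiener_integral_iff_sequence:
  assumes f: "f \<in> L2 (lborel_pow n)"
  shows "has_wiener_integral \<mu> n f J \<longleftrightarrow> J \<in> L2 \<mu> \<and> (\<exists>A c. (\<forall>k. finite (A k)) \<and>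
    (\<lambda>k. L2_sq (lborel_pow n) (\<lambda>x. tensor_sum n (A k) (c k) x - f x)) \<longlonglongrightarrow> 0 \<and>
    (\<lambda>k. L2_sq \<mu> (\<lambda>\<omega>. wick_sum n (A k) (c k) \<omega> - J \<omega>)) \<longlonglongrightarrow> 0)" (is "?L \<longleftrightarrow> ?R")
proof
  assume L: ?L
  let ?P = "\<lambda>k A c. finite A \<and> L2_sq (lborel_pow n) (\<lambda>x. tensor_sum n A c x - f x) < inverse (real (Suc k)) \<and>
      L2_sq \<mu> (\<lambda>\<omega>. wick_sum n A c \<omega> - J \<omega>) < inverse (real (Suc k))"
  have "\<forall>k. \<exists>A c. ?P k A c"
  proof
    fix k
    have "inverse (real (Suc k)) > 0" by simp
    with L show "\<exists>A c. ?P k A c"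
      unfolding has_wiener_integral_def L2_sq_minus_commute[of _ f] L2_sq_minus_commute[of _ J]
        tensor_sum_def wick_sum_def by blast
  qed
  from choice[OF this] obtain A where "\<forall>k. \<exists>c. ?P k (A k) c" by blast
  from choice[OF this] obtain c where *: "\<And>k. ?P k (A k) (c k)" by blast
  have "(\<lambda>k. L2_sq (lborel_pow n) (\<lambda>x. tensor_sum n (A k) (c k) x - f x)) \<longlonglongrightarrow> 0"
    by (rule tendsto_sandwich[OF _ _ tendsto_const LIMSEQ_inverse_real_of_nat])
       (use * in \<open>auto simp: L2_sq_nonneg intro!: always_eventually less_imp_le\<close>)
  moreover have "(\<lambda>k. L2_sq \<mu> (\<lambda>\<omega>. wick_sum n (A k) (c k) \<omega> - J \<omega>)) \<longlonglongrightarrow> 0"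
    by (rule tendsto_sandwich[OF _ _ tendsto_const LIMSEQ_inverse_real_of_nat])
       (use * in \<open>auto simp: L2_sq_nonneg intro!: always_eventually less_imp_le\<close>)
  moreover have "\<forall>k. finite (A k)" using * by blast
  moreover have "J \<in> L2 \<mu>" using L by (simp add: has_wiener_integral_def)
  ultimately show ?R by blast
next
  assume ?R
  then obtain A c where J: "J \<in> L2 \<mu>" and fin: "\<And>k. finite (A k)"
    and lim: "(\<lambda>k. L2_sq (lborel_pow n) (\<lambda>x. tensor_sum n (A k) (c k) x - f x)) \<longlonglongrightarrow> 0"
      "(\<lambda>k. L2_sq \<mu> (\<lambda>\<omega>. wick_sum n (A k) (c k) \<omega> - J \<omega>)) \<longlonglongrightarrow> 0" by blast
  show ?L
    unfolding has_wiener_integral_def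
  proof (intro conjI allI impI J)
    fix \<epsilon> :: real assume "\<epsilon> > 0"
    then have "eventually (\<lambda>k. L2_sq (lborel_pow n) (\<lambda>x. tensor_sum n (A k) (c k) x - f x) < \<epsilon> \<and>
        L2_sq \<mu> (\<lambda>\<omega>. wick_sum n (A k) (c k) \<omega> - J \<omega>) < \<epsilon>) sequentially"
      using lim by (intro eventually_conj) (auto dest: order_tendstoD(2))
    then obtain k where "L2_sq (lborel_pow n) (\<lambda>x. tensor_sum n (A k) (c k) x - f x) < \<epsilon>"
        "L2_sq \<mu> (\<lambda>\<omega>. wick_sum n (A k) (c k) \<omega> - J \<omega>) < \<epsilon>"
      using eventually_happens'[OF sequentially_bot] by blast
    then show "\<exists>A c. finite A \<and> L2_sq (lborel_pow n) (\<lambda>x. f x - (\<Sum>\<phi>\<in>A. c \<phi> * tensor_power n \<phi> x)) < \<epsilon> \<and>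
        L2_sq \<mu> (\<lambda>\<omega>. J \<omega> - (\<Sum>\<phi>\<in>A. c \<phi> * wick_power n \<phi> \<omega>)) < \<epsilon>"
      using fin unfolding L2_sq_minus_commute[of _ f] L2_sq_minus_commute[of _ J]
        tensor_sum_def wick_sum_def by (intro exI[of _ "A k"] exI[of _ "c k"]) simp
  qed
qed

lemma has_wiener_integral_inner:
  assumes f: "f \<in> L2 (lborel_pow n)" and g: "g \<in> L2 (lborel_pow m)"
    and J: "has_wiener_integral \<mu> n f J" and K: "has_wiener_integral \<mu> m g K"
  shows "L2_inner \<mu> J K = (if n = m then fact n * L2_inner (lborel_pow n) f g else 0)"
proof -
  obtain A c where JL2: "J \<in> L2 \<mu>"
    and lf: "(\<lambda>k. L2_sq (lborel_pow n) (\<lambda>x. tensor_sum n (A k) (c k) x - f x)) \<longlonglongrightarrow> 0"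
    and lJ: "(\<lambda>k. L2_sq \<mu> (\<lambda>\<omega>. wick_sum n (A k) (c k) \<omega> - J \<omega>)) \<longlonglongrightarrow> 0"
    using J unfolding has_wiener_integral_iff_sequence[OF f] by blast
  obtain B d where KL2: "K \<in> L2 \<mu>"
    and lg: "(\<lambda>k. L2_sq (lborel_pow m) (\<lambda>x. tensor_sum m (B k) (d k) x - g x)) \<longlonglongrightarrow> 0"
    and lK: "(\<lambda>k. L2_sq \<mu> (\<lambda>\<omega>. wick_sum m (B k) (d k) \<omega> - K \<omega>)) \<longlonglongrightarrow> 0"
    using K unfolding has_wiener_integral_iff_sequence[OF g] by blast
  have 1: "(\<lambda>k. L2_inner \<mu> (wick_sum n (A k) (c k)) (wick_sum m (B k) (d k))) \<longlonglongrightarrow> L2_inner \<mu> J K"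
    by (rule L2_inner_tendsto[OF wick_sum_L2 JL2 wick_sum_L2 KL2 lJ lK])
  show ?thesis
  proof (cases "n = m")
    case True
    have "(\<lambda>k. fact n * L2_inner (lborel_pow n) (tensor_sum n (A k) (c k)) (tensor_sum n (B k) (d k)))
        \<longlonglongrightarrow> fact n * L2_inner (lborel_pow n) f g"
      using g lg unfolding True[symmetric]
      by (intro tendsto_mult tendsto_const L2_inner_tendsto[OF tensor_sum_L2 f tensor_sum_L2 _ lf])
    then show ?thesis
      using 1 True by (auto simp: L2_inner_wick_sum intro: LIMSEQ_unique)
  next
    case False
    then show ?thesis using 1 by (simp add: L2_inner_wick_sum LIMSEQ_const_iff)
  qed
qed

lemma has_wiener_integral_lincomb:
  assumes f: "f \<in> L2 (lborel_pow n)" and g: "g \<in> L2 (lborel_pow n)"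
    and J: "has_wiener_integral \<mu> n f J" and K: "has_wiener_integral \<mu> n g K"
  shows "has_wiener_integral \<mu> n (\<lambda>x. a * f x + b * g x) (\<lambda>\<omega>. a * J \<omega> + b * K \<omega>)"
proof -
  obtain A c where JL2: "J \<in> L2 \<mu>" and A: "\<And>k. finite (A k)"
    and lf: "(\<lambda>k. L2_sq (lborel_pow n) (\<lambda>x. tensor_sum n (A k) (c k) x - f x)) \<longlonglongrightarrow> 0"
    and lJ: "(\<lambda>k. L2_sq \<mu> (\<lambda>\<omega>. wick_sum n (A k) (c k) \<omega> - J \<omega>)) \<longlonglongrightarrow> 0"
    using J unfolding has_wiener_integral_iff_sequence[OF f] by blast
  obtain B d where KL2: "K \<in> L2 \<mu>" and B: "\<And>k. finite (B k)"
    and lg: "(\<lambda>k. L2_sq (lborel_pow n) (\<lambda>x. tensor_sum n (B k) (d k) x - g x)) \<longlonglongrightarrow> 0"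
    and lK: "(\<lambda>k. L2_sq \<mu> (\<lambda>\<omega>. wick_sum n (B k) (d k) \<omega> - K \<omega>)) \<longlonglongrightarrow> 0"
    using K unfolding has_wiener_integral_iff_sequence[OF g] by blast
  have "\<forall>k. \<exists>e. (\<forall>x. tensor_sum n (A k \<union> B k) e x = a * tensor_sum n (A k) (c k) x + b * tensor_sum n (B k) (d k) x) \<and>
    (\<forall>\<omega>. wick_sum n (A k \<union> B k) e \<omega> = a * wick_sum n (A k) (c k) \<omega> + b * wick_sum n (B k) (d k) \<omega>)"
    using sum_wick_tensor_lincomb[OF A B] by blast
  from choice[OF this] obtain e where
    te: "\<And>k x. tensor_sum n (A k \<union> B k) (e k) x = a * tensor_sum n (A k) (c k) x + b * tensor_sum n (B k) (d k) x" and
    we: "\<And>k \<omega>. wick_sum n (A k \<union> B k) (e k) \<omega> = a * wick_sum n (A k) (c k) \<omega> + b * wick_sum n (B k) (d k) \<omega>"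
    by blast
  have comb: "(\<lambda>k. L2_sq M (\<lambda>x. (a * u k x + b * v k x) - (a * u' x + b * v' x))) \<longlonglongrightarrow> 0"
    if L2: "\<And>k. u k \<in> L2 M" "\<And>k. v k \<in> L2 M" "u' \<in> L2 M" "v' \<in> L2 M"
      and lim: "(\<lambda>k. L2_sq M (\<lambda>x. u k x - u' x)) \<longlonglongrightarrow> 0" "(\<lambda>k. L2_sq M (\<lambda>x. v k x - v' x)) \<longlonglongrightarrow> 0"
    for M :: "'z measure" and u v u' v'
  proof -
    have l: "(\<lambda>k. 2 * (a\<^sup>2 * L2_sq M (\<lambda>x. u k x - u' x)) + 2 * (b\<^sup>2 * L2_sq M (\<lambda>x. v k x - v' x)))
        \<longlonglongrightarrow> 2 * (a\<^sup>2 * 0) + 2 * (b\<^sup>2 * 0)"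
      by (intro tendsto_intros lim)
    have le: "L2_sq M (\<lambda>x. (a * u k x + b * v k x) - (a * u' x + b * v' x)) \<le>
        2 * (a\<^sup>2 * L2_sq M (\<lambda>x. u k x - u' x)) + 2 * (b\<^sup>2 * L2_sq M (\<lambda>x. v k x - v' x))" for k
    proof -
      have d: "(\<lambda>x. u k x - u' x) \<in> L2 M" "(\<lambda>x. v k x - v' x) \<in> L2 M"
        using L2 by (auto intro: L2_diff)
      have "(\<lambda>x. (a * u k x + b * v k x) - (a * u' x + b * v' x)) =
          (\<lambda>x. a * (u k x - u' x) + b * (v k x - v' x))" by (auto simp: algebra_simps)
      then show ?thesis
        using L2_add(2)[OF L2_scale(1)[OF d(1), of a] L2_scale(1)[OF d(2), of b]]
        by (simp add: L2_scale(2)[OF d(1)] L2_scale(2)[OF d(2)])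
    qed
    show ?thesis
      by (rule nonneg_squeeze_zero[OF l _ L2_sq_nonneg le]) simp
  qed
  have fg: "(\<lambda>x. a * f x + b * g x) \<in> L2 (lborel_pow n)" by (rule L2_lincomb[OF f g])
  show ?thesis
    unfolding has_wiener_integral_iff_sequence[OF fg]
  proof (rule conjI, rule L2_lincomb[OF JL2 KL2], rule exI[of _ "\<lambda>k. A k \<union> B k"], rule exI[of _ e],
      intro conjI allI)
    show "finite (A k \<union> B k)" for k using A B by blast
    show "(\<lambda>k. L2_sq (lborel_pow n) (\<lambda>x. tensor_sum n (A k \<union> B k) (e k) x - (a * f x + b * g x))) \<longlonglongrightarrow> 0"
      unfolding te by (rule comb[OF tensor_sum_L2 tensor_sum_L2 f g lf lg])
    show "(\<lambda>k. L2_sq \<mu> (\<lambda>\<omega>. wick_sum n (A k \<union> B k) (e k) \<omega> - (a * J \<omega> + b * K \<omega>))) \<longlonglongrightarrow> 0"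
      unfolding we by (rule comb[OF wick_sum_L2 wick_sum_L2 JL2 KL2 lJ lK])
  qed
qed

text \<open>The tensor sums that approximate \<open>f\<close> are a Cauchy sequence, hence by the isometry so are the
  Wick sums with the same coefficients.\<close>

lemma has_wiener_integral_exists:
  assumes f: "f \<in> L2_sym n"
  shows "\<exists>J. has_wiener_integral \<mu> n f J"
proof -
  have fL2: "f \<in> L2 (lborel_pow n)" by (rule L2_sym_L2[OF f])
  obtain A c where A: "\<And>k. finite (A k)"
    and lim: "(\<lambda>k. L2_sq (lborel_pow n) (\<lambda>x. tensor_sum n (A k) (c k) x - f x)) \<longlonglongrightarrow> 0"
    using tensor_powers_dense[OF f] unfolding tensor_sum_def by blast
  have "\<exists>J\<in>L2 \<mu>. (\<lambda>k. L2_sq \<mu> (\<lambda>\<omega>. wick_sum n (A k) (c k) \<omega> - J \<omega>)) \<longlonglongrightarrow> 0"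
  proof (rule L2_complete[OF wick_sum_L2])
    fix e :: real assume e: "e > 0"
    let ?d = "e / (4 * fact n)"
    have "?d > 0" using e by simp
    from LIMSEQ_D[OF lim this] obtain N where
      N: "\<And>k. k \<ge> N \<Longrightarrow> L2_sq (lborel_pow n) (\<lambda>x. tensor_sum n (A k) (c k) x - f x) < ?d"
      by (auto simp: L2_sq_nonneg)
    have "L2_sq \<mu> (\<lambda>\<omega>. wick_sum n (A k) (c k) \<omega> - wick_sum n (A l) (c l) \<omega>) < e" if "k \<ge> N" "l \<ge> N" for k l
    proof -
      have "L2_sq (lborel_pow n) (\<lambda>x. tensor_sum n (A k) (c k) x - tensor_sum n (A l) (c l) x) \<le>
          2 * L2_sq (lborel_pow n) (\<lambda>x. tensor_sum n (A k) (c k) x - f x) +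
          2 * L2_sq (lborel_pow n) (\<lambda>x. tensor_sum n (A l) (c l) x - f x)"
        using L2_sq_triangle[OF tensor_sum_L2 fL2 tensor_sum_L2, of "A k" "c k" "A l" "c l"]
        by (simp add: L2_sq_minus_commute[of _ f])
      also have "\<dots> < 4 * ?d" using N[OF that(1)] N[OF that(2)] by linarith
      finally have "fact n * L2_sq (lborel_pow n) (\<lambda>x. tensor_sum n (A k) (c k) x - tensor_sum n (A l) (c l) x)
          < fact n * (4 * ?d)" by (intro mult_strict_left_mono) auto
      then show ?thesis by (simp add: L2_sq_wick_sum_diff A)
    qed
    then show "\<exists>N. \<forall>k\<ge>N. \<forall>l\<ge>N. L2_sq \<mu> (\<lambda>\<omega>. wick_sum n (A k) (c k) \<omega> - wick_sum n (A l) (c l) \<omega>) < e"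
      by blast
  qed
  then show ?thesis unfolding has_wiener_integral_iff_sequence[OF fL2] using A lim by blast
qed

lemma has_wiener_integral: "f \<in> L2_sym n \<Longrightarrow> has_wiener_integral \<mu> n f (wiener_integral \<mu> n f)"
  unfolding wiener_integral_def by (rule someI_ex[of "has_wiener_integral \<mu> n f", OF has_wiener_integral_exists])

lemma wiener_integral_L2: "f \<in> L2_sym n \<Longrightarrow> wiener_integral \<mu> n f \<in> L2 \<mu>"
  using has_wiener_integral by (simp add: has_wiener_integral_def)

lemma wiener_integral_inner:
  assumes "f \<in> L2_sym n" "g \<in> L2_sym m"
  shows "L2_inner \<mu> (wiener_integral \<mu> n f) (wiener_integral \<mu> m g) =
    (if n = m then fact n * L2_inner (lborel_pow n) f g else 0)"
  using assms by (intro has_wiener_integral_inner has_wiener_integral L2_sym_L2)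

text \<open>The integral is a chosen representative, so linearity holds only almost surely.  Both sides are
  integrals of the same kernel, and the inner product formula shows that any two of these have
  distance \<open>0\<close>.\<close>

lemma wiener_integral_lincomb:
  assumes f: "f \<in> L2_sym n" and g: "g \<in> L2_sym n"
  shows "AE \<omega> in \<mu>. wiener_integral \<mu> n (\<lambda>x. a * f x + b * g x) \<omega> =
    a * wiener_integral \<mu> n f \<omega> + b * wiener_integral \<mu> n g \<omega>"
proof -
  let ?h = "\<lambda>x. a * f x + b * g x"
  let ?J = "wiener_integral \<mu> n ?h" and ?K = "\<lambda>\<omega>. a * wiener_integral \<mu> n f \<omega> + b * wiener_integral \<mu> n g \<omega>"
  have h: "?h \<in> L2_sym n" by (rule L2_sym_linear[OF f g])
  have hL2: "?h \<in> L2 (lborel_pow n)" by (rule L2_sym_L2[OF h])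
  have J: "has_wiener_integral \<mu> n ?h ?J" by (rule has_wiener_integral[OF h])
  have K: "has_wiener_integral \<mu> n ?h ?K"
    by (intro has_wiener_integral_lincomb L2_sym_L2 f g has_wiener_integral)
  have J2: "?J \<in> L2 \<mu>" and K2: "?K \<in> L2 \<mu>" using J K by (auto simp: has_wiener_integral_def)
  have "L2_sq \<mu> (\<lambda>\<omega>. ?J \<omega> - ?K \<omega>) = 0"
    unfolding L2_sq_diff[OF J2 K2]
    unfolding L2_sq_eq_inner has_wiener_integral_inner[OF hL2 hL2 J J]
      has_wiener_integral_inner[OF hL2 hL2 J K] has_wiener_integral_inner[OF hL2 hL2 K K] by simp
  then show ?thesis by (rule L2_sq_diff_zero_AE[OF J2 K2])
qed

end

section \<open>Chaos expansions\<close>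

lemma sum_nonneg_tendsto_zero:
  fixes t :: "nat \<Rightarrow> real"
  assumes nn: "\<And>n. 0 \<le> t n" and lim: "(\<lambda>m. \<Sum>n\<le>m. t n) \<longlonglongrightarrow> 0"
  shows "t n = 0"
proof -
  have "t n \<le> (\<Sum>k\<le>m. t k)" if "m \<ge> n" for m
    using that nn by (intro member_le_sum) auto
  then have "t n \<le> 0" using lim by (intro LIMSEQ_le_const) auto
  then show ?thesis using nn by (rule antisym)
qed

lemma chaos_term_zero_iff: "chaos_term p F n = 0 \<longleftrightarrow> L2_sq (lborel_pow n) (F n) = 0"
  by (simp add: chaos_term_def)

lemma chaos_term_cong:
  assumes "F n \<in> L2_sym n" "H n \<in> L2_sym n" "AE x in lborel_pow n. F n x = H n x"
  shows "chaos_term p F n = chaos_term p H n"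
  using assms unfolding chaos_term_def
  by (subst L2_sq_cong_AE[of _ _ "H n"]) (auto intro: L2_measurable L2_sym_L2)

lemma chaos_term_lincomb_le:
  assumes "F n \<in> L2_sym n" "H n \<in> L2_sym n"
  shows "chaos_term p (\<lambda>n x. a * F n x + b * H n x) n \<le> 2 * a\<^sup>2 * chaos_term p F n + 2 * b\<^sup>2 * chaos_term p H n"
proof -
  have L2: "F n \<in> L2 (lborel_pow n)" "H n \<in> L2 (lborel_pow n)" using assms by (auto intro: L2_sym_L2)
  have "L2_sq (lborel_pow n) (\<lambda>x. a * F n x + b * H n x) \<le>
      2 * (a\<^sup>2 * L2_sq (lborel_pow n) (F n)) + 2 * (b\<^sup>2 * L2_sq (lborel_pow n) (H n))"
    using L2_add(2)[OF L2_scale(1)[OF L2(1), of a] L2_scale(1)[OF L2(2), of b]]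
    by (simp only: L2_scale(2)[OF L2(1)] L2_scale(2)[OF L2(2)])
  then have "chaos_term p (\<lambda>n x. a * F n x + b * H n x) n \<le> exp (2 * of_int p * of_nat n) * fact n *
      (2 * (a\<^sup>2 * L2_sq (lborel_pow n) (F n)) + 2 * (b\<^sup>2 * L2_sq (lborel_pow n) (H n)))"
    unfolding chaos_term_def by (intro mult_left_mono) auto
  then show ?thesis by (simp add: chaos_term_def algebra_simps)
qed

lemma chaos_term_shift: "chaos_term (p + q) F n = exp (2 * of_int q * real n) * chaos_term p F n"
  by (simp add: chaos_term_def algebra_simps exp_add)

definition cut_kernels :: "nat \<Rightarrow> (nat \<Rightarrow> (nat \<Rightarrow> 'a::euclidean_space) \<Rightarrow> real) \<Rightarrow> nat \<Rightarrow> (nat \<Rightarrow> 'a) \<Rightarrow> real" where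
  "cut_kernels m F n x = (if n \<le> m then F n x else 0)"

lemma chaos_term_cut: "chaos_term p (cut_kernels m F) n = (if n \<le> m then chaos_term p F n else 0)"
  by (simp add: chaos_term_def cut_kernels_def[abs_def] L2_zero)

lemma cut_kernels_L2_sym:
  assumes "\<And>n. F n \<in> L2_sym n"
  shows "cut_kernels m F n \<in> L2_sym n"
  using assms[of n] L2_sym_zero[of n] by (cases "n \<le> m") (simp_all add: cut_kernels_def[abs_def])

context white_noise_space
begin

definition chaos_sum :: "nat \<Rightarrow> (nat \<Rightarrow> (nat \<Rightarrow> 'a) \<Rightarrow> real) \<Rightarrow> ('a schwartz \<Rightarrow> real) \<Rightarrow> real" where
  "chaos_sum m F \<omega> = (\<Sum>n\<le>m. wiener_integral \<mu> n (F n) \<omega>)"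

lemma has_chaos_expansion_iff:
  "has_chaos_expansion \<mu> \<phi> F \<longleftrightarrow> (\<forall>n. F n \<in> L2_sym n) \<and> (\<lambda>m. L2_sq \<mu> (\<lambda>\<omega>. \<phi> \<omega> - chaos_sum m F \<omega>)) \<longlonglongrightarrow> 0"
  by (simp add: has_chaos_expansion_def chaos_sum_def)

lemma chaos_sum_L2:
  assumes "\<And>n. F n \<in> L2_sym n"
  shows "chaos_sum m F \<in> L2 \<mu>"
  unfolding chaos_sum_def[abs_def] using assms by (intro L2_sum wiener_integral_L2)

lemma L2_sq_chaos_sum:
  assumes F: "\<And>n. F n \<in> L2_sym n"
  shows "L2_sq \<mu> (chaos_sum m F) = (\<Sum>n\<le>m. chaos_term 0 F n)"
proof -
  have I: "wiener_integral \<mu> n (F n) \<in> L2 \<mu>" for n by (rule wiener_integral_L2[OF F])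
  have *: "L2_inner \<mu> (chaos_sum m F) h = (\<Sum>n\<le>m. L2_inner \<mu> (wiener_integral \<mu> n (F n)) h)" if "h \<in> L2 \<mu>" for h
    using L2_inner_sum_left[of "{..m}" "\<lambda>n. wiener_integral \<mu> n (F n)" \<mu> h "\<lambda>_. 1"] that I
    by (simp add: chaos_sum_def[abs_def])
  have "L2_sq \<mu> (chaos_sum m F) = (\<Sum>n\<le>m. L2_inner \<mu> (wiener_integral \<mu> n (F n)) (chaos_sum m F))"
    unfolding L2_sq_eq_inner by (rule *[OF chaos_sum_L2[OF F]])
  also have "\<dots> = (\<Sum>n\<le>m. \<Sum>k\<le>m. L2_inner \<mu> (wiener_integral \<mu> k (F k)) (wiener_integral \<mu> n (F n)))"
    by (subst L2_inner_commute) (simp only: *[OF I])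
  also have "\<dots> = (\<Sum>n\<le>m. \<Sum>k\<le>m. if k = n then fact n * L2_sq (lborel_pow n) (F n) else 0)"
    by (intro sum.cong refl) (simp add: wiener_integral_inner F L2_sq_eq_inner)
  also have "\<dots> = (\<Sum>n\<le>m. chaos_term 0 F n)"
    by (simp add: chaos_term_def)
  finally show ?thesis .
qed

lemma chaos_sum_lincomb:
  assumes F: "\<And>n. F n \<in> L2_sym n" and H: "\<And>n. H n \<in> L2_sym n"
  shows "AE \<omega> in \<mu>. chaos_sum m (\<lambda>n x. a * F n x + b * H n x) \<omega> = a * chaos_sum m F \<omega> + b * chaos_sum m H \<omega>"
proof -
  have "AE \<omega> in \<mu>. \<forall>n\<in>{..m}. wiener_integral \<mu> n (\<lambda>x. a * F n x + b * H n x) \<omega> =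
      a * wiener_integral \<mu> n (F n) \<omega> + b * wiener_integral \<mu> n (H n) \<omega>"
    by (intro AE_finite_allI wiener_integral_lincomb F H) simp
  then show ?thesis
    by eventually_elim (simp add: chaos_sum_def sum.distrib sum_distrib_left)
qed

lemma has_chaos_expansion_lincomb:
  assumes \<phi>: "\<phi> \<in> L2 \<mu>" "has_chaos_expansion \<mu> \<phi> F" and \<psi>: "\<psi> \<in> L2 \<mu>" "has_chaos_expansion \<mu> \<psi> H"
  shows "has_chaos_expansion \<mu> (\<lambda>\<omega>. a * \<phi> \<omega> + b * \<psi> \<omega>) (\<lambda>n x. a * F n x + b * H n x)"
proof -
  have F: "F n \<in> L2_sym n" and H: "H n \<in> L2_sym n" for n
    using \<phi>(2) \<psi>(2) by (auto simp: has_chaos_expansion_iff)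
  let ?L = "\<lambda>n x. a * F n x + b * H n x"
  have L: "?L n \<in> L2_sym n" for n by (rule L2_sym_linear[OF F H])
  let ?u = "\<lambda>m \<omega>. \<phi> \<omega> - chaos_sum m F \<omega>" and ?v = "\<lambda>m \<omega>. \<psi> \<omega> - chaos_sum m H \<omega>"
  have uv: "?u m \<in> L2 \<mu>" "?v m \<in> L2 \<mu>" for m
    using \<phi>(1) \<psi>(1) F H by (auto intro: L2_diff chaos_sum_L2)
  have le: "L2_sq \<mu> (\<lambda>\<omega>. a * \<phi> \<omega> + b * \<psi> \<omega> - chaos_sum m ?L \<omega>) \<le>
      2 * (a\<^sup>2 * L2_sq \<mu> (?u m)) + 2 * (b\<^sup>2 * L2_sq \<mu> (?v m))" for m
  proof -
    have "L2_sq \<mu> (\<lambda>\<omega>. a * \<phi> \<omega> + b * \<psi> \<omega> - chaos_sum m ?L \<omega>) = L2_sq \<mu> (\<lambda>\<omega>. a * ?u m \<omega> + b * ?v m \<omega>)"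
    proof (rule L2_sq_cong_AE)
      show "AE \<omega> in \<mu>. a * \<phi> \<omega> + b * \<psi> \<omega> - chaos_sum m ?L \<omega> = a * ?u m \<omega> + b * ?v m \<omega>"
        using chaos_sum_lincomb[OF F H, of m a b] by eventually_elim (simp add: algebra_simps)
    qed (intro L2_measurable L2_diff L2_lincomb \<phi> \<psi> chaos_sum_L2 L F H)+
    also have "\<dots> \<le> 2 * (a\<^sup>2 * L2_sq \<mu> (?u m)) + 2 * (b\<^sup>2 * L2_sq \<mu> (?v m))"
      using L2_add(2)[OF L2_scale(1)[OF uv(1), of a] L2_scale(1)[OF uv(2), of b]]
      by (simp only: L2_scale(2)[OF uv(1)] L2_scale(2)[OF uv(2)])
    finally show ?thesis .
  qed
  have "(\<lambda>m. 2 * (a\<^sup>2 * L2_sq \<mu> (?u m)) + 2 * (b\<^sup>2 * L2_sq \<mu> (?v m))) \<longlonglongrightarrow> 2 * (a\<^sup>2 * 0) + 2 * (b\<^sup>2 * 0)"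
    using \<phi>(2) \<psi>(2) by (intro tendsto_intros) (auto simp: has_chaos_expansion_iff)
  then have "(\<lambda>m. L2_sq \<mu> (\<lambda>\<omega>. a * \<phi> \<omega> + b * \<psi> \<omega> - chaos_sum m ?L \<omega>)) \<longlonglongrightarrow> 0"
    by (rule nonneg_squeeze_zero[OF _ _ L2_sq_nonneg le]) simp
  then show ?thesis using L by (simp add: has_chaos_expansion_iff)
qed

text \<open>The difference of two expansions of \<open>\<phi>\<close> expands \<open>0\<close>, and the squared norms of its partial sums
  are increasing sums of nonnegative terms that tend to \<open>0\<close>.\<close>

lemma has_chaos_expansion_unique:
  assumes \<phi>: "\<phi> \<in> L2 \<mu>" and F: "has_chaos_expansion \<mu> \<phi> F" and H: "has_chaos_expansion \<mu> \<phi> H"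
  shows "AE x in lborel_pow n. F n x = H n x"
proof -
  have sym: "F n \<in> L2_sym n" "H n \<in> L2_sym n" for n using F H by (auto simp: has_chaos_expansion_iff)
  let ?D = "\<lambda>n x. 1 * F n x + (-1) * H n x"
  have D: "?D n \<in> L2_sym n" for n by (rule L2_sym_linear[OF sym])
  have "has_chaos_expansion \<mu> (\<lambda>\<omega>. 1 * \<phi> \<omega> + (-1) * \<phi> \<omega>) ?D"
    by (rule has_chaos_expansion_lincomb[OF \<phi> F \<phi> H])
  then have "(\<lambda>m. L2_sq \<mu> (\<lambda>\<omega>. 0 - chaos_sum m ?D \<omega>)) \<longlonglongrightarrow> 0"
    by (simp add: has_chaos_expansion_iff)
  moreover have "L2_sq \<mu> (\<lambda>\<omega>. 0 - chaos_sum m ?D \<omega>) = (\<Sum>n\<le>m. chaos_term 0 ?D n)" for m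
    unfolding L2_sq_chaos_sum[OF D, symmetric] by (simp add: L2_sq_def)
  ultimately have "chaos_term 0 ?D n = 0"
    by (intro sum_nonneg_tendsto_zero chaos_term_nonneg) simp
  then have "L2_sq (lborel_pow n) (\<lambda>x. F n x - H n x) = 0" by (simp add: chaos_term_zero_iff)
  then show ?thesis by (rule L2_sq_diff_zero_AE[OF L2_sym_L2 L2_sym_L2, OF sym])
qed

lemma has_chaos_expansion_null:
  assumes "\<phi> \<in> L2 \<mu>" "AE \<omega> in \<mu>. \<phi> \<omega> = 0"
  shows "has_chaos_expansion \<mu> \<phi> (\<lambda>n x. 0)"
proof -
  have "L2_sq \<mu> (\<lambda>\<omega>. \<phi> \<omega> - chaos_sum m (\<lambda>n x. 0) \<omega>) = 0" for m
  proof -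
    have c: "chaos_sum m (\<lambda>n x. 0) \<in> L2 \<mu>" by (rule chaos_sum_L2[OF L2_sym_zero])
    have "L2_sq \<mu> (\<lambda>\<omega>. \<phi> \<omega> - chaos_sum m (\<lambda>n x. 0) \<omega>) \<le> 2 * L2_sq \<mu> \<phi> + 2 * L2_sq \<mu> (chaos_sum m (\<lambda>n x. 0))"
      by (rule L2_sq_diff_le[OF assms(1) c])
    also have "L2_sq \<mu> (chaos_sum m (\<lambda>n x. 0)) = 0"
      by (simp add: L2_sq_chaos_sum L2_sym_zero chaos_term_def L2_zero)
    also have "L2_sq \<mu> \<phi> = L2_sq \<mu> (\<lambda>\<omega>. 0)"
      using assms by (intro L2_sq_cong_AE) (auto intro: L2_measurable)
    finally show ?thesis using L2_sq_nonneg[of \<mu>] by (simp add: L2_zero antisym)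
  qed
  then show ?thesis by (simp add: has_chaos_expansion_iff L2_sym_zero)
qed

text \<open>The later partial sums of the truncated series are almost surely equal to the \<open>m\<close>-th one, as
  the integral of the kernel \<open>0\<close> vanishes almost surely.\<close>

lemma has_chaos_expansion_chaos_sum:
  assumes F: "\<And>n. F n \<in> L2_sym n"
  shows "has_chaos_expansion \<mu> (chaos_sum m F) (cut_kernels m F)"
proof -
  have "L2_sq \<mu> (\<lambda>\<omega>. chaos_sum m F \<omega> - chaos_sum l (cut_kernels m F) \<omega>) = 0" if "l \<ge> m" for l
  proof -
    have split: "{..l} = {..m} \<union> {m<..l}" using that by auto
    have "chaos_sum l (cut_kernels m F) \<omega> = chaos_sum m F \<omega> + (\<Sum>n\<in>{m<..l}. wiener_integral \<mu> n (\<lambda>x. 0) \<omega>)" for \<omega>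
      unfolding chaos_sum_def split by (subst sum.union_disjoint) (auto simp: cut_kernels_def[abs_def])
    then have "L2_sq \<mu> (\<lambda>\<omega>. chaos_sum m F \<omega> - chaos_sum l (cut_kernels m F) \<omega>) =
        L2_sq \<mu> (\<lambda>\<omega>. - (\<Sum>n\<in>{m<..l}. wiener_integral \<mu> n (\<lambda>x. 0) \<omega>))" by simp
    also have "\<dots> = L2_sq \<mu> (\<lambda>\<omega>. 0)"
    proof (rule L2_sq_cong_AE)
      have "AE \<omega> in \<mu>. \<forall>n\<in>{m<..l}. wiener_integral \<mu> n (\<lambda>x. 0) \<omega> = 0"
      proof (rule AE_finite_allI)
        fix n
        show "AE \<omega> in \<mu>. wiener_integral \<mu> n (\<lambda>x. 0) \<omega> = 0"
          using wiener_integral_lincomb[OF L2_sym_zero L2_sym_zero, of n 0 0] by simp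
      qed simp
      then show "AE \<omega> in \<mu>. - (\<Sum>n\<in>{m<..l}. wiener_integral \<mu> n (\<lambda>x. 0) \<omega>) = 0"
        by eventually_elim simp
      show "(\<lambda>\<omega>. - (\<Sum>n\<in>{m<..l}. wiener_integral \<mu> n (\<lambda>x. 0) \<omega>)) \<in> borel_measurable \<mu>"
        by (intro borel_measurable_uminus borel_measurable_sum L2_measurable wiener_integral_L2 L2_sym_zero)
    qed simp
    finally show ?thesis by (simp add: L2_zero)
  qed
  then have "(\<lambda>l. L2_sq \<mu> (\<lambda>\<omega>. chaos_sum m F \<omega> - chaos_sum l (cut_kernels m F) \<omega>)) \<longlonglongrightarrow> 0"
    by (intro tendsto_eventually eventually_sequentiallyI[of m])
  then show ?thesis using cut_kernels_L2_sym[OF F] by (simp add: has_chaos_expansion_iff)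
qed

section \<open>Norms of regular test functions\<close>

text \<open>The norms refer to a chosen sequence of kernels.  This predicate allows them to be computed
  from any expansion that is at hand.\<close>

definition test_expansion :: "(('a schwartz \<Rightarrow> real) \<Rightarrow> real) \<Rightarrow> (nat \<Rightarrow> (nat \<Rightarrow> 'a) \<Rightarrow> real) \<Rightarrow> bool" where
  "test_expansion \<phi> F \<longleftrightarrow> \<phi> \<in> L2 \<mu> \<and> has_chaos_expansion \<mu> \<phi> F \<and> (\<forall>p. summable (chaos_term (int p) F))"

lemma test_expansion_chaos_kernels:
  assumes "\<phi> \<in> G_test \<mu>"
  shows "test_expansion \<phi> (chaos_kernels \<mu> \<phi>)"
  using assms by (auto simp: G_test_def Gp_def test_expansion_def)

text \<open>Any expansion has almost everywhere the same kernels as the chosen one.\<close>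

lemma test_expansion_G_test:
  assumes "test_expansion \<phi> F"
  shows "\<phi> \<in> G_test \<mu>" "G_norm p \<mu> \<phi> = sqrt (\<Sum>n. chaos_term (int p) F n)"
proof -
  have \<phi>: "\<phi> \<in> L2 \<mu>" and F: "has_chaos_expansion \<mu> \<phi> F" and s: "\<And>p. summable (chaos_term (int p) F)"
    using assms by (auto simp: test_expansion_def)
  have K: "has_chaos_expansion \<mu> \<phi> (chaos_kernels \<mu> \<phi>)"
    unfolding chaos_kernels_def by (rule someI[of "has_chaos_expansion \<mu> \<phi>", OF F])
  have "chaos_term q (chaos_kernels \<mu> \<phi>) n = chaos_term q F n" for q n
    using K F has_chaos_expansion_unique[OF \<phi> K F]
    by (intro chaos_term_cong) (auto simp: has_chaos_expansion_iff)
  then have eq: "chaos_term q (chaos_kernels \<mu> \<phi>) = chaos_term q F" for q by (rule ext)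
  show "\<phi> \<in> G_test \<mu>" using \<phi> K s by (auto simp: G_test_def Gp_def eq)
  show "G_norm p \<mu> \<phi> = sqrt (\<Sum>n. chaos_term (int p) F n)" by (simp add: G_norm_def eq)
qed

lemma test_expansion_lincomb:
  assumes \<phi>: "test_expansion \<phi> F" and \<psi>: "test_expansion \<psi> H"
  shows "test_expansion (\<lambda>\<omega>. a * \<phi> \<omega> + b * \<psi> \<omega>) (\<lambda>n x. a * F n x + b * H n x)"
proof -
  have "summable (chaos_term (int p) (\<lambda>n x. a * F n x + b * H n x))" for p
  proof (rule summable_comparison_test')
    show "summable (\<lambda>n. 2 * a\<^sup>2 * chaos_term (int p) F n + 2 * b\<^sup>2 * chaos_term (int p) H n)"
      using \<phi> \<psi> by (intro summable_add summable_mult) (auto simp: test_expansion_def)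
    show "norm (chaos_term (int p) (\<lambda>n x. a * F n x + b * H n x) n) \<le>
        2 * a\<^sup>2 * chaos_term (int p) F n + 2 * b\<^sup>2 * chaos_term (int p) H n" if "n \<ge> 0" for n
      using chaos_term_lincomb_le[of F n H "int p" a b] \<phi> \<psi>
      by (simp add: chaos_term_nonneg test_expansion_def has_chaos_expansion_iff)
  qed
  then show ?thesis
    using \<phi> \<psi> by (auto simp: test_expansion_def intro: L2_lincomb has_chaos_expansion_lincomb)
qed

lemma G_norm_nonneg: "0 \<le> G_norm p \<mu> \<phi>" if "\<phi> \<in> G_test \<mu>"
  using test_expansion_chaos_kernels[OF that]
  by (auto simp: G_norm_def test_expansion_def intro!: suminf_nonneg chaos_term_nonneg)

text \<open>The factor \<open>2\<close> comes from \<open>(s + t)\<^sup>2 \<le> 2 s\<^sup>2 + 2 t\<^sup>2\<close>, which is crude but harmless: only the orders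
  of growth of the norms matter for moderate and negligible sequences.\<close>

lemma G_norm_lincomb_le:
  assumes \<phi>: "\<phi> \<in> G_test \<mu>" and \<psi>: "\<psi> \<in> G_test \<mu>"
  shows "(\<lambda>\<omega>. a * \<phi> \<omega> + b * \<psi> \<omega>) \<in> G_test \<mu>"
    and "G_norm p \<mu> (\<lambda>\<omega>. a * \<phi> \<omega> + b * \<psi> \<omega>) \<le> 2 * \<bar>a\<bar> * G_norm p \<mu> \<phi> + 2 * \<bar>b\<bar> * G_norm p \<mu> \<psi>"
proof -
  let ?F = "chaos_kernels \<mu> \<phi>" and ?H = "chaos_kernels \<mu> \<psi>"
  let ?L = "\<lambda>n x. a * ?F n x + b * ?H n x"
  have F: "test_expansion \<phi> ?F" and H: "test_expansion \<psi> ?H"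
    using \<phi> \<psi> by (auto intro: test_expansion_chaos_kernels)
  have L: "test_expansion (\<lambda>\<omega>. a * \<phi> \<omega> + b * \<psi> \<omega>) ?L" by (rule test_expansion_lincomb[OF F H])
  show "(\<lambda>\<omega>. a * \<phi> \<omega> + b * \<psi> \<omega>) \<in> G_test \<mu>" by (rule test_expansion_G_test(1)[OF L])
  let ?p = "int p"
  have sF: "summable (chaos_term ?p ?F)" and sH: "summable (chaos_term ?p ?H)" and sL: "summable (chaos_term ?p ?L)"
    using F H L by (auto simp: test_expansion_def)
  have nn: "0 \<le> (\<Sum>n. chaos_term ?p ?F n)" "0 \<le> (\<Sum>n. chaos_term ?p ?H n)"
    using sF sH by (auto intro: suminf_nonneg chaos_term_nonneg)
  have "(\<Sum>n. chaos_term ?p ?L n) \<le> (\<Sum>n. 2 * a\<^sup>2 * chaos_term ?p ?F n + 2 * b\<^sup>2 * chaos_term ?p ?H n)"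
    using F H by (intro suminf_le sL summable_add summable_mult sF sH chaos_term_lincomb_le)
      (auto simp: test_expansion_def has_chaos_expansion_iff)
  also have "\<dots> = 2 * a\<^sup>2 * (\<Sum>n. chaos_term ?p ?F n) + 2 * b\<^sup>2 * (\<Sum>n. chaos_term ?p ?H n)"
    using sF sH by (simp add: suminf_add[symmetric] suminf_mult summable_mult)
  also have "\<dots> \<le> (2 * \<bar>a\<bar>)\<^sup>2 * (\<Sum>n. chaos_term ?p ?F n) + (2 * \<bar>b\<bar>)\<^sup>2 * (\<Sum>n. chaos_term ?p ?H n)"
    using nn by (intro add_mono mult_right_mono) (auto simp: power_mult_distrib)
  finally have "G_norm p \<mu> (\<lambda>\<omega>. a * \<phi> \<omega> + b * \<psi> \<omega>) \<le>
      sqrt ((2 * \<bar>a\<bar>)\<^sup>2 * (\<Sum>n. chaos_term ?p ?F n) + (2 * \<bar>b\<bar>)\<^sup>2 * (\<Sum>n. chaos_term ?p ?H n))"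
    unfolding test_expansion_G_test(2)[OF L] by (rule real_sqrt_le_mono)
  also have "\<dots> \<le> sqrt ((2 * \<bar>a\<bar>)\<^sup>2 * (\<Sum>n. chaos_term ?p ?F n)) + sqrt ((2 * \<bar>b\<bar>)\<^sup>2 * (\<Sum>n. chaos_term ?p ?H n))"
    using nn by (intro sqrt_add_le_add_sqrt) auto
  also have "\<dots> = 2 * \<bar>a\<bar> * G_norm p \<mu> \<phi> + 2 * \<bar>b\<bar> * G_norm p \<mu> \<psi>"
    by (simp add: G_norm_def real_sqrt_mult)
  finally show "G_norm p \<mu> (\<lambda>\<omega>. a * \<phi> \<omega> + b * \<psi> \<omega>) \<le> 2 * \<bar>a\<bar> * G_norm p \<mu> \<phi> + 2 * \<bar>b\<bar> * G_norm p \<mu> \<psi>" .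
qed

end

section \<open>Negligible sequences and their classes\<close>

text \<open>Rapid decay as a family of estimates.  A bound of order \<open>k + 1\<close> makes the sequence weighted with
  \<open>exp (n k)\<close> tend to \<open>0\<close>, and the bound of order \<open>1\<close> gives square summability.\<close>

lemma seq_e_iff_bound: "a \<in> seq_e \<longleftrightarrow> (\<forall>k::nat. \<exists>C. \<forall>n. \<bar>a n\<bar> \<le> C * exp (- (real n * real k)))"
proof
  assume a: "a \<in> seq_e"
  show "\<forall>k::nat. \<exists>C. \<forall>n. \<bar>a n\<bar> \<le> C * exp (- (real n * real k))"
  proof
    fix k :: nat
    have "(\<lambda>n. exp (real n * real k) * a n) \<longlonglongrightarrow> 0" using a by (simp add: seq_e_def)
    then have "Bseq (\<lambda>n. exp (real n * real k) * a n)" by (intro convergent_imp_Bseq convergentI)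
    then obtain C where C: "\<And>n. norm (exp (real n * real k) * a n) \<le> C" unfolding Bseq_def by blast
    have "\<bar>a n\<bar> \<le> C * exp (- (real n * real k))" for n
    proof -
      have "\<bar>a n\<bar> * exp (real n * real k) \<le> C" using C[of n] by (simp only: real_norm_def abs_mult abs_exp_cancel mult.commute)
      then show ?thesis by (simp only: exp_minus divide_inverse[symmetric] pos_le_divide_eq exp_gt_zero)
    qed
    then show "\<exists>C. \<forall>n. \<bar>a n\<bar> \<le> C * exp (- (real n * real k))" by blast
  qed
next
  assume R: "\<forall>k::nat. \<exists>C. \<forall>n. \<bar>a n\<bar> \<le> C * exp (- (real n * real k))"
  have geo: "exp (- real n) = exp (- 1) ^ n" for n :: nat
    by (simp flip: exp_of_nat_mult)
  have "(\<lambda>n. exp (real n * real m) * a n) \<longlonglongrightarrow> 0" for m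
  proof -
    obtain C where C: "\<And>n. \<bar>a n\<bar> \<le> C * exp (- (real n * real (Suc m)))" using R by blast
    have "norm (exp (real n * real m) * a n) \<le> C * exp (- 1) ^ n" for n
    proof -
      have "norm (exp (real n * real m) * a n) \<le> exp (real n * real m) * (C * exp (- (real n * real (Suc m))))"
        unfolding norm_mult using C[of n] by (intro mult_mono) auto
      also have "\<dots> = C * (exp (real n * real m) * exp (- (real n * real (Suc m))))" by simp
      also have "exp (real n * real m) * exp (- (real n * real (Suc m))) = exp (- real n)"
        by (simp add: exp_add[symmetric] algebra_simps)
      finally show ?thesis by (simp only: geo)
    qed
    moreover have "(\<lambda>n. C * exp (- 1) ^ n) \<longlonglongrightarrow> 0"
      by (intro tendsto_mult_right_zero LIMSEQ_power_zero) simp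
    ultimately show ?thesis by (rule Lim_null_comparison[OF always_eventually, rule_format])
  qed
  moreover have "summable (\<lambda>n. (a n)\<^sup>2)"
  proof -
    obtain C where C: "\<And>n. \<bar>a n\<bar> \<le> C * exp (- (real n * real 1))" using R by blast
    have le: "(a n)\<^sup>2 \<le> C\<^sup>2 * (exp (- 1) ^ 2) ^ n" for n
    proof -
      have "\<bar>a n\<bar>\<^sup>2 \<le> (C * exp (- 1) ^ n)\<^sup>2"
        using C[of n] geo[of n] by (intro power_mono) auto
      then show ?thesis by (simp add: power_mult_distrib mult.commute flip: power_mult)
    qed
    have "exp (- 1 :: real) ^ 2 < 1" by (simp add: power_less_one_iff abs_square_less_1)
    then have "summable (\<lambda>n. C\<^sup>2 * (exp (- 1) ^ 2) ^ n)"
      by (intro summable_mult summable_geometric) simp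
    then show ?thesis by (rule summable_comparison_test'[of _ 0]) (use le in auto)
  qed
  ultimately show "a \<in> seq_e" by (simp add: seq_e_def)
qed

context white_noise_space
begin

lemma G_e_lincomb:
  assumes \<phi>: "\<phi> \<in> G_e \<mu>" and \<psi>: "\<psi> \<in> G_e \<mu>"
  shows "(\<lambda>m \<omega>. a * \<phi> m \<omega> + b * \<psi> m \<omega>) \<in> G_e \<mu>"
proof -
  have G: "\<phi> m \<in> G_test \<mu>" "\<psi> m \<in> G_test \<mu>" for m using \<phi> \<psi> by (auto simp: G_e_def)
  have "(\<lambda>m. G_norm p \<mu> (\<lambda>\<omega>. a * \<phi> m \<omega> + b * \<psi> m \<omega>)) \<in> seq_e" for p
    unfolding seq_e_iff_bound
  proof
    fix k
    obtain C where C: "\<And>m. \<bar>G_norm p \<mu> (\<phi> m)\<bar> \<le> C * exp (- (real m * real k))"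
      using \<phi> unfolding G_e_def seq_e_iff_bound by blast
    obtain D where D: "\<And>m. \<bar>G_norm p \<mu> (\<psi> m)\<bar> \<le> D * exp (- (real m * real k))"
      using \<psi> unfolding G_e_def seq_e_iff_bound by blast
    have "\<bar>G_norm p \<mu> (\<lambda>\<omega>. a * \<phi> m \<omega> + b * \<psi> m \<omega>)\<bar> \<le>
        (2 * \<bar>a\<bar> * C + 2 * \<bar>b\<bar> * D) * exp (- (real m * real k))" for m
    proof -
      have "\<bar>G_norm p \<mu> (\<lambda>\<omega>. a * \<phi> m \<omega> + b * \<psi> m \<omega>)\<bar> \<le>
          2 * \<bar>a\<bar> * G_norm p \<mu> (\<phi> m) + 2 * \<bar>b\<bar> * G_norm p \<mu> (\<psi> m)"
        using G_norm_nonneg[OF G_norm_lincomb_le(1)[OF G], of p a m b m] G_norm_lincomb_le(2)[OF G, of p a m b m]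
        by simp
      also have "\<dots> \<le> 2 * \<bar>a\<bar> * (C * exp (- (real m * real k))) + 2 * \<bar>b\<bar> * (D * exp (- (real m * real k)))"
        using C[of m] D[of m] by (intro add_mono mult_left_mono) auto
      finally show ?thesis by (simp add: algebra_simps)
    qed
    then show "\<exists>C. \<forall>m. \<bar>G_norm p \<mu> (\<lambda>\<omega>. a * \<phi> m \<omega> + b * \<psi> m \<omega>)\<bar> \<le> C * exp (- (real m * real k))" by blast
  qed
  then show ?thesis using G_norm_lincomb_le(1)[OF G] by (simp add: G_e_def)
qed

lemma G_e_add: "\<phi> \<in> G_e \<mu> \<Longrightarrow> \<psi> \<in> G_e \<mu> \<Longrightarrow> (\<lambda>m \<omega>. \<phi> m \<omega> + \<psi> m \<omega>) \<in> G_e \<mu>"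
  using G_e_lincomb[of \<phi> \<psi> 1 1] by simp

lemma G_e_diff: "\<phi> \<in> G_e \<mu> \<Longrightarrow> \<psi> \<in> G_e \<mu> \<Longrightarrow> (\<lambda>m \<omega>. \<phi> m \<omega> - \<psi> m \<omega>) \<in> G_e \<mu>"
  using G_e_lincomb[of \<phi> \<psi> 1 "-1"] by simp

lemma G_e_scale: "\<phi> \<in> G_e \<mu> \<Longrightarrow> (\<lambda>m \<omega>. c * \<phi> m \<omega>) \<in> G_e \<mu>"
  using G_e_lincomb[of \<phi> \<phi> c 0] by simp

text \<open>Since Wiener integrals are linear only almost surely, the linearity of the embedding needs
  sequences of null functions to be negligible.\<close>

lemma G_e_null:
  assumes L2: "\<And>m. \<phi> m \<in> L2 \<mu>" and null: "\<And>m. AE \<omega> in \<mu>. \<phi> m \<omega> = 0"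
  shows "\<phi> \<in> G_e \<mu>"
proof -
  have "chaos_term p (\<lambda>n (x :: nat \<Rightarrow> 'a). 0) = (\<lambda>n. 0)" for p :: int
    by (simp add: fun_eq_iff chaos_term_def L2_zero)
  then have "test_expansion (\<phi> m) (\<lambda>n x. 0)" for m
    using has_chaos_expansion_null[OF L2 null] L2 by (simp add: test_expansion_def)
  from test_expansion_G_test[OF this] have "\<phi> m \<in> G_test \<mu>" "G_norm p \<mu> (\<phi> m) = 0" for m p
    by (simp_all add: chaos_term_def L2_zero)
  then show ?thesis by (simp add: G_e_def seq_e_def)
qed

lemma G_e_zero: "(\<lambda>m \<omega>. 0) \<in> G_e \<mu>"
  by (rule G_e_null) (auto simp: L2_zero)

lemma gen_class_eq: "gen_class \<mu> \<phi> = {\<lambda>m \<omega>. \<gamma> m \<omega> + \<phi> m \<omega> | \<gamma>. \<gamma> \<in> G_e \<mu>}"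
  by (auto simp: gen_class_def a_r_coset_def r_coset_def G_e'_algebra_def)

lemma gen_class_eq_iff: "gen_class \<mu> \<phi> = gen_class \<mu> \<psi> \<longleftrightarrow> (\<lambda>m \<omega>. \<phi> m \<omega> - \<psi> m \<omega>) \<in> G_e \<mu>"
proof
  assume "gen_class \<mu> \<phi> = gen_class \<mu> \<psi>"
  moreover have "\<phi> \<in> gen_class \<mu> \<phi>"
    unfolding gen_class_eq using G_e_zero by (intro CollectI exI[of _ "\<lambda>m \<omega>. 0"]) auto
  ultimately obtain \<gamma> where "\<gamma> \<in> G_e \<mu>" "\<phi> = (\<lambda>m \<omega>. \<gamma> m \<omega> + \<psi> m \<omega>)"
    unfolding gen_class_eq by auto
  then show "(\<lambda>m \<omega>. \<phi> m \<omega> - \<psi> m \<omega>) \<in> G_e \<mu>" by simp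
next
  assume D: "(\<lambda>m \<omega>. \<phi> m \<omega> - \<psi> m \<omega>) \<in> G_e \<mu>"
  show "gen_class \<mu> \<phi> = gen_class \<mu> \<psi>"
  proof (intro subset_antisym subsetI)
    fix \<xi> assume "\<xi> \<in> gen_class \<mu> \<phi>"
    then obtain \<gamma> where \<gamma>: "\<gamma> \<in> G_e \<mu>" "\<xi> = (\<lambda>m \<omega>. \<gamma> m \<omega> + \<phi> m \<omega>)" unfolding gen_class_eq by auto
    show "\<xi> \<in> gen_class \<mu> \<psi>"
      unfolding gen_class_eq using G_e_add[OF \<gamma>(1) D]
      by (intro CollectI exI[of _ "\<lambda>m \<omega>. \<gamma> m \<omega> + (\<phi> m \<omega> - \<psi> m \<omega>)"]) (auto simp: \<gamma>)
  next
    fix \<xi> assume "\<xi> \<in> gen_class \<mu> \<psi>"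
    then obtain \<gamma> where \<gamma>: "\<gamma> \<in> G_e \<mu>" "\<xi> = (\<lambda>m \<omega>. \<gamma> m \<omega> + \<psi> m \<omega>)" unfolding gen_class_eq by auto
    show "\<xi> \<in> gen_class \<mu> \<phi>"
      unfolding gen_class_eq using G_e_diff[OF \<gamma>(1) D]
      by (intro CollectI exI[of _ "\<lambda>m \<omega>. \<gamma> m \<omega> - (\<phi> m \<omega> - \<psi> m \<omega>)"]) (auto simp: \<gamma>)
  qed
qed

lemma gen_class_add:
  "gen_class \<mu> \<phi> \<oplus>\<^bsub>gen_algebra \<mu>\<^esub> gen_class \<mu> \<psi> = gen_class \<mu> (\<lambda>m \<omega>. \<phi> m \<omega> + \<psi> m \<omega>)"
proof -
  have "gen_class \<mu> \<phi> \<oplus>\<^bsub>gen_algebra \<mu>\<^esub> gen_class \<mu> \<psi> =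
      {\<lambda>m \<omega>. \<xi> m \<omega> + \<eta> m \<omega> | \<xi> \<eta>. \<xi> \<in> gen_class \<mu> \<phi> \<and> \<eta> \<in> gen_class \<mu> \<psi>}"
    by (auto simp: gen_algebra_def ring.defs FactRing_def set_add_def set_mult_def G_e'_algebra_def)
  also have "\<dots> = gen_class \<mu> (\<lambda>m \<omega>. \<phi> m \<omega> + \<psi> m \<omega>)"
  proof (intro subset_antisym subsetI)
    fix \<zeta> assume "\<zeta> \<in> {\<lambda>m \<omega>. \<xi> m \<omega> + \<eta> m \<omega> | \<xi> \<eta>. \<xi> \<in> gen_class \<mu> \<phi> \<and> \<eta> \<in> gen_class \<mu> \<psi>}"
    then obtain \<gamma> \<delta> where *: "\<gamma> \<in> G_e \<mu>" "\<delta> \<in> G_e \<mu>"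
      "\<zeta> = (\<lambda>m \<omega>. (\<gamma> m \<omega> + \<phi> m \<omega>) + (\<delta> m \<omega> + \<psi> m \<omega>))"
      unfolding gen_class_eq by auto
    show "\<zeta> \<in> gen_class \<mu> (\<lambda>m \<omega>. \<phi> m \<omega> + \<psi> m \<omega>)"
      unfolding gen_class_eq using G_e_add[OF *(1,2)]
      by (intro CollectI exI[of _ "\<lambda>m \<omega>. \<gamma> m \<omega> + \<delta> m \<omega>"]) (auto simp: * add_ac)
  next
    fix \<zeta> assume "\<zeta> \<in> gen_class \<mu> (\<lambda>m \<omega>. \<phi> m \<omega> + \<psi> m \<omega>)"
    then obtain \<gamma> where *: "\<gamma> \<in> G_e \<mu>" "\<zeta> = (\<lambda>m \<omega>. \<gamma> m \<omega> + (\<phi> m \<omega> + \<psi> m \<omega>))"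
      unfolding gen_class_eq by auto
    have 1: "(\<lambda>m \<omega>. \<gamma> m \<omega> + \<phi> m \<omega>) \<in> gen_class \<mu> \<phi>" unfolding gen_class_eq using *(1) by blast
    have 2: "(\<lambda>m \<omega>. 0 + \<psi> m \<omega>) \<in> gen_class \<mu> \<psi>"
      unfolding gen_class_eq using G_e_zero by (intro CollectI exI[of _ "\<lambda>m \<omega>. 0"]) auto
    show "\<zeta> \<in> {\<lambda>m \<omega>. \<xi> m \<omega> + \<eta> m \<omega> | \<xi> \<eta>. \<xi> \<in> gen_class \<mu> \<phi> \<and> \<eta> \<in> gen_class \<mu> \<psi>}"
      by (rule CollectI, rule exI[of _ "\<lambda>m \<omega>. \<gamma> m \<omega> + \<phi> m \<omega>"], rule exI[of _ "\<lambda>m \<omega>. 0 + \<psi> m \<omega>"],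
          intro conjI 1 2) (simp add: * add_ac)
  qed
  finally show ?thesis .
qed

text \<open>All members of the union are the same class because \<open>G_e\<close> is a subspace, and the union is not
  empty.\<close>

lemma gen_class_smult:
  "c \<odot>\<^bsub>gen_algebra \<mu>\<^esub> gen_class \<mu> \<phi> = gen_class \<mu> (\<lambda>m \<omega>. c * \<phi> m \<omega>)"
proof -
  have "c \<odot>\<^bsub>gen_algebra \<mu>\<^esub> gen_class \<mu> \<phi> = (\<Union>\<xi>\<in>gen_class \<mu> \<phi>. gen_class \<mu> (\<lambda>m \<omega>. c * \<xi> m \<omega>))"
    by (simp add: gen_algebra_def ring.defs module.defs G_e'_algebra_def)
  also have "\<dots> = (\<Union>\<xi>\<in>gen_class \<mu> \<phi>. gen_class \<mu> (\<lambda>m \<omega>. c * \<phi> m \<omega>))"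
  proof (intro SUP_cong refl)
    fix \<xi> assume "\<xi> \<in> gen_class \<mu> \<phi>"
    then obtain \<gamma> where \<gamma>: "\<gamma> \<in> G_e \<mu>" "\<xi> = (\<lambda>m \<omega>. \<gamma> m \<omega> + \<phi> m \<omega>)" unfolding gen_class_eq by auto
    then show "gen_class \<mu> (\<lambda>m \<omega>. c * \<xi> m \<omega>) = gen_class \<mu> (\<lambda>m \<omega>. c * \<phi> m \<omega>)"
      unfolding gen_class_eq_iff using G_e_scale[OF \<gamma>(1), of c] by (simp add: \<gamma>(2) algebra_simps)
  qed
  also have "\<dots> = gen_class \<mu> (\<lambda>m \<omega>. c * \<phi> m \<omega>)"
  proof -
    have "gen_class \<mu> \<phi> \<noteq> {}" unfolding gen_class_eq using G_e_zero by blast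
    then show ?thesis by simp
  qed
  finally show ?thesis .
qed

lemma gen_class_carrier: "\<phi> \<in> G_e' \<mu> \<Longrightarrow> gen_class \<mu> \<phi> \<in> carrier (gen_algebra \<mu>)"
  by (auto simp: gen_algebra_def ring.defs FactRing_def A_RCOSETS_def RCOSETS_def gen_class_def
      a_r_coset_def G_e'_algebra_def)

section \<open>Truncated chaos series\<close>

lemma test_expansion_chaos_sum:
  assumes F: "\<And>n. F n \<in> L2_sym n"
  shows "test_expansion (chaos_sum m F) (cut_kernels m F)"
proof -
  have "summable (chaos_term p (cut_kernels m F))" for p
    by (rule summable_finite[of "{..m}"]) (auto simp: chaos_term_cut)
  then show ?thesis
    unfolding test_expansion_def by (intro conjI allI chaos_sum_L2 has_chaos_expansion_chaos_sum F)
qed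

lemma G_norm_chaos_sum:
  assumes F: "\<And>n. F n \<in> L2_sym n"
  shows "G_norm p \<mu> (chaos_sum m F) = sqrt (\<Sum>n\<le>m. chaos_term (int p) F n)"
proof -
  have "(\<Sum>n. chaos_term (int p) (cut_kernels m F) n) = (\<Sum>n\<le>m. chaos_term (int p) (cut_kernels m F) n)"
    by (rule suminf_finite) (auto simp: chaos_term_cut)
  also have "\<dots> = (\<Sum>n\<le>m. chaos_term (int p) F n)" by (simp add: chaos_term_cut)
  finally show ?thesis unfolding test_expansion_G_test(2)[OF test_expansion_chaos_sum[OF F]] by simp
qed

text \<open>If \<open>\<parallel>F\<parallel>\<^sub>-\<^sub>q\<close> is finite, then
  \<open>\<parallel>\<Pi>\<^sub>m F\<parallel>\<^sub>p\<^sup>2 \<le> exp (2 (p + q) m) \<parallel>F\<parallel>\<^sub>-\<^sub>q\<^sup>2\<close>: on the orders up to \<open>m\<close> the two weights differ at most by this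
  factor.\<close>

lemma chaos_sum_moderate:
  assumes F: "F \<in> regular_kernels"
  shows "(\<lambda>m. chaos_sum m F) \<in> G_e' \<mu>"
proof -
  have sym: "F n \<in> L2_sym n" for n using F by (simp add: regular_kernels_def)
  obtain q :: nat where s: "summable (chaos_term (- int q) F)" using F by (auto simp: regular_kernels_def)
  let ?S = "\<Sum>n. chaos_term (- int q) F n"
  have "(\<lambda>m. G_norm p \<mu> (chaos_sum m F)) \<in> seq_e'" for p
  proof -
    have "\<bar>G_norm p \<mu> (chaos_sum m F)\<bar> \<le> sqrt ?S * exp (2 * real m * real (p + q))" for m
    proof -
      have "(\<Sum>n\<le>m. chaos_term (int p) F n) =
          (\<Sum>n\<le>m. exp (2 * real (p + q) * real n) * chaos_term (- int q) F n)"
        using chaos_term_shift[of "- int q" "int (p + q)" F] by simp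
      also have "\<dots> \<le> (\<Sum>n\<le>m. exp (2 * real (p + q) * real m) * chaos_term (- int q) F n)"
        by (intro sum_mono mult_right_mono chaos_term_nonneg) (auto intro!: mult_left_mono)
      also have "\<dots> = exp (2 * real (p + q) * real m) * (\<Sum>n\<le>m. chaos_term (- int q) F n)"
        by (simp add: sum_distrib_left)
      also have "\<dots> \<le> exp (2 * real (p + q) * real m) * ?S"
        by (intro mult_left_mono sum_le_suminf s) (auto simp: chaos_term_nonneg)
      also have "\<dots> \<le> (exp (2 * real m * real (p + q)))\<^sup>2 * ?S"
      proof (rule mult_right_mono[OF _ suminf_nonneg[OF s chaos_term_nonneg]])
        have "exp (2 * real m * real (p + q)) \<le> (exp (2 * real m * real (p + q)))\<^sup>2"
          by (rule self_le_power) simp_all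
        then show "exp (2 * real (p + q) * real m) \<le> (exp (2 * real m * real (p + q)))\<^sup>2"
          by (simp only: mult_ac)
      qed
      finally have "sqrt (\<Sum>n\<le>m. chaos_term (int p) F n) \<le> sqrt ((exp (2 * real m * real (p + q)))\<^sup>2 * ?S)"
        by (rule real_sqrt_le_mono)
      then show ?thesis
        by (simp add: G_norm_chaos_sum sym real_sqrt_mult sum_nonneg chaos_term_nonneg mult.commute)
    qed
    then show ?thesis unfolding seq_e'_def by blast
  qed
  then show ?thesis
    using test_expansion_G_test(1)[OF test_expansion_chaos_sum[OF sym]] by (simp add: G_e'_def)
qed

lemma chaos_sum_lincomb_G_e:
  assumes F: "\<And>n. F n \<in> L2_sym n" and H: "\<And>n. H n \<in> L2_sym n"
  shows "(\<lambda>m \<omega>. chaos_sum m (\<lambda>n x. a * F n x + b * H n x) \<omega> - (a * chaos_sum m F \<omega> + b * chaos_sum m H \<omega>)) \<in> G_e \<mu>"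
proof (rule G_e_null)
  fix m
  show "(\<lambda>\<omega>. chaos_sum m (\<lambda>n x. a * F n x + b * H n x) \<omega> - (a * chaos_sum m F \<omega> + b * chaos_sum m H \<omega>)) \<in> L2 \<mu>"
    by (intro L2_diff L2_lincomb chaos_sum_L2 F H L2_sym_linear)
  show "AE \<omega> in \<mu>. chaos_sum m (\<lambda>n x. a * F n x + b * H n x) \<omega> - (a * chaos_sum m F \<omega> + b * chaos_sum m H \<omega>) = 0"
    using chaos_sum_lincomb[OF F H, of m a b] by eventually_elim simp
qed

text \<open>The squared norms \<open>\<parallel>\<Pi>\<^sub>m F\<parallel>\<^sub>0\<^sup>2\<close> increase with \<open>m\<close>, so they can tend to \<open>0\<close> only if all are \<open>0\<close>.\<close>

lemma chaos_sum_negligible_imp_zero: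
  assumes F: "\<And>n. F n \<in> L2_sym n" and neg: "(\<lambda>m. chaos_sum m F) \<in> G_e \<mu>"
  shows "L2_sq (lborel_pow n) (F n) = 0"
proof -
  have "(\<lambda>m. G_norm 0 \<mu> (chaos_sum m F)) \<in> seq_e" using neg by (simp add: G_e_def)
  then have "(\<lambda>m. exp (real m * real 0) * G_norm 0 \<mu> (chaos_sum m F)) \<longlonglongrightarrow> 0"
    unfolding seq_e_def by blast
  then have "(\<lambda>m. (sqrt (\<Sum>n\<le>m. chaos_term 0 F n))\<^sup>2) \<longlonglongrightarrow> 0\<^sup>2"
    by (intro tendsto_power) (simp add: G_norm_chaos_sum F)
  then have "(\<lambda>m. \<Sum>n\<le>m. chaos_term 0 F n) \<longlonglongrightarrow> 0"
    by (simp add: sum_nonneg chaos_term_nonneg)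
  then have "chaos_term 0 F n = 0" by (intro sum_nonneg_tendsto_zero chaos_term_nonneg)
  then show ?thesis by (simp add: chaos_term_zero_iff)
qed

text \<open>The remainder only has orders beyond \<open>m\<close>, where the weight of index \<open>p\<close> is at most
  \<open>exp (- 2 k m)\<close> times the weight of index \<open>p + k\<close>.  As \<open>k\<close> is arbitrary, the remainders are negligible.\<close>

lemma chaos_sum_converges:
  assumes F: "test_expansion \<phi> F"
  shows "(\<lambda>m \<omega>. chaos_sum m F \<omega> - \<phi> \<omega>) \<in> G_e \<mu>"
proof -
  have sym: "F n \<in> L2_sym n" for n using F by (simp add: test_expansion_def has_chaos_expansion_iff)
  let ?R = "\<lambda>m n x. 1 * cut_kernels m F n x + (-1) * F n x"
  have R: "test_expansion (\<lambda>\<omega>. chaos_sum m F \<omega> - \<phi> \<omega>) (?R m)" for m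
    using test_expansion_lincomb[OF test_expansion_chaos_sum[OF sym, of m] F, of 1 "-1"] by simp
  have remainder: "chaos_term p (?R m) n = (if n \<le> m then 0 else chaos_term p F n)" for p m n
    by (simp add: chaos_term_def cut_kernels_def L2_sq_def)
  have "(\<lambda>m. G_norm p \<mu> (\<lambda>\<omega>. chaos_sum m F \<omega> - \<phi> \<omega>)) \<in> seq_e" for p
    unfolding seq_e_iff_bound
  proof
    fix k :: nat
    have s: "summable (chaos_term (int (p + k)) F)" using F unfolding test_expansion_def by blast
    let ?S = "\<Sum>n. chaos_term (int (p + k)) F n"
    have "\<bar>G_norm p \<mu> (\<lambda>\<omega>. chaos_sum m F \<omega> - \<phi> \<omega>)\<bar> \<le> sqrt ?S * exp (- (real m * real k))" for m
    proof -
      have sR: "summable (chaos_term (int p) (?R m))" using R unfolding test_expansion_def by blast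
      have "(\<Sum>n. chaos_term (int p) (?R m) n) \<le>
          (\<Sum>n. (exp (- (real m * real k)))\<^sup>2 * chaos_term (int (p + k)) F n)"
      proof (intro suminf_le sR summable_mult s)
        fix n
        show "chaos_term (int p) (?R m) n \<le> (exp (- (real m * real k)))\<^sup>2 * chaos_term (int (p + k)) F n"
        proof (cases "n \<le> m")
          case True
          then show ?thesis unfolding remainder by (simp add: chaos_term_nonneg)
        next
          case False
          have "chaos_term (int p) F n = exp (- 2 * real k * real n) * chaos_term (int (p + k)) F n"
            using chaos_term_shift[of "int (p + k)" "- int k" F n] by simp
          also have "exp (- 2 * real k * real n) \<le> exp (- 2 * real k * real m)"
            using False by (simp add: mult_left_mono)
          also have "exp (- 2 * real k * real m) = (exp (- (real m * real k)))\<^sup>2"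
            by (simp add: power2_eq_square mult_ac flip: exp_add)
          finally show ?thesis using False unfolding remainder by (simp add: chaos_term_nonneg mult_right_mono)
        qed
      qed
      also have "\<dots> = (exp (- (real m * real k)))\<^sup>2 * ?S" by (rule suminf_mult[OF s])
      finally have "sqrt (\<Sum>n. chaos_term (int p) (?R m) n) \<le> sqrt ((exp (- (real m * real k)))\<^sup>2 * ?S)"
        by (rule real_sqrt_le_mono)
      moreover have "0 \<le> (\<Sum>n. chaos_term (int p) (?R m) n)"
        by (intro suminf_nonneg sR chaos_term_nonneg)
      ultimately show ?thesis
        unfolding test_expansion_G_test(2)[OF R] by (simp add: real_sqrt_mult mult.commute)
    qed
    then show "\<exists>C. \<forall>m. \<bar>G_norm p \<mu> (\<lambda>\<omega>. chaos_sum m F \<omega> - \<phi> \<omega>)\<bar> \<le> C * exp (- (real m * real k))" by blast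
  qed
  then show ?thesis using test_expansion_G_test(1)[OF R] by (simp add: G_e_def)
qed

end

section \<open>The embedding\<close>

lemma Gstar_cases:
  fixes F :: "'a::euclidean_space Gstar"
  obtains K where "K \<in> regular_kernels" "F = abs_Gstar K"
proof -
  have "kernels_eq (rep_Gstar F) (rep_Gstar F)" "F = abs_Gstar (rep_Gstar F)"
    using Quotient3_rep_reflp[OF Quotient3_Gstar] Quotient3_abs_rep[OF Quotient3_Gstar, of F] by simp_all
  then show ?thesis using that by (auto simp: kernels_eq_def)
qed

lemma regular_kernels_L2_sym: "K \<in> regular_kernels \<Longrightarrow> K n \<in> L2_sym n"
  by (simp add: regular_kernels_def)

context white_noise_space
begin

lemma gen_embedding_abs:
  assumes "F \<in> regular_kernels"
  shows "gen_embedding \<mu> (abs_Gstar F) = gen_class \<mu> (\<lambda>m. chaos_sum m F)"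
proof -
  have "kernels_eq F F" using assms by (simp add: kernels_eq_def)
  then have "chaos_truncation \<mu> m (abs_Gstar F) = chaos_sum m F" for m
    by (simp add: chaos_truncation.abs_eq chaos_sum_def[abs_def])
  then show ?thesis by (simp add: gen_embedding_def)
qed

lemma gen_embedding_carrier: "gen_embedding \<mu> F \<in> carrier (gen_algebra \<mu>)"
  by (cases F rule: Gstar_cases) (simp add: gen_embedding_abs gen_class_carrier chaos_sum_moderate)

lemma gen_embedding_add:
  "gen_embedding \<mu> (F + H) = gen_embedding \<mu> F \<oplus>\<^bsub>gen_algebra \<mu>\<^esub> gen_embedding \<mu> H"
proof -
  obtain K L where K: "K \<in> regular_kernels" "F = abs_Gstar K" and L: "L \<in> regular_kernels" "H = abs_Gstar L"
    by (meson Gstar_cases)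
  have "F + H = abs_Gstar (\<lambda>n x. K n x + L n x)"
    using K L by (simp add: plus_Gstar.abs_eq kernels_eq_def)
  moreover have "(\<lambda>n x. K n x + L n x) \<in> regular_kernels"
    using regular_kernels_linear[OF K(1) L(1), of 1 1] by simp
  ultimately show ?thesis
    using chaos_sum_lincomb_G_e[OF regular_kernels_L2_sym regular_kernels_L2_sym, OF K(1) L(1), of 1 1] K L
    by (simp add: gen_embedding_abs gen_class_add gen_class_eq_iff)
qed

lemma gen_embedding_scaleR:
  "gen_embedding \<mu> (c *\<^sub>R F) = c \<odot>\<^bsub>gen_algebra \<mu>\<^esub> gen_embedding \<mu> F"
proof -
  obtain K where K: "K \<in> regular_kernels" "F = abs_Gstar K" by (rule Gstar_cases)
  have "c *\<^sub>R F = abs_Gstar (\<lambda>n x. c * K n x)"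
    using K by (simp add: scaleR_Gstar.abs_eq kernels_eq_def)
  moreover have "(\<lambda>n x. c * K n x) \<in> regular_kernels"
    using regular_kernels_linear[OF K(1) K(1), of c 0] by simp
  ultimately show ?thesis
    using chaos_sum_lincomb_G_e[OF regular_kernels_L2_sym regular_kernels_L2_sym, OF K(1) K(1), of c 0] K
    by (simp add: gen_embedding_abs gen_class_smult gen_class_eq_iff)
qed

text \<open>If two partial sums differ by a negligible sequence, then so does the sequence of partial sums
  of the difference from \<open>0\<close>, and its kernels vanish.\<close>

lemma inj_gen_embedding: "inj (gen_embedding \<mu>)"
proof (rule injI)
  fix F H :: "'a Gstar" assume eq: "gen_embedding \<mu> F = gen_embedding \<mu> H"
  obtain K L where K: "K \<in> regular_kernels" "F = abs_Gstar K" and L: "L \<in> regular_kernels" "H = abs_Gstar L"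
    by (meson Gstar_cases)
  let ?D = "\<lambda>n x. 1 * K n x + (-1) * L n x"
  have sym: "K n \<in> L2_sym n" "L n \<in> L2_sym n" for n using K L by (auto intro: regular_kernels_L2_sym)
  have D: "?D n \<in> L2_sym n" for n by (rule L2_sym_linear[OF sym])
  have "(\<lambda>m \<omega>. chaos_sum m K \<omega> - chaos_sum m L \<omega>) \<in> G_e \<mu>"
    using eq K L by (simp add: gen_embedding_abs gen_class_eq_iff)
  from G_e_add[OF chaos_sum_lincomb_G_e[OF sym, of 1 "-1"] this] have "(\<lambda>m. chaos_sum m ?D) \<in> G_e \<mu>"
    by simp
  from chaos_sum_negligible_imp_zero[OF D this]
  have "AE x in lborel_pow n. K n x = L n x" for n
    by (intro L2_sq_diff_zero_AE L2_sym_L2 sym) simp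
  then have "kernels_eq K L" using K L by (simp add: kernels_eq_def)
  then show "F = H" using K L Quotient3_rel_abs[OF Quotient3_Gstar] by blast
qed

lemma gen_embedding_test:
  assumes "\<phi> \<in> G_test \<mu>"
  shows "gen_embedding \<mu> (Gstar_of \<mu> \<phi>) = gen_class \<mu> (\<lambda>m. \<phi>)"
proof -
  let ?K = "chaos_kernels \<mu> \<phi>"
  have K: "test_expansion \<phi> ?K" by (rule test_expansion_chaos_kernels[OF assms])
  have "summable (chaos_term (- int 0) ?K)" using K unfolding test_expansion_def by (metis of_nat_0 minus_zero)
  then have "?K \<in> regular_kernels"
    using K unfolding regular_kernels_def test_expansion_def has_chaos_expansion_def by blast
  then show ?thesis
    using chaos_sum_converges[OF K] by (simp add: Gstar_of_def gen_embedding_abs gen_class_eq_iff)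
qed

end

theorem proposition5:
  fixes \<mu> :: "('a::euclidean_space schwartz \<Rightarrow> real) measure"
  assumes "white_noise \<mu>"
  shows "(\<forall>F. gen_embedding \<mu> F \<in> carrier (gen_algebra \<mu>)) \<and>
    (\<forall>F H. gen_embedding \<mu> (F + H) = gen_embedding \<mu> F \<oplus>\<^bsub>gen_algebra \<mu>\<^esub> gen_embedding \<mu> H) \<and>
    (\<forall>c F. gen_embedding \<mu> (c *\<^sub>R F) = c \<odot>\<^bsub>gen_algebra \<mu>\<^esub> gen_embedding \<mu> F) \<and>
    inj (gen_embedding \<mu>) \<and>
    (\<forall>\<phi>\<in>G_test \<mu>. gen_embedding \<mu> (Gstar_of \<mu> \<phi>) = gen_class \<mu> (\<lambda>m. \<phi>))"
proof -
  interpret white_noise_space \<mu> by standard (rule assms)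
  show ?thesis
    by (intro conjI allI ballI gen_embedding_carrier gen_embedding_add gen_embedding_scaleR
        inj_gen_embedding gen_embedding_test)
qed

end
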